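(* Let $\mu$ be a non-zero integer. Then for all real $x>0$ $$P_{\mu}(x)=\frac{(-1)^{\mu+1}}{4}\Bigg(\pi\left(Y_0(x)J_{\mu}(x)+J_0(x)Y_{\mu}(x)\right)+\sqrt{\pi}\,\mu^2\,G_{2,4}^{3,0}\left(x^2\,\middle|\,\begin{array}{c}\frac12,\,1\\ -\frac{\mu}{2},\,\frac{\mu}{2},\,\frac{\mu}{2},\,-\frac{\mu}{2}\end{array}\right)+\sqrt{\pi}\,(1-\mu^2)\,x\,G_{2,4}^{3,0}\left(x^2\,\middle|\,\begin{array}{c}-\frac12,\,1\\ -\frac{\mu+1}{2},\,\frac{\mu-1}{2},\,\frac{\mu-1}{2},\,-\frac{\mu+1}{2}\end{array}\right)\Bigg).$$
   Context: $J_p(x)$ and $Y_p(x)$ are the Bessel functions of the first and second kind of order $p$. A hat denotes the derivative with respect to the order: for an integer $k$ and $x>0$, $\hat{J}_k(x)=\left.\frac{\partial}{\partial p}J_p(x)\right|_{p=k}$. For an integer $\mu$ and $x>0$ define $$P_{\mu}(x)=\sum_{n=1}^{\infty}n\left[\left(\hat{J}_{n-\mu}(x)J_{n}(x)+J_{n-\mu}(x)\hat{J}_{n}(x)\right)+(-1)^{\mu}\left(\hat{J}_{n+\mu}(x)J_{n}(x)+J_{n+\mu}(x)\hat{J}_{n}(x)\right)\right].$$ $G$ denotes the Meijer G function in its standard normalization; in the case used here, for $z>0$, $$G_{2,4}^{3,0}\left(z\,\middle|\,\begin{array}{c}a_1,a_2\\ b_1,b_2,b_3,b_4\end{array}\right)=\frac{1}{2\pi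 i}\int_L\frac{\Gamma(b_1+s)\Gamma(b_2+s)\Gamma(b_3+s)}{\Gamma(a_1+s)\Gamma(a_2+s)\Gamma(1-b_4-s)}\,z^{-s}\,ds,$$ where $L$ is a loop beginning and ending at $-\infty$ that encircles all poles of $\Gamma(b_j+s)$, $j=1,2,3$, once counterclockwise (so the value is the sum of the residues of the integrand at these poles). *)

theory Defs
  imports "HOL-Complex_Analysis.Complex_Analysis"
begin

text \<open>
  Bessel functions of complex order \<open>p\<close>. The powers are principal values, so the formulas are
  meant for \<open>z\<close> off the nonpositive real axis. The reciprocal Gamma function \<^term>\<open>rGamma\<close> is
  entire, so nonpositive integer values of \<open>m + p + 1\<close> are covered.
\<close>

definition bessel_J :: "complex \<Rightarrow> complex \<Rightarrow> complex" where
  "bessel_J p z =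
     (\<Sum>m. (-1) ^ m * rGamma (of_nat m + p + 1) / fact m * (z / 2) powr (2 * of_nat m + p))"

definition bessel_Y_quot :: "complex \<Rightarrow> complex \<Rightarrow> complex" where
  "bessel_Y_quot p z =
     (bessel_J p z * cos (p * of_real pi) - bessel_J (- p) z) / sin (p * of_real pi)"

definition bessel_Y :: "complex \<Rightarrow> complex \<Rightarrow> complex" where
  "bessel_Y p z =
     (if p \<in> \<int> then Lim (at p) (\<lambda>q. bessel_Y_quot q z) else bessel_Y_quot p z)"

definition bessel_J_hat :: "int \<Rightarrow> complex \<Rightarrow> complex" where
  "bessel_J_hat k z = deriv (\<lambda>p. bessel_J p z) (of_int k)"

definition bessel_P_term :: "int \<Rightarrow> complex \<Rightarrow> nat \<Rightarrow> complex" where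
  "bessel_P_term \<mu> z n = of_nat n *
     ((bessel_J_hat (int n - \<mu>) z * bessel_J (of_nat n) z
       + bessel_J (of_int (int n - \<mu>)) z * bessel_J_hat (int n) z)
      + (-1) powi \<mu> *
        (bessel_J_hat (int n + \<mu>) z * bessel_J (of_nat n) z
         + bessel_J (of_int (int n + \<mu>)) z * bessel_J_hat (int n) z))"

definition bessel_P :: "int \<Rightarrow> complex \<Rightarrow> complex" where
  "bessel_P \<mu> z = (\<Sum>n. bessel_P_term \<mu> z (Suc n))"

definition meijer_G_integrand ::
  "complex \<Rightarrow> complex \<Rightarrow> complex \<Rightarrow> complex \<Rightarrow> complex \<Rightarrow> complex \<Rightarrow> complex \<Rightarrow> complex \<Rightarrow> complex"
where
  "meijer_G_integrand a1 a2 b1 b2 b3 b4 z s =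
     Gamma (b1 + s) * Gamma (b2 + s) * Gamma (b3 + s)
       * rGamma (a1 + s) * rGamma (a2 + s) * rGamma (1 - b4 - s) * z powr (- s)"

text \<open>
  The part in \<open>Re s \<ge> -T\<close> of a loop that comes in from \<open>-\<infinity>\<close> along \<open>Im s = -d\<close>, crosses to
  \<open>Im s = d\<close> along \<open>Re s = c\<close>, and returns to \<open>-\<infinity>\<close>.
\<close>

definition truncated_loop :: "real \<Rightarrow> real \<Rightarrow> real \<Rightarrow> real \<Rightarrow> complex" where
  "truncated_loop c d T =
     linepath (Complex (- T) (- d)) (Complex c (- d))
     +++ linepath (Complex c (- d)) (Complex c d)
     +++ linepath (Complex c d) (Complex (- T) d)"

text \<open>
  The poles of \<open>Gamma (b + s)\<close> in \<open>s\<close> are the points \<open>-b - k\<close> with \<open>k\<close> a natural number. The choice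
  of \<open>c\<close> and \<open>d\<close> below puts all of them, for \<open>b1\<close>, \<open>b2\<close>, \<open>b3\<close>, inside the loop; by Cauchy's
  theorem any larger \<open>c\<close> and \<open>d\<close> give the same value.
\<close>

definition meijer_G_3_0_2_4 ::
  "complex \<Rightarrow> complex \<Rightarrow> complex \<Rightarrow> complex \<Rightarrow> complex \<Rightarrow> complex \<Rightarrow> complex \<Rightarrow> complex"
where
  "meijer_G_3_0_2_4 z a1 a2 b1 b2 b3 b4 =
     (let c = 1 + Max {- Re b1, - Re b2, - Re b3};
          d = 1 + Max {\<bar>Im b1\<bar>, \<bar>Im b2\<bar>, \<bar>Im b3\<bar>}
      in Lim at_top (\<lambda>T. contour_integral (truncated_loop c d T)
                           (meijer_G_integrand a1 a2 b1 b2 b3 b4 z))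
           / (2 * of_real pi * \<i>))"

end

theory Submission
  imports Defs
begin

text \<open>
  Everything is expanded in powers of \<open>x/2\<close>. The product \<open>J\<^sub>a J\<^sub>b\<close> has coefficients
  \<open>(-1)\<^sup>k (a + b + 2k choose k) / (\<Gamma>(a + k + 1) \<Gamma>(b + k + 1))\<close>, so summing
  \<open>n J\<^bsub>n-\<mu>+p\<^esub> J\<^bsub>n+p\<^esub>\<close> over \<open>n\<close> along a fixed power \<open>A\<close> of \<open>x/2\<close> is an alternating weighted
  binomial sum, which collapses to a single coefficient \<open>(A - 2 choose N - 1)\<close>. The same powers with
  \<open>(A choose N)\<close> make up \<open>\<pi> (Y\<^sub>0 J\<^sub>\<mu> + J\<^sub>0 Y\<^sub>\<mu>)\<close>, which is an order derivative of
  \<open>J\<^sub>p J\<^bsub>p+\<mu>\<^esub> + (-1)\<^sup>\<mu> J\<^sub>p J\<^bsub>p-\<mu>\<^esub>\<close>. Adding the contributions of \<open>\<mu>\<close> and \<open>-\<mu>\<close>, both derivatives in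
  \<open>p\<close> turn into derivatives in \<open>A\<close> of one function of \<open>A\<close>.

  By the reflection formula the Meijer integrands are \<open>cos (\<pi>u) / sin\<^sup>2 (\<pi>u)\<close> times that function divided
  by \<open>A\<close> and \<open>A - 1\<close>, so that their residues are again derivatives, and the theorem reduces to
  \<open>A (A - 1) + \<mu>\<^sup>2 (A - 1) + (1 - \<mu>\<^sup>2) A = A\<^sup>2 - \<mu>\<^sup>2\<close>. At powers where the Gamma factors degenerate,
  the identities between coefficients are obtained as limits.
\<close>

section \<open>Products of Bessel series\<close>

text \<open>Shifting both orders by one parameter \<open>p\<close> turns each pair of product-rule
  terms into a single derivative at \<open>p = 0\<close>. The double sum over \<open>n\<close> and
  the series index may then be rearranged along powers because all coefficients are bounded
  uniformly on the closed unit disc in \<open>p\<close>: by Cauchy's inequality on that disc the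
  same bounds hold for the derivatives.

  For fixed \<open>N\<close> the signs of \<open>\<mu>\<close> contribute two binomials whose lower
  indices \<open>j\<close>, \<open>l\<close> add up to their common upper argument at
  \<open>p = 0\<close>. As functions of \<open>p\<close> they do not sum to the Gamma quotient used
  later; values and first derivatives at \<open>0\<close> agree, and only these enter.

  With \<open>u = N - M + p\<close>, \<open>M = \<bar>\<mu>\<bar>\<close>, the expansion index is
  also the variable of the loop integral: the \<open>N\<close>-th pole is \<open>u = N - M\<close>.
  At negative integers the Gamma factors have poles cancelled by zeros elsewhere. Hence functions
  are kept in a form holomorphic on balls of radius \<open>1/2\<close> about the integers, their
  Gamma formulas are proved only where \<open>2 * u\<close> is not an integer, and derivatives are
  compared by continuity.\<close>

lemma summable_power_over_fact_diff:
  fixes y :: real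
  shows "summable (\<lambda>n. y ^ n / fact (n - L))"
proof -
  have "summable (\<lambda>n. y ^ L * (inverse (fact n) * y ^ n))"
    by (intro summable_mult summable_exp)
  then have "summable (\<lambda>n. y ^ (n + L) / fact (n + L - L))"
    by (simp add: field_simps power_add)
  then show ?thesis
    using summable_iff_shift[of "\<lambda>n. y ^ n / fact (n - L)" L] by simp
qed

text \<open>Once the argument has real part at least 1, \<open>pochhammer q k\<close> dominates
  \<open>fact k\<close>, and the recurrence of \<open>rGamma\<close> turns this into factorial
  decay. The finitely many indices up to \<open>L\<close> are handled by compactness; for them the
  truncated \<open>m - L\<close> leaves the plain bound \<open>C\<close>.\<close>

lemma rGamma_shift_bound:
  fixes c :: complex
  obtains C L where "C > 0"
    "\<And>m p. norm p \<le> 1 \<Longrightarrow> norm (rGamma (of_nat m + c + p)) \<le> C / fact (m - L)"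
proof -
  \<comment> \<open>The margin 2 leaves real part at least 1 after adding any \<open>p\<close> of
    norm at most 1.\<close>
  obtain L :: nat where L: "real L \<ge> 2 - Re c"
    using real_arch_simple by blast
  have "compact ((\<lambda>p. rGamma (of_nat j + c + p)) ` cball 0 1)" for j :: nat
    by (intro compact_continuous_image holomorphic_on_imp_continuous_on holomorphic_intros compact_cball)
  then have "\<exists>C. \<forall>p\<in>cball 0 1. norm (rGamma (of_nat j + c + p)) \<le> C" for j :: nat
    by (metis (no_types, lifting) bounded_iff compact_imp_bounded imageI)
  then obtain D where D: "\<And>j p. norm p \<le> 1 \<Longrightarrow> norm (rGamma (of_nat j + c + p)) \<le> D j"
    by (metis mem_cball_0)
  define C where "C = 1 + (\<Sum>j\<le>L. \<bar>D j\<bar>)"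
  have "C > 0"
    unfolding C_def by (smt (verit) sum_nonneg abs_ge_zero)
  have le_C: "norm (rGamma (of_nat j + c + p)) \<le> C" if "j \<le> L" "norm p \<le> 1" for j p
  proof -
    have "\<bar>D j\<bar> \<le> (\<Sum>j\<le>L. \<bar>D j\<bar>)"
      using that by (intro member_le_sum) auto
    with D[of p j] that show ?thesis unfolding C_def by linarith
  qed
  have "norm (rGamma (of_nat m + c + p)) \<le> C / fact (m - L)" if p: "norm p \<le> 1" for m p
  proof (cases "m \<le> L")
    case True
    then show ?thesis using le_C[OF True p] by simp
  next
    case False
    define k where "k = m - L"
    define q where "q = of_nat L + c + p"
    have Req: "Re q \<ge> 1"
      using L abs_Re_le_cmod[of p] p unfolding q_def by simp
    have "norm (pochhammer q k) \<ge> fact k"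
    proof (induction k)
      case (Suc k)
      have "real (Suc k) \<le> norm (q + of_nat k)"
        using Req complex_Re_le_cmod[of "q + of_nat k"] by simp
      then have "fact k * real (Suc k) \<le> norm (pochhammer q k) * norm (q + of_nat k)"
        using Suc by (intro mult_mono) auto
      then show ?case
        by (simp add: pochhammer_rec' norm_mult mult.commute del: of_nat_Suc)
    qed auto
    moreover have "norm (rGamma q) = norm (pochhammer q k) * norm (rGamma (q + of_nat k))"
      by (metis norm_mult pochhammer_rGamma)
    ultimately have "fact k * norm (rGamma (q + of_nat k)) \<le> norm (rGamma q)"
      by (simp add: mult_right_mono)
    also have "\<dots> \<le> C"
      using le_C[of L p] p unfolding q_def by simp
    finally have "norm (rGamma (q + of_nat k)) \<le> C / fact k"
      by (simp add: field_simps)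
    moreover have "q + of_nat k = of_nat m + c + p"
      using False by (simp add: q_def k_def of_nat_diff)
    ultimately show ?thesis by (simp add: k_def)
  qed
  then show thesis using \<open>C > 0\<close> that by blast
qed

text \<open>\<open>(r + k) ^ k / fact k\<close> is a single term of an exponential series. Geometric
  growth in \<open>k\<close> is affordable, since the reciprocal Gamma factors decay
  factorially.\<close>

lemma norm_gbinomial_le:
  fixes a :: complex
  assumes "norm a \<le> r"
  shows "norm (a gchoose k) \<le> exp (r + real k)"
proof -
  have r: "r \<ge> 0" using assms norm_ge_zero[of a] by linarith
  have "norm (\<Prod>i<k. a - of_nat i) \<le> (\<Prod>i<k. r + real k)"
    unfolding prod_norm[symmetric]
  proof (intro prod_mono conjI norm_ge_zero)
    fix i assume "i \<in> {..<k}"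
    then show "norm (a - of_nat i) \<le> r + real k"
      using norm_triangle_ineq4[of a "of_nat i"] assms by simp
  qed
  then have "norm (a gchoose k) \<le> (r + real k) ^ k / fact k"
    by (simp add: gbinomial_prod_rev norm_divide divide_right_mono atLeast0LessThan)
  also have "\<dots> \<le> exp (r + real k)"
  proof -
    have "(r + real k) ^ k / fact k = (\<Sum>n\<in>{k}. (r + real k) ^ n / fact n)"
      by simp
    also have "\<dots> \<le> (\<Sum>n. (r + real k) ^ n / fact n)"
      using r summable_exp[of "r + real k"]
      by (intro sum_le_suminf) (auto simp: field_simps)
    also have "\<dots> = exp (r + real k)"
      by (simp add: exp_def divide_inverse mult.commute)
    finally show ?thesis .
  qed
  finally show ?thesis .
qed

lemma powr_bounded_on_unit_cball:
  fixes \<alpha> c d :: complex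
  assumes "\<alpha> \<noteq> 0"
  obtains C where "C > 0" "\<And>N p. norm p \<le> 1 \<Longrightarrow>
    norm (\<alpha> powr (2 * of_nat N + c + d * p)) \<le> C * (norm \<alpha> ^ 2) ^ N"
proof -
  have "compact ((\<lambda>p. \<alpha> powr (c + d * p)) ` cball 0 1)"
    using assms
    by (intro compact_continuous_image holomorphic_on_imp_continuous_on holomorphic_intros compact_cball)
  then obtain C where "C > 0" and C: "\<And>p. norm p \<le> 1 \<Longrightarrow> norm (\<alpha> powr (c + d * p)) \<le> C"
    by (metis (no_types, lifting) bounded_pos compact_imp_bounded imageI mem_cball_0)
  have "norm (\<alpha> powr (2 * of_nat N + c + d * p)) \<le> C * (norm \<alpha> ^ 2) ^ N"
    if "norm p \<le> 1" for N p
  proof -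
    have "\<alpha> powr (2 * of_nat N + c + d * p) = \<alpha> powr (of_nat (2 * N)) * \<alpha> powr (c + d * p)"
      by (simp add: powr_add algebra_simps)
    also have "\<dots> = \<alpha> ^ (2 * N) * \<alpha> powr (c + d * p)"
      by (subst powr_nat) (use assms in auto)
    finally have "norm (\<alpha> powr (2 * of_nat N + c + d * p))
        = (norm \<alpha> ^ 2) ^ N * norm (\<alpha> powr (c + d * p))"
      by (simp add: norm_mult norm_power power_mult)
    then show ?thesis
      using mult_left_mono[OF C[OF that], of "(norm \<alpha> ^ 2) ^ N"] by (simp add: mult.commute)
  qed
  then show thesis using that \<open>C > 0\<close> by blast
qed

lemma holomorphic_on_gbinomial [holomorphic_intros]:
  "f holomorphic_on S \<Longrightarrow> (\<lambda>x. f x gchoose k) holomorphic_on S"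
  unfolding gbinomial_prod_rev
  by (intro holomorphic_on_divide holomorphic_on_prod holomorphic_on_diff holomorphic_on_const) auto

lemma bessel_J_terms_bound:
  fixes z :: complex
  assumes "z \<noteq> 0"
  obtains h where "summable h"
    "\<And>m p. norm p \<le> 1 \<Longrightarrow>
       norm ((-1) ^ m * rGamma (of_nat m + (q + p) + 1) / fact m * (z / 2) powr (2 * of_nat m + (q + p)))
         \<le> h m"
proof -
  obtain C L where C: "C > 0"
    "\<And>m p. norm p \<le> 1 \<Longrightarrow> norm (rGamma (of_nat m + (q + 1) + p)) \<le> C / fact (m - L)"
    using rGamma_shift_bound by blast
  obtain D where D: "D > 0" "\<And>N p. norm p \<le> 1 \<Longrightarrow>
      norm ((z / 2) powr (2 * of_nat N + q + 1 * p)) \<le> D * (norm (z / 2) ^ 2) ^ N"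
    using powr_bounded_on_unit_cball[of "z / 2" q 1] assms by auto
  show thesis
  proof (rule that)
    show "summable (\<lambda>m. C * D * ((norm (z / 2) ^ 2) ^ m / fact (m - L)))"
      by (intro summable_mult summable_power_over_fact_diff)
    fix m :: nat and p :: complex
    assume p: "norm p \<le> 1"
    have "norm (rGamma (of_nat m + (q + p) + 1)) * norm ((z / 2) powr (2 * of_nat m + (q + p)))
        \<le> C / fact (m - L) * (D * (norm (z / 2) ^ 2) ^ m)"
      using C(2)[OF p, of m] D(2)[OF p, of m] C(1)
      by (intro mult_mono) (auto simp: algebra_simps)
    moreover have "norm (rGamma (of_nat m + (q + p) + 1)) / fact m
        \<le> norm (rGamma (of_nat m + (q + p) + 1))"
      by (simp add: divide_le_eq mult_le_cancel_left1 fact_ge_1 order_less_le)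
    ultimately show "norm ((-1) ^ m * rGamma (of_nat m + (q + p) + 1) / fact m
          * (z / 2) powr (2 * of_nat m + (q + p)))
        \<le> C * D * ((norm (z / 2) ^ 2) ^ m / fact (m - L))"
      by (simp only: norm_mult norm_divide norm_power norm_minus_cancel norm_one power_one
           mult_1 norm_fact)
         (smt (verit) mult_right_mono norm_ge_zero times_divide_eq_right mult.assoc mult.commute times_divide_eq_left)
  qed
qed

lemma bessel_J_norm_summable:
  fixes z :: complex
  assumes "z \<noteq> 0"
  shows "summable (\<lambda>m. norm ((-1) ^ m * rGamma (of_nat m + q + 1) / fact m
           * (z / 2) powr (2 * of_nat m + q)))"
proof -
  obtain h where h: "summable h" "\<And>m p. norm p \<le> 1 \<Longrightarrow>
       norm ((-1) ^ m * rGamma (of_nat m + (q + p) + 1) / fact m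
         * (z / 2) powr (2 * of_nat m + (q + p))) \<le> h m"
    using bessel_J_terms_bound[OF assms] by blast
  show ?thesis
  proof (rule summable_comparison_test'[OF h(1)])
    show "norm (norm ((-1) ^ m * rGamma (of_nat m + q + 1) / fact m
           * (z / 2) powr (2 * of_nat m + q))) \<le> h m" for m
      using h(2)[of 0 m] by (simp only: norm_zero add_0_right zero_le_one real_norm_def abs_norm_cancel)
  qed
qed

text \<open>Weierstrass' theorem: for holomorphic terms, a summable majorant of the terms alone
  justifies termwise differentiation.\<close>

lemma series_holomorphic_deriv_sums:
  fixes f :: "nat \<Rightarrow> complex \<Rightarrow> complex"
  assumes "open S" and holo: "\<And>n. f n holomorphic_on S" and h: "summable h"
    and le: "\<And>n x. x \<in> S \<Longrightarrow> norm (f n x) \<le> h n" and "c \<in> S"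
  shows "(\<lambda>n. deriv (f n) c) sums deriv (\<lambda>x. \<Sum>n. f n x) c"
    and "(\<lambda>x. \<Sum>n. f n x) field_differentiable at c"
proof -
  have D: "(f n has_field_derivative deriv (f n) x) (at x)" if "x \<in> S" for n x
    using holomorphic_derivI[OF holo \<open>open S\<close> that] .
  have ev: "\<forall>\<^sub>F n in sequentially. \<forall>x\<in>S. norm (f n x) \<le> h n"
    using le by simp
  obtain g g' where g: "\<forall>x\<in>S. (\<lambda>n. f n x) sums g x \<and> (\<lambda>n. deriv (f n) x) sums g' x
        \<and> (g has_field_derivative g' x) (at x)"
    by (rule series_and_derivative_comparison[of S h f "\<lambda>n. deriv (f n)"])
       (use \<open>open S\<close> h D ev in auto)
  have "((\<lambda>x. \<Sum>n. f n x) has_field_derivative g' c) (at c)"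
  proof (rule has_field_derivative_transform_within_open[where f = g and S = S])
    show "(g has_field_derivative g' c) (at c)"
      using g \<open>c \<in> S\<close> by blast
    show "g x = (\<Sum>n. f n x)" if "x \<in> S" for x
      using g that sums_unique by blast
  qed fact+
  then show "(\<lambda>n. deriv (f n) c) sums deriv (\<lambda>x. \<Sum>n. f n x) c"
    and "(\<lambda>x. \<Sum>n. f n x) field_differentiable at c"
    using g \<open>c \<in> S\<close> by (auto dest: DERIV_imp_deriv simp: field_differentiable_def)
qed

lemma bessel_J_field_differentiable:
  assumes "z \<noteq> 0"
  shows "(\<lambda>p. bessel_J p z) field_differentiable at q"
proof -
  obtain h where h: "summable h" "\<And>m p. norm p \<le> 1 \<Longrightarrow>
       norm ((-1) ^ m * rGamma (of_nat m + (q + p) + 1) / fact m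
         * (z / 2) powr (2 * of_nat m + (q + p))) \<le> h m"
    using bessel_J_terms_bound[OF assms] by blast
  have "(\<lambda>p. \<Sum>m. (-1) ^ m * rGamma (of_nat m + p + 1) / fact m
      * (z / 2) powr (2 * of_nat m + p)) field_differentiable at q"
  proof (rule series_holomorphic_deriv_sums(2))
    show "open (ball q 1)" "q \<in> ball q 1" by auto
    show "summable h" by fact
    show "(\<lambda>p. (-1) ^ n * rGamma (of_nat n + p + 1) / fact n
        * (z / 2) powr (2 * of_nat n + p)) holomorphic_on ball q 1" for n
      using assms by (intro holomorphic_intros) auto
    show "norm ((-1) ^ n * rGamma (of_nat n + p + 1) / fact n
        * (z / 2) powr (2 * of_nat n + p)) \<le> h n" if "p \<in> ball q 1" for n p
      using h(2)[of "p - q" n] that by (simp add: dist_norm norm_minus_commute)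
  qed
  then show ?thesis unfolding bessel_J_def .
qed

text \<open>The Vandermonde convolution collapses the Cauchy product of the two Bessel series.\<close>

lemma bessel_J_mult_sums:
  assumes "z \<noteq> 0"
  shows "(\<lambda>k. (-1) ^ k * ((a + b + 2 * of_nat k) gchoose k) * rGamma (a + of_nat k + 1)
            * rGamma (b + of_nat k + 1) * (z / 2) powr (a + b + 2 * of_nat k))
         sums (bessel_J a z * bessel_J b z)"
proof -
  define T where "T a m = (-1) ^ m * rGamma (of_nat m + a + 1) / fact m
      * (z / 2) powr (2 * of_nat m + a)" for a and m :: nat
  \<comment> \<open>Moves the dependence on \<open>i\<close> from the Gamma factor into a binomial
    coefficient; what remains is a prefactor common to the whole Cauchy coefficient.\<close>
  have falling: "rGamma (of_nat i + a + 1) / fact (k - i)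
      = rGamma (a + of_nat k + 1) * ((a + of_nat k) gchoose (k - i))" if "i \<le> k" for a :: complex and i k
  proof -
    have "rGamma (of_nat i + a + 1) = pochhammer (of_nat i + a + 1) (k - i)
        * rGamma (of_nat i + a + 1 + of_nat (k - i))"
      by (rule pochhammer_rGamma)
    also have "of_nat i + a + 1 + of_nat (k - i) = a + of_nat k + 1"
      using that by (simp add: of_nat_diff)
    also have "pochhammer (of_nat i + a + 1) (k - i)
        = fact (k - i) * ((a + of_nat k) gchoose (k - i))"
      using that by (simp add: gbinomial_pochhammer' of_nat_diff algebra_simps)
    finally show ?thesis by simp
  qed
  have "(\<lambda>k. \<Sum>i\<le>k. T a i * T b (k - i)) sums ((\<Sum>k. T a k) * (\<Sum>k. T b k))"
    unfolding T_def using assms by (intro Cauchy_product_sums bessel_J_norm_summable)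
  moreover have "(\<Sum>i\<le>k. T a i * T b (k - i)) = (-1) ^ k * ((a + b + 2 * of_nat k) gchoose k)
      * rGamma (a + of_nat k + 1) * rGamma (b + of_nat k + 1) * (z / 2) powr (a + b + 2 * of_nat k)"
    (is "_ = ?R") for k
  proof -
    define W where "W = (-1) ^ k * rGamma (a + of_nat k + 1) * rGamma (b + of_nat k + 1)
      * (z / 2) powr (a + b + 2 * of_nat k)"
    have "T a i * T b (k - i) = W * (((a + of_nat k) gchoose (k - i)) * ((b + of_nat k) gchoose i))"
      if "i \<le> k" for i
    proof -
      have "T a i * T b (k - i) = ((-1) ^ i * (-1) ^ (k - i))
          * (rGamma (of_nat i + a + 1) / fact (k - i)) * (rGamma (of_nat (k - i) + b + 1) / fact i)
          * ((z / 2) powr (2 * of_nat i + a) * (z / 2) powr (2 * of_nat (k - i) + b))"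
        by (simp add: T_def mult_ac)
      also have "(-1) ^ i * (-1) ^ (k - i) = ((-1) ^ k :: complex)"
        using that by (simp flip: power_add)
      also have "(z / 2) powr (2 * of_nat i + a) * (z / 2) powr (2 * of_nat (k - i) + b)
          = (z / 2) powr (a + b + 2 * of_nat k)"
        using that by (simp add: of_nat_diff algebra_simps flip: powr_add)
      also have "rGamma (of_nat (k - i) + b + 1) / fact i
          = rGamma (b + of_nat k + 1) * ((b + of_nat k) gchoose i)"
        using falling[of "k - i" k b] that by simp
      finally show ?thesis
        by (simp add: falling[OF that] W_def mult_ac)
    qed
    then have "(\<Sum>i\<le>k. T a i * T b (k - i))
        = W * (\<Sum>i\<le>k. ((b + of_nat k) gchoose i) * ((a + of_nat k) gchoose (k - i)))"
      by (simp add: sum_distrib_left mult_ac)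
    also have "\<dots> = W * ((b + of_nat k + (a + of_nat k)) gchoose k)"
      by (subst gbinomial_Vandermonde[symmetric]) (simp add: atLeast0AtMost)
    also have "\<dots> = ?R"
      by (simp add: W_def algebra_simps)
    finally show ?thesis .
  qed
  ultimately show ?thesis
    by (simp add: T_def[abs_def] bessel_J_def)
qed

section \<open>Termwise differentiation and summation of the products\<close>

text \<open>The unsigned \<open>k\<close>-th term of the product series for the orders
  \<open>n - m + p\<close> and \<open>n + p\<close>, indexed by \<open>N = n + k\<close>. In this
  indexing \<open>k\<close> survives only in the binomial.\<close>

definition bessel_prod_coeff :: "complex \<Rightarrow> complex \<Rightarrow> nat \<Rightarrow> nat \<Rightarrow> complex \<Rightarrow> complex" where
  "bessel_prod_coeff z m N k p = ((2 * of_nat N - m + 2 * p) gchoose k)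
     * (rGamma (of_nat N + (1 - m) + p) * rGamma (of_nat N + 1 + p)
        * (z / 2) powr (2 * of_nat N - m + 2 * p))"

lemma bessel_prod_coeff_holomorphic:
  "z \<noteq> 0 \<Longrightarrow> bessel_prod_coeff z m N k holomorphic_on S"
  unfolding bessel_prod_coeff_def[abs_def] by (intro holomorphic_intros)

text \<open>Uniformity in \<open>k \<le> N\<close> makes \<open>B\<close> a majorant along
  antidiagonals. The weight \<open>Suc N ^ 2\<close> pays once for the factor \<open>n\<close> in
  the series of \<open>P\<close> and once for the \<open>N + 1\<close> entries of an
  antidiagonal.\<close>

lemma bessel_prod_coeff_bound:
  assumes "z \<noteq> 0"
  obtains B where "summable (\<lambda>N. real (Suc N) ^ 2 * B N)" "\<And>N. B N \<ge> 0"
    "\<And>N k p. k \<le> N \<Longrightarrow> norm p \<le> 1 \<Longrightarrow> norm (bessel_prod_coeff z m N k p) \<le> B N"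
proof -
  obtain C1 L1 where C1: "C1 > 0"
    "\<And>N p. norm p \<le> 1 \<Longrightarrow> norm (rGamma (of_nat N + (1 - m) + p)) \<le> C1 / fact (N - L1)"
    using rGamma_shift_bound[of "1 - m"] by blast
  obtain C2 L2 where C2: "C2 > 0"
    "\<And>N p. norm p \<le> 1 \<Longrightarrow> norm (rGamma (of_nat N + 1 + p :: complex)) \<le> C2 / fact (N - L2)"
    using rGamma_shift_bound[of 1] by blast
  obtain D where D: "D > 0" "\<And>N p. norm p \<le> 1 \<Longrightarrow>
      norm ((z / 2) powr (2 * of_nat N + - m + 2 * p)) \<le> D * (norm (z / 2) ^ 2) ^ N"
    using powr_bounded_on_unit_cball[of "z / 2" "- m" 2] assms by auto
  \<comment> \<open>In \<open>exp 3\<close>, the upper argument of the binomial contributes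
    \<open>2 * N\<close> to the exponent and its lower index \<open>k \<le> N\<close> the
    rest.\<close>
  define y where "y = exp 3 * norm (z / 2) ^ 2"
  define K where "K = exp (2 + norm m) * C1 * C2 * D"
  define B where "B N = K * (y ^ N / fact (N - L1))" for N
  have K: "K > 0" using C1 C2 D by (simp add: K_def)
  have y: "y \<ge> 0" by (simp add: y_def)
  show thesis
  proof (rule that)
    show "B N \<ge> 0" for N
      using K y by (simp add: B_def)
    have le: "real (Suc N) ^ 2 \<le> exp 2 ^ N" for N
    proof -
      have "real (Suc N) \<le> exp (real N)" using exp_ge_add_one_self[of "real N"] by simp
      then have "real (Suc N) ^ 2 \<le> exp (real N) ^ 2" by (intro power_mono) auto
      also have "\<dots> = exp 2 ^ N" by (simp flip: exp_of_nat_mult add: mult.commute)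
      finally show ?thesis .
    qed
    show "summable (\<lambda>N. real (Suc N) ^ 2 * B N)"
    proof (rule summable_comparison_test'[of "\<lambda>N. K * ((exp 2 * y) ^ N / fact (N - L1))" 0])
      show "summable (\<lambda>N. K * ((exp 2 * y) ^ N / fact (N - L1)))"
        by (intro summable_mult summable_power_over_fact_diff)
      show "norm (real (Suc N) ^ 2 * B N) \<le> K * ((exp 2 * y) ^ N / fact (N - L1))" for N
      proof -
        have "real (Suc N) ^ 2 * B N \<le> exp 2 ^ N * B N"
          using le \<open>B N \<ge> 0\<close> by (rule mult_right_mono)
        then show ?thesis
          using K y by (simp add: B_def power_mult_distrib mult_ac)
      qed
    qed
    fix N k :: nat and p :: complex
    assume k: "k \<le> N" and p: "norm p \<le> 1"
    have "norm (2 * of_nat N - m + 2 * p) \<le> 2 * real N + norm m + 2"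
      using norm_triangle_ineq[of "2 * of_nat N - m" "2 * p"]
        norm_triangle_ineq4[of "2 * of_nat N" m] p by (simp add: norm_mult)
    then have "norm ((2 * of_nat N - m + 2 * p) gchoose k) \<le> exp (2 * real N + norm m + 2 + real k)"
      by (rule norm_gbinomial_le)
    also have "\<dots> \<le> exp (2 + norm m + real N * 3)"
      using k by simp
    also have "\<dots> = exp (2 + norm m) * exp 3 ^ N"
      by (simp add: exp_add exp_of_nat_mult)
    finally have 1: "norm ((2 * of_nat N - m + 2 * p) gchoose k) \<le> exp (2 + norm m) * exp 3 ^ N" .
    have 2: "norm (rGamma (of_nat N + 1 + p)) \<le> C2"
    proof -
      have "C2 / fact (N - L2) \<le> C2 / 1"
        using C2(1) by (intro divide_left_mono fact_ge_1) auto
      then show ?thesis using C2(2)[OF p, of N] by simp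
    qed
    have 3: "norm ((z / 2) powr (2 * of_nat N - m + 2 * p)) \<le> D * (norm (z / 2) ^ 2) ^ N"
      using D(2)[OF p, of N] by simp
    have "norm (bessel_prod_coeff z m N k p)
        \<le> (exp (2 + norm m) * exp 3 ^ N) * ((C1 / fact (N - L1) * C2) * (D * (norm (z / 2) ^ 2) ^ N))"
      unfolding bessel_prod_coeff_def norm_mult
      using 1 2 3 C1(2)[OF p, of N] C1(1) C2(1)
      by (intro mult_mono mult_nonneg_nonneg) auto
    also have "\<dots> = B N"
      by (simp add: B_def K_def y_def power_mult_distrib mult_ac)
    finally show "norm (bessel_prod_coeff z m N k p) \<le> B N" .
  qed
qed

text \<open>Cauchy's inequality on the unit circle; with radius 1 the bound passes to the derivative
  without loss.\<close>

lemma norm_deriv_bessel_prod_coeff_le: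
  assumes "z \<noteq> 0" and "\<And>p. norm p \<le> 1 \<Longrightarrow> norm (bessel_prod_coeff z m N k p) \<le> b"
  shows "norm (deriv (bessel_prod_coeff z m N k) 0) \<le> b"
proof -
  have "norm ((deriv ^^ 1) (bessel_prod_coeff z m N k) 0) \<le> fact 1 * b / 1 ^ 1"
  proof (rule Cauchy_inequality)
    show "bessel_prod_coeff z m N k holomorphic_on ball 0 1"
      "continuous_on (cball 0 1) (bessel_prod_coeff z m N k)"
      using bessel_prod_coeff_holomorphic[OF assms(1)] holomorphic_on_imp_continuous_on by blast+
  qed (use assms(2) in auto)
  then show ?thesis by simp
qed

lemma bessel_J_mult_deriv_sums:
  assumes "z \<noteq> 0"
  shows "(\<lambda>k. (-1) ^ k * deriv (bessel_prod_coeff z m (n + k) k) 0)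
    sums deriv (\<lambda>p. bessel_J (of_nat n - m + p) z * bessel_J (of_nat n + p) z) 0"
proof -
  obtain B where B: "summable (\<lambda>N. real (Suc N) ^ 2 * B N)" "\<And>N. B N \<ge> 0"
    "\<And>N k p. k \<le> N \<Longrightarrow> norm p \<le> 1 \<Longrightarrow> norm (bessel_prod_coeff z m N k p) \<le> B N"
    using bessel_prod_coeff_bound[OF assms] by blast
  have "summable B"
  proof (rule summable_comparison_test'[OF B(1)])
    show "norm (B N) \<le> real (Suc N) ^ 2 * B N" for N
      using mult_right_mono[of 1 "real (Suc N) ^ 2" "B N"] B(2)[of N] by simp
  qed
  then have sB: "summable (\<lambda>k. B (n + k))"
    by (simp add: add.commute summable_iff_shift)
  define f where "f k p = (-1) ^ k * bessel_prod_coeff z m (n + k) k p" for k p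
  have fsum: "(\<lambda>k. f k p) sums (bessel_J (of_nat n - m + p) z * bessel_J (of_nat n + p) z)" for p
    using bessel_J_mult_sums[OF assms, of "of_nat n - m + p" "of_nat n + p"]
    by (simp add: f_def bessel_prod_coeff_def algebra_simps)
  have "(\<lambda>k. deriv (f k) 0) sums deriv (\<lambda>p. \<Sum>k. f k p) 0"
  proof (rule series_holomorphic_deriv_sums(1)[of "ball 0 1"])
    show "f k holomorphic_on ball 0 1" for k
      unfolding f_def[abs_def]
      by (intro holomorphic_intros bessel_prod_coeff_holomorphic[OF assms])
    show "norm (f k p) \<le> B (n + k)" if "p \<in> ball 0 1" for k p
      using B(3)[of k "n + k" p] that by (simp add: f_def norm_mult norm_power)
  qed (use sB in auto)
  also have "(\<lambda>p. \<Sum>k. f k p) = (\<lambda>p. bessel_J (of_nat n - m + p) z * bessel_J (of_nat n + p) z)"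
    by (intro ext sums_unique[symmetric] fsum)
  finally have "(\<lambda>k. deriv (f k) 0)
    sums deriv (\<lambda>p. bessel_J (of_nat n - m + p) z * bessel_J (of_nat n + p) z) 0" .
  moreover have "deriv (f k) 0 = (-1) ^ k * deriv (bessel_prod_coeff z m (n + k) k) 0" for k
    unfolding f_def[abs_def]
    using bessel_prod_coeff_holomorphic[OF assms, of m "n + k" k UNIV]
    by (intro deriv_cmult) (auto simp: holomorphic_on_def)
  ultimately show ?thesis by simp
qed

text \<open>Fubini for an absolutely summable family: antidiagonal \<open>N\<close> has
  \<open>N + 1\<close> entries, each at most \<open>b N\<close>, whence the weight in the
  hypothesis.\<close>

lemma double_series_antidiagonal:
  fixes d :: "nat \<Rightarrow> nat \<Rightarrow> complex"
  assumes le: "\<And>n k. norm (d n k) \<le> b (n + k)" and b: "summable (\<lambda>N. real (Suc N) * b N)"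
  shows "summable (\<lambda>n. \<Sum>k. d n k)"
    and "(\<lambda>N. \<Sum>k\<le>N. d (N - k) k) sums (\<Sum>n. \<Sum>k. d n k)"
proof -
  have b0: "b N \<ge> 0" for N
    using le[of N 0] norm_ge_zero[of "d N 0"] by (metis add_0_right order_trans)
  let ?T = "Sigma UNIV (\<lambda>N. {..N::nat})"
  let ?g = "\<lambda>(N, k). d (N - k) k"
  have "(\<lambda>x. norm (?g x)) summable_on ?T"
  proof (rule Infinite_Sum.abs_summable_on_Sigma_iff[THEN iffD2, OF conjI])
    show "\<forall>N\<in>UNIV. (\<lambda>k. norm (?g (N, k))) summable_on {..N}"
      by (auto intro: summable_on_finite)
    have le': "norm (infsum (\<lambda>k. norm (?g (N, k))) {..N}) \<le> real (Suc N) * b N" for N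
    proof -
      have "(\<Sum>k\<le>N. norm (d (N - k) k)) \<le> (\<Sum>k\<le>N. b N)"
        using le by (intro sum_mono) (metis atMost_iff le_add_diff_inverse2)
      then show ?thesis by (simp add: infsum_finite sum_nonneg)
    qed
    have "summable (\<lambda>N. norm (infsum (\<lambda>k. norm (?g (N, k))) {..N}))"
      by (rule summable_comparison_test'[OF b]) (use le' in simp)
    then show "(\<lambda>N. norm (infsum (\<lambda>k. norm (?g (N, k))) {..N})) summable_on UNIV"
      by (simp add: summable_on_UNIV_nonneg_real_iff)
  qed
  then have gT: "?g summable_on ?T" by (rule abs_summable_summable)
  then obtain S where S: "(?g has_sum S) ?T" by (auto simp: summable_on_def)
  have row: "((\<lambda>k. d (N - k) k) has_sum (\<Sum>k\<le>N. d (N - k) k)) {..N}" for N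
    by (simp add: has_sum_finite)
  have "((\<lambda>N. \<Sum>k\<le>N. d (N - k) k) has_sum S) UNIV"
    using has_sum_SigmaD[OF S] row by auto
  then have anti: "(\<lambda>N. \<Sum>k\<le>N. d (N - k) k) sums S"
    by (rule has_sum_imp_sums)
  have "((\<lambda>(n, k). d n k) has_sum S) (Sigma UNIV (\<lambda>_. UNIV)) \<longleftrightarrow> (?g has_sum S) ?T"
    by (rule has_sum_reindex_bij_witness[of _ "\<lambda>(N, k). (N - k, k)" "\<lambda>(n, k). (n + k, k)"]) auto
  with S have S': "((\<lambda>(n, k). d n k) has_sum S) (Sigma UNIV (\<lambda>_. UNIV))" by simp
  have "((\<lambda>k. d n k) has_sum (\<Sum>k. d n k)) UNIV" for n
  proof -
    have "summable b"
    proof (rule summable_comparison_test'[OF b])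
      show "norm (b N) \<le> real (Suc N) * b N" for N
        using mult_right_mono[of 1 "real (Suc N)" "b N"] b0[of N] by simp
    qed
    then have "summable (\<lambda>k. b (n + k))" by (simp add: add.commute summable_iff_shift)
    then have "summable (\<lambda>k. norm (d n k))"
      by (rule summable_comparison_test'[of _ 0]) (use le in simp)
    then show ?thesis
      using norm_summable_imp_has_sum summable_norm_cancel summable_sums by blast
  qed
  then have "((\<lambda>n. \<Sum>k. d n k) has_sum S) UNIV"
    using has_sum_SigmaD[OF S'] by auto
  then have "(\<lambda>n. \<Sum>k. d n k) sums S"
    by (rule has_sum_imp_sums)
  then show "summable (\<lambda>n. \<Sum>k. d n k)"
    and "(\<lambda>N. \<Sum>k\<le>N. d (N - k) k) sums (\<Sum>n. \<Sum>k. d n k)"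
    using anti by (auto simp: sums_iff)
qed

section \<open>Collapse of the alternating weighted binomial sums\<close>

lemma sum_triangle_weights:
  fixes f :: "nat \<Rightarrow> 'a::comm_ring_1"
  shows "(\<Sum>k\<le>n. of_nat (Suc n - k) * f k) = (\<Sum>j\<le>n. \<Sum>k\<le>j. f k)"
proof (induction n)
  case (Suc n)
  have "(\<Sum>k\<le>Suc n. of_nat (Suc (Suc n) - k) * f k)
      = (\<Sum>k\<le>Suc n. of_nat (Suc n - k) * f k + f k)"
    by (intro sum.cong) (auto simp: Suc_diff_le algebra_simps)
  also have "\<dots> = (\<Sum>k\<le>n. of_nat (Suc n - k) * f k) + (\<Sum>k\<le>Suc n. f k)"
    by (simp add: sum.distrib)
  finally show ?case using Suc by simp
qed auto

text \<open>The linear weight is a sum of partial sums, and each passage to alternating partial sums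
  lowers the upper argument by 1; two passages give \<open>a - 2\<close>. The term
  \<open>k = Suc n\<close> has weight zero.\<close>

lemma gbinomial_alternating_weighted_sum:
  fixes a :: complex
  shows "(\<Sum>k\<le>Suc n. of_nat (Suc n - k) * ((-1) ^ k * (a gchoose k))) = (-1) ^ n * ((a - 2) gchoose n)"
proof -
  have "(\<Sum>k\<le>Suc n. of_nat (Suc n - k) * ((-1) ^ k * (a gchoose k)))
      = (\<Sum>k\<le>n. of_nat (Suc n - k) * ((a gchoose k) * (-1) ^ k))"
    by (simp add: mult.commute)
  also have "\<dots> = (\<Sum>j\<le>n. ((a - 1) gchoose j) * (-1) ^ j)"
    by (subst sum_triangle_weights) (simp add: gbinomial_sum_lower_neg mult.commute)
  also have "\<dots> = (-1) ^ n * ((a - 1 - 1) gchoose n)"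
    by (rule gbinomial_sum_lower_neg)
  finally show ?thesis by simp
qed

text \<open>The part of \<open>bessel_prod_coeff\<close> free of \<open>k\<close>, hence the common
  factor of antidiagonal \<open>N\<close>.\<close>

definition bessel_diag_coeff :: "complex \<Rightarrow> complex \<Rightarrow> nat \<Rightarrow> complex \<Rightarrow> complex" where
  "bessel_diag_coeff z m N p = rGamma (of_nat N + (1 - m) + p) * rGamma (of_nat N + 1 + p)
        * (z / 2) powr (2 * of_nat N - m + 2 * p)"

text \<open>On antidiagonal \<open>N\<close> the weight is \<open>n = N - k\<close>, so the
  alternating sum collapses before the derivative is taken. For \<open>N = 0\<close> the only entry
  has weight zero.\<close>

lemma weighted_bessel_J_mult_deriv_sums:
  fixes z m :: complex
  assumes "z \<noteq> 0"
  defines "D \<equiv> \<lambda>n. deriv (\<lambda>p. bessel_J (of_nat n - m + p) z * bessel_J (of_nat n + p) z) 0"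
  shows "summable (\<lambda>n. of_nat n * D n)"
    and "(\<lambda>N. if N = 0 then 0 else (-1) ^ (N - 1) * deriv (\<lambda>p. bessel_diag_coeff z m N p
              * ((2 * of_nat N - m - 2 + 2 * p) gchoose (N - 1))) 0)
         sums (\<Sum>n. of_nat n * D n)"
proof -
  obtain B where B: "summable (\<lambda>N. real (Suc N) ^ 2 * B N)" "\<And>N. B N \<ge> 0"
    "\<And>N k p. k \<le> N \<Longrightarrow> norm p \<le> 1 \<Longrightarrow> norm (bessel_prod_coeff z m N k p) \<le> B N"
    using bessel_prod_coeff_bound[OF assms(1)] by blast
  define d where "d n k = of_nat n * ((-1) ^ k * deriv (bessel_prod_coeff z m (n + k) k) 0)" for n k
  have dsum: "(\<Sum>k. d n k) = of_nat n * D n" for n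
    unfolding d_def D_def using bessel_J_mult_deriv_sums[OF assms(1), THEN sums_mult, THEN sums_unique]
    by metis
  have le: "norm (d n k) \<le> real (Suc (n + k)) * B (n + k)" for n k
  proof -
    have "norm (deriv (bessel_prod_coeff z m (n + k) k) 0) \<le> B (n + k)"
      using B(3)[of k "n + k"] by (intro norm_deriv_bessel_prod_coeff_le assms) auto
    then have "real n * norm (deriv (bessel_prod_coeff z m (n + k) k) 0) \<le> real (Suc (n + k)) * B (n + k)"
      by (intro mult_mono) auto
    then show ?thesis by (simp add: d_def norm_mult norm_power)
  qed
  have sm: "summable (\<lambda>N. real (Suc N) * (real (Suc N) * B N))"
    using B(1) by (simp add: power2_eq_square mult.assoc)
  from double_series_antidiagonal(1)[of d "\<lambda>N. real (Suc N) * B N", OF le sm]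
  show "summable (\<lambda>n. of_nat n * D n)" by (simp add: dsum)
  have "(\<Sum>k\<le>N. d (N - k) k) = (if N = 0 then 0 else (-1) ^ (N - 1) * deriv (\<lambda>p. bessel_diag_coeff z m N p
              * ((2 * of_nat N - m - 2 + 2 * p) gchoose (N - 1))) 0)" for N
  proof (cases N)
    case 0
    then show ?thesis by (simp add: d_def)
  next
    case (Suc n)
    have D1: "(bessel_prod_coeff z m N k has_field_derivative deriv (bessel_prod_coeff z m N k) 0) (at 0)" for k
      using holomorphic_derivI[OF bessel_prod_coeff_holomorphic[OF assms(1)], of UNIV 0] by auto
    have "((\<lambda>p. \<Sum>k\<le>N. of_nat (N - k) * ((-1) ^ k * bessel_prod_coeff z m N k p))
       has_field_derivative (\<Sum>k\<le>N. of_nat (N - k) * ((-1) ^ k * deriv (bessel_prod_coeff z m N k) 0))) (at 0)"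
      by (intro DERIV_sum DERIV_cmult D1)
    also have "(\<lambda>p. \<Sum>k\<le>N. of_nat (N - k) * ((-1) ^ k * bessel_prod_coeff z m N k p))
      = (\<lambda>p. (-1) ^ n * (bessel_diag_coeff z m N p * ((2 * of_nat N - m - 2 + 2 * p) gchoose n)))"
      (is "?l = ?r")
    proof
      fix p
      have "?l p = bessel_diag_coeff z m N p * (\<Sum>k\<le>Suc n. of_nat (Suc n - k) *
          ((-1) ^ k * ((2 * of_nat N - m + 2 * p) gchoose k)))"
        by (simp only: sum_distrib_left Suc bessel_prod_coeff_def bessel_diag_coeff_def mult_ac)
      also have "\<dots> = ?r p"
        by (subst gbinomial_alternating_weighted_sum) (simp add: algebra_simps)
      finally show "?l p = ?r p" .
    qed
    finally have "(\<Sum>k\<le>N. of_nat (N - k) * ((-1) ^ k * deriv (bessel_prod_coeff z m N k) 0))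
      = deriv (\<lambda>p. (-1) ^ n * (bessel_diag_coeff z m N p * ((2 * of_nat N - m - 2 + 2 * p) gchoose n))) 0"
      by (rule DERIV_imp_deriv[symmetric])
    also have "\<dots> = (-1) ^ n * deriv (\<lambda>p. bessel_diag_coeff z m N p * ((2 * of_nat N - m - 2 + 2 * p) gchoose n)) 0"
    proof (rule deriv_cmult)
      have "(\<lambda>p. bessel_diag_coeff z m N p * ((2 * of_nat N - m - 2 + 2 * p) gchoose n)) holomorphic_on UNIV"
        unfolding bessel_diag_coeff_def using assms(1) by (intro holomorphic_intros)
      then show "(\<lambda>p. bessel_diag_coeff z m N p * ((2 * of_nat N - m - 2 + 2 * p) gchoose n))
          field_differentiable at 0"
        by (auto simp: holomorphic_on_def)
    qed
    finally show ?thesis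
      by (simp add: Suc d_def)
  qed
  with double_series_antidiagonal(2)[of d "\<lambda>N. real (Suc N) * B N", OF le sm]
  show "(\<lambda>N. if N = 0 then 0 else (-1) ^ (N - 1) * deriv (\<lambda>p. bessel_diag_coeff z m N p
              * ((2 * of_nat N - m - 2 + 2 * p) gchoose (N - 1))) 0)
         sums (\<Sum>n. of_nat n * D n)"
    by (simp only: dsum)
qed

section \<open>Bessel functions at integer orders\<close>

text \<open>At order \<open>- n\<close> the first \<open>n\<close> coefficients vanish at the poles
  of Gamma; the remaining ones are the series of order \<open>n\<close>, shifted by \<open>n\<close>
  places with sign \<open>(-1) ^ n\<close>.\<close>

lemma bessel_J_minus_of_nat:
  assumes "z \<noteq> 0"
  shows "bessel_J (- of_nat n) z = (-1) ^ n * bessel_J (of_nat n) z"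
proof -
  define T where "T q m = (-1) ^ m * rGamma (of_nat m + q + 1) / fact m
      * (z / 2) powr (2 * of_nat m + q)" for q and m :: nat
  have T: "T q sums bessel_J q z" for q
    unfolding T_def[abs_def] bessel_J_def
    by (rule summable_sums[OF summable_norm_cancel[OF bessel_J_norm_summable[OF assms]]])
  have "T (- of_nat n) m = 0" if "m < n" for m
  proof -
    have "of_nat m + - of_nat n + 1 = (- of_nat (n - m - 1) :: complex)"
      using that by (simp add: of_nat_diff)
    then have "rGamma (of_nat m + - of_nat n + 1 :: complex) = 0"
      by (simp add: rGamma_eq_zero_iff)
    then show ?thesis by (simp add: T_def)
  qed
  then have "(\<lambda>j. T (- of_nat n) (j + n)) sums bessel_J (- of_nat n) z"
    using T[of "- of_nat n"] by (subst sums_zero_iff_shift) auto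
  also have "(\<lambda>j. T (- of_nat n) (j + n)) = (\<lambda>j. (-1) ^ n * T (of_nat n) j)"
  proof
    fix j
    have "rGamma (of_nat j + 1 :: complex) = inverse (fact j)"
      "rGamma (of_nat j + of_nat n + 1 :: complex) = inverse (fact (j + n))"
      using Gamma_fact[of j, where 'a = complex] Gamma_fact[of "j + n", where 'a = complex]
      by (simp_all add: rGamma_inverse_Gamma add_ac)
    then show "T (- of_nat n) (j + n) = (-1) ^ n * T (of_nat n) j"
      by (simp add: T_def power_add field_simps)
  qed
  finally show ?thesis
    using sums_mult[OF T[of "of_nat n"], of "(-1) ^ n"] sums_unique2 by blast
qed

lemma bessel_J_hat_has_field_derivative:
  "z \<noteq> 0 \<Longrightarrow> ((\<lambda>p. bessel_J p z) has_field_derivative bessel_J_hat k z) (at (of_int k))"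
  unfolding bessel_J_hat_def by (intro DERIV_deriv_iff_field_differentiable[THEN iffD2]
      bessel_J_field_differentiable)

lemma bessel_J_uminus_of_int:
  assumes "z \<noteq> 0"
  shows "bessel_J (- of_int k) z = (-1) powi k * bessel_J (of_int k) z"
proof (cases k)
  case (nonneg n)
  then show ?thesis using bessel_J_minus_of_nat[OF assms, of n] by simp
next
  case (neg n)
  then show ?thesis
    using bessel_J_minus_of_nat[OF assms, of "Suc n"]
    by (simp add: power_int_minus_one_minus flip: mult.assoc power_add del: of_nat_Suc power_Suc)
qed

lemma cos_sin_int_pi:
  "cos (of_int k * of_real pi :: complex) = (-1) powi k" "sin (of_int k * of_real pi :: complex) = 0"
proof -
  have "of_int k * of_real pi = complex_of_real (pi * of_int k)" by simp
  then show "cos (of_int k * of_real pi :: complex) = (-1) powi k" "sin (of_int k * of_real pi :: complex) = 0"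
    by (simp_all only: cos_of_real sin_of_real cos_npi_int sin_npi_int) (simp_all add: power_int_minus_left)
qed

text \<open>L'Hopital's rule: at an integer order the numerator of \<open>bessel_Y_quot\<close>
  vanishes because of \<open>bessel_J_uminus_of_int\<close>.\<close>

lemma bessel_Y_of_int:
  assumes "z \<noteq> 0"
  shows "of_real pi * bessel_Y (of_int k) z = bessel_J_hat k z + (-1) powi k * bessel_J_hat (- k) z"
proof -
  have D1: "((\<lambda>p. bessel_J p z) has_field_derivative bessel_J_hat k z) (at (of_int k))"
    by (rule bessel_J_hat_has_field_derivative[OF assms])
  have D2: "((\<lambda>p. bessel_J p z) has_field_derivative bessel_J_hat (- k) z) (at (- of_int k))"
    using bessel_J_hat_has_field_derivative[OF assms, of "- k"] by simp
  have D3: "((\<lambda>p. bessel_J (- p) z) has_field_derivative - bessel_J_hat (- k) z) (at (of_int k))"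
    using DERIV_chain2[where f = "\<lambda>p. bessel_J p z" and g = uminus and x = "of_int k" and Db = "-1"
        and Da = "bessel_J_hat (- k) z" and s = UNIV] D2
      DERIV_minus[OF DERIV_ident, of "of_int k :: complex" UNIV]
    by simp
  have "((\<lambda>p. bessel_J p z * cos (p * of_real pi) - bessel_J (- p) z) has_field_derivative
      (-1) powi k * bessel_J_hat k z + bessel_J_hat (- k) z) (at (of_int k))"
    by (rule derivative_eq_intros D1 D3 refl | simp add: cos_sin_int_pi)+
  moreover have "((\<lambda>p. sin (p * of_real pi)) has_field_derivative (-1) powi k * of_real pi)
      (at (of_int k :: complex))"
    by (auto intro!: derivative_eq_intros simp: cos_sin_int_pi)
  ultimately have "((\<lambda>p. bessel_Y_quot p z) \<longlongrightarrow>
      ((-1) powi k * bessel_J_hat k z + bessel_J_hat (- k) z) / ((-1) powi k * of_real pi))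
      (at (of_int k))"
    unfolding bessel_Y_quot_def
    by (rule lhopital_complex_simple) (auto simp: cos_sin_int_pi bessel_J_uminus_of_int[OF assms])
  then have "Lim (at (of_int k)) (\<lambda>p. bessel_Y_quot p z) =
      ((-1) powi k * bessel_J_hat k z + bessel_J_hat (- k) z) / ((-1) powi k * of_real pi)"
    by (intro tendsto_Lim) auto
  then show ?thesis
    by (cases "even k") (auto simp: bessel_Y_def field_simps)
qed

section \<open>Series for \<open>P\<close> and for the combination of \<open>Y\<close> and
  \<open>J\<close>\<close>

lemma deriv_bessel_J_mult:
  assumes "z \<noteq> 0"
  shows "deriv (\<lambda>p. bessel_J (of_int i + p) z * bessel_J (of_int j + p) z) 0
    = bessel_J_hat i z * bessel_J (of_int j) z + bessel_J (of_int i) z * bessel_J_hat j z"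
proof -
  have D: "((\<lambda>p. bessel_J (of_int i + p) z) has_field_derivative bessel_J_hat i z) (at 0)" for i
    using DERIV_chain2[where f = "\<lambda>p. bessel_J p z" and g = "\<lambda>p. of_int i + p" and x = 0 and Db = 1
        and Da = "bessel_J_hat i z" and s = UNIV] bessel_J_hat_has_field_derivative[OF assms, of i]
      DERIV_add[OF DERIV_const DERIV_ident, of "of_int i" 0 UNIV]
    by simp
  show ?thesis
    using DERIV_imp_deriv[OF DERIV_mult[OF D[of i] D[of j]]] by (simp add: mult_ac)
qed

definition deriv_bessel_J_prod :: "complex \<Rightarrow> complex \<Rightarrow> nat \<Rightarrow> complex" where
  "deriv_bessel_J_prod z m n = deriv (\<lambda>p. bessel_J (of_nat n - m + p) z * bessel_J (of_nat n + p) z) 0"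

lemma bessel_P_term_eq:
  assumes "z \<noteq> 0"
  shows "bessel_P_term (int M) z n = of_nat n * deriv_bessel_J_prod z (of_nat M) n
     + (-1) ^ M * (of_nat n * deriv_bessel_J_prod z (- of_nat M) n)"
  using deriv_bessel_J_mult[OF assms, of "int n - int M" "int n"]
    deriv_bessel_J_mult[OF assms, of "int n + int M" "int n"]
  by (simp add: bessel_P_term_def deriv_bessel_J_prod_def algebra_simps)

text \<open>Up to the factor \<open>(-1) ^ M\<close>, this is the combination of derivatives in
  \<open>bessel_P_term_eq\<close> taken at \<open>n = 0\<close> and without the weight
  \<open>n\<close>; thus the same product series serves both sides of the theorem.\<close>

lemma bessel_YJ_eq:
  assumes "z \<noteq> 0"
  shows "of_real pi * (bessel_Y 0 z * bessel_J (of_nat M) z + bessel_J 0 z * bessel_Y (of_nat M) z)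
    = deriv_bessel_J_prod z (- of_nat M) 0 + (-1) ^ M * deriv_bessel_J_prod z (of_nat M) 0"
proof -
  have "of_real pi * (bessel_Y 0 z * bessel_J (of_nat M) z + bessel_J 0 z * bessel_Y (of_nat M) z)
    = (of_real pi * bessel_Y (of_int 0) z) * bessel_J (of_nat M) z
      + bessel_J 0 z * (of_real pi * bessel_Y (of_int (int M)) z)"
    by (simp add: algebra_simps)
  also have "\<dots> = (bessel_J_hat 0 z + bessel_J_hat 0 z) * bessel_J (of_nat M) z
      + bessel_J 0 z * (bessel_J_hat (int M) z + (-1) ^ M * bessel_J_hat (- int M) z)"
    by (simp only: bessel_Y_of_int[OF assms]) simp
  also have "\<dots> = (bessel_J_hat (int M) z * bessel_J 0 z + bessel_J (of_nat M) z * bessel_J_hat 0 z)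
     + (-1) ^ M * (bessel_J_hat (- int M) z * bessel_J 0 z + bessel_J (- of_nat M) z * bessel_J_hat 0 z)"
    by (simp add: bessel_J_minus_of_nat[OF assms] algebra_simps flip: power_add mult_2)
  also have "bessel_J_hat (int M) z * bessel_J 0 z + bessel_J (of_nat M) z * bessel_J_hat 0 z
      = deriv_bessel_J_prod z (- of_nat M) 0"
    using deriv_bessel_J_mult[OF assms, of "int M" 0] by (simp add: deriv_bessel_J_prod_def)
  also have "bessel_J_hat (- int M) z * bessel_J 0 z + bessel_J (- of_nat M) z * bessel_J_hat 0 z
      = deriv_bessel_J_prod z (of_nat M) 0"
    using deriv_bessel_J_mult[OF assms, of "- int M" 0] by (simp add: deriv_bessel_J_prod_def)
  finally show ?thesis .
qed

text \<open>Zero at negative lower index, consistent with the factor \<open>rGamma (j + 1)\<close>.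
  The series for \<open>- M\<close>, which starts only at the shifted index, then obeys one formula
  for all \<open>N\<close>.\<close>

definition int_gbinomial :: "complex \<Rightarrow> int \<Rightarrow> complex" where
  "int_gbinomial a j = (if j < 0 then 0 else a gchoose nat j)"

lemma holomorphic_on_int_gbinomial [holomorphic_intros]:
  "f holomorphic_on S \<Longrightarrow> (\<lambda>x. int_gbinomial (f x) j) holomorphic_on S"
  unfolding int_gbinomial_def by (cases "j < 0") (simp_all add: holomorphic_on_gbinomial)

lemma bessel_diag_coeff_holomorphic:
  "z \<noteq> 0 \<Longrightarrow> bessel_diag_coeff z m N holomorphic_on S"
  unfolding bessel_diag_coeff_def[abs_def] by (intro holomorphic_intros)

text \<open>Once the index is shifted by \<open>M\<close>, the change of sign merely exchanges the
  two Gamma factors and keeps the power of \<open>z / 2\<close>. This aligns the series for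
  \<open>M\<close> and \<open>- M\<close>.\<close>

lemma bessel_diag_coeff_uminus:
  assumes "M \<le> N"
  shows "bessel_diag_coeff z (- of_nat M) (N - M) = bessel_diag_coeff z (of_nat M) N"
  using assms by (auto simp: bessel_diag_coeff_def of_nat_diff algebra_simps)

lemma deriv_bessel_diag_coeff_add:
  assumes "z \<noteq> 0" "f holomorphic_on UNIV" "g holomorphic_on UNIV"
  shows "deriv (\<lambda>p. bessel_diag_coeff z m N p * (f p + g p)) 0
    = deriv (\<lambda>p. bessel_diag_coeff z m N p * f p) 0 + deriv (\<lambda>p. bessel_diag_coeff z m N p * g p) 0"
  unfolding distrib_left using assms bessel_diag_coeff_holomorphic[OF assms(1), of m N UNIV]
  by (intro deriv_add) (auto intro!: field_differentiable_mult simp: holomorphic_on_def)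

lemma bessel_P_sums:
  assumes "z \<noteq> 0"
  shows "summable (\<lambda>n. bessel_P_term (int M) z (Suc n))"
    and "(\<lambda>N. (-1) ^ Suc N * deriv (\<lambda>p. bessel_diag_coeff z (of_nat M) N p *
           (int_gbinomial (2 * of_nat N - of_nat M - 2 + 2 * p) (int N - 1)
            + int_gbinomial (2 * of_nat N - of_nat M - 2 + 2 * p) (int N - int M - 1))) 0)
         sums bessel_P (int M) z"
proof -
  define c where "c m N = (if N = 0 then 0 else (-1) ^ (N - 1) * deriv (\<lambda>p. bessel_diag_coeff z m N p
              * ((2 * of_nat N - m - 2 + 2 * p) gchoose (N - 1))) 0)" for m N
  define S where "S m = (\<Sum>n. of_nat n * deriv_bessel_J_prod z m n)" for m
  note W = weighted_bessel_J_mult_deriv_sums[OF assms, folded deriv_bessel_J_prod_def]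
  have sum_P: "(\<lambda>n. bessel_P_term (int M) z n) sums (S (of_nat M) + (-1) ^ M * S (- of_nat M))"
    unfolding bessel_P_term_eq[OF assms] S_def
    by (intro sums_add sums_mult summable_sums W)
  then show "summable (\<lambda>n. bessel_P_term (int M) z (Suc n))"
    by (subst summable_Suc_iff) (rule sums_summable)
  have "bessel_P_term (int M) z 0 = 0" by (simp add: bessel_P_term_def)
  with sum_P have "(\<lambda>n. bessel_P_term (int M) z (Suc n)) sums (S (of_nat M) + (-1) ^ M * S (- of_nat M))"
    by (subst sums_Suc_iff) simp
  then have P: "bessel_P (int M) z = S (of_nat M) + (-1) ^ M * S (- of_nat M)"
    unfolding bessel_P_def by (rule sums_unique[symmetric])
  have c: "c m sums S m" for m
    using W(2)[of m] by (simp add: c_def[abs_def] S_def)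
  have "(\<lambda>N. if N < M then 0 else c (- of_nat M) (N - M)) sums S (- of_nat M)"
    using c[of "- of_nat M"] by (subst sums_zero_iff_shift[of M, symmetric]) auto
  then have "(\<lambda>N. c (of_nat M) N + (-1) ^ M * (if N < M then 0 else c (- of_nat M) (N - M)))
     sums bessel_P (int M) z"
    unfolding P by (intro sums_add sums_mult c)
  also have "(\<lambda>N. c (of_nat M) N + (-1) ^ M * (if N < M then 0 else c (- of_nat M) (N - M))) = (\<lambda>N. 
      (-1) ^ Suc N * deriv (\<lambda>p. bessel_diag_coeff z (of_nat M) N p *
           (int_gbinomial (2 * of_nat N - of_nat M - 2 + 2 * p) (int N - 1)
            + int_gbinomial (2 * of_nat N - of_nat M - 2 + 2 * p) (int N - int M - 1))) 0)"
    (is "?l = ?r")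
  proof
    fix N
    let ?I = "\<lambda>j. (-1) ^ Suc N * deriv (\<lambda>p. bessel_diag_coeff z (of_nat M) N p *
           int_gbinomial (2 * of_nat N - of_nat M - 2 + 2 * p) j) 0"
    have 1: "c (of_nat M) N = ?I (int N - 1)"
      by (cases N) (auto simp: c_def int_gbinomial_def)
    have 2: "(-1) ^ M * (if N < M then 0 else c (- of_nat M) (N - M)) = ?I (int N - int M - 1)"
    proof (cases "N \<le> M")
      case True
      then show ?thesis by (auto simp: c_def int_gbinomial_def)
    next
      case False
      then obtain k where N: "N = M + Suc k"
        by (metis add_Suc_right less_imp_Suc_add not_le)
      have "c (- of_nat M) (N - M) = (-1) ^ k * deriv (\<lambda>p. bessel_diag_coeff z (of_nat M) N p
              * ((2 * of_nat N - of_nat M - 2 + 2 * p) gchoose k)) 0"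
        using bessel_diag_coeff_uminus[of M N z]
        by (simp add: c_def N algebra_simps)
      then show ?thesis
        by (simp add: N int_gbinomial_def power_add)
    qed
    show "?l N = ?r N"
      unfolding 1 2 distrib_left[symmetric]
      by (subst deriv_bessel_diag_coeff_add[OF assms]) (auto intro!: holomorphic_intros simp: algebra_simps)
  qed
  finally show "\<dots> sums bessel_P (int M) z" .
qed

text \<open>Only the products with \<open>n = 0\<close> enter, so nothing is collapsed and the upper
  argument of the binomials is not lowered by 2.\<close>

lemma bessel_YJ_sums:
  assumes "z \<noteq> 0"
  shows "(\<lambda>N. (-1) ^ (M + N) * deriv (\<lambda>p. bessel_diag_coeff z (of_nat M) N p *
           (int_gbinomial (2 * of_nat N - of_nat M + 2 * p) (int N)
            + int_gbinomial (2 * of_nat N - of_nat M + 2 * p) (int N - int M))) 0)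
         sums (of_real pi * (bessel_Y 0 z * bessel_J (of_nat M) z + bessel_J 0 z * bessel_Y (of_nat M) z))"
proof -
  define c where "c m N = (-1) ^ N * deriv (\<lambda>p. bessel_diag_coeff z m N p
              * ((2 * of_nat N - m + 2 * p) gchoose N)) 0" for m N
  have c: "c m sums deriv_bessel_J_prod z m 0" for m
    using bessel_J_mult_deriv_sums[OF assms, of m 0]
    by (simp add: c_def[abs_def] deriv_bessel_J_prod_def bessel_prod_coeff_def[abs_def]
        bessel_diag_coeff_def mult_ac)
  have "(\<lambda>N. if N < M then 0 else c (- of_nat M) (N - M)) sums deriv_bessel_J_prod z (- of_nat M) 0"
    using c[of "- of_nat M"] by (subst sums_zero_iff_shift[of M, symmetric]) auto
  then have "(\<lambda>N. (if N < M then 0 else c (- of_nat M) (N - M)) + (-1) ^ M * c (of_nat M) N)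
     sums (of_real pi * (bessel_Y 0 z * bessel_J (of_nat M) z + bessel_J 0 z * bessel_Y (of_nat M) z))"
    unfolding bessel_YJ_eq[OF assms] by (intro sums_add sums_mult c)
  also have "(\<lambda>N. (if N < M then 0 else c (- of_nat M) (N - M)) + (-1) ^ M * c (of_nat M) N) = (\<lambda>N. 
      (-1) ^ (M + N) * deriv (\<lambda>p. bessel_diag_coeff z (of_nat M) N p *
           (int_gbinomial (2 * of_nat N - of_nat M + 2 * p) (int N)
            + int_gbinomial (2 * of_nat N - of_nat M + 2 * p) (int N - int M))) 0)"
    (is "?l = ?r")
  proof
    fix N
    let ?I = "\<lambda>j. (-1) ^ (M + N) * deriv (\<lambda>p. bessel_diag_coeff z (of_nat M) N p *
           int_gbinomial (2 * of_nat N - of_nat M + 2 * p) j) 0"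
    have 1: "(-1) ^ M * c (of_nat M) N = ?I (int N)"
      by (simp add: c_def int_gbinomial_def power_add)
    have 2: "(if N < M then 0 else c (- of_nat M) (N - M)) = ?I (int N - int M)"
    proof (cases "N < M")
      case True
      then show ?thesis by (auto simp: int_gbinomial_def)
    next
      case False
      then obtain k where N: "N = M + k"
        by (metis le_iff_add not_le)
      have "(-1) ^ (M + N) = ((-1) ^ k :: complex)"
        by (simp add: N power_add flip: power_mult_distrib mult.assoc)
      then show ?thesis
        using bessel_diag_coeff_uminus[of M N z]
        by (simp add: c_def N int_gbinomial_def algebra_simps)
    qed
    show "?l N = ?r N"
      unfolding 1 2 distrib_left[symmetric]
      by (subst deriv_bessel_diag_coeff_add[OF assms]) (auto intro!: holomorphic_intros simp: algebra_simps)
  qed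
  finally show ?thesis .
qed

section \<open>Loop integrals as sums of residues\<close>

text \<open>
  The loop is closed by vertical segments halfway between consecutive poles; since \<open>F\<close> at least
  halves under \<open>s \<mapsto> s - 1\<close> far to the left, everything beyond such a segment is negligible.
\<close>

lemma truncated_loop_residue_sums:
  fixes F :: "complex \<Rightarrow> complex" and \<sigma> T0 :: real
  defines "P \<equiv> range (\<lambda>k::nat. of_real \<sigma> - of_nat k)"
  assumes holo: "F holomorphic_on - P"
    and halve: "\<And>s. Re s \<le> T0 \<Longrightarrow> s \<notin> P \<Longrightarrow> norm (F (s - 1)) \<le> norm (F s) / 2"
  obtains S where "(\<lambda>k. residue F (of_real \<sigma> - of_nat k)) sums S"
    "((\<lambda>T. contour_integral (truncated_loop (\<sigma> + 1) 1 T) F) \<longlongrightarrow> 2 * of_real pi * \<i> * S) at_top"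
proof -
  define x where "x n = \<sigma> - real n - 1 / 2" for n
  have contF: "continuous_on A F" if "A \<inter> P = {}" for A
    by (rule continuous_on_subset[OF holomorphic_on_imp_continuous_on[OF holo]]) (use that in auto)
  have P_Im: "Im s = 0" if "s \<in> P" for s
    using that by (auto simp: P_def)
  have x_int: False if "Re s = x n" "s \<in> P" for s n
  proof -
    from that(2) obtain k where "s = of_real \<sigma> - of_nat k" by (auto simp: P_def)
    with that(1) have "2 * int k = 2 * int n + 1" by (simp add: x_def)
    then show False by presburger
  qed
  have far_P: False if "Re s \<ge> \<sigma> + 1" "s \<in> P" for s
    using that by (auto simp: P_def)
  obtain n0 :: nat where n0: "x n0 \<le> T0"
  proof -
    obtain n :: nat where "\<sigma> - T0 \<le> real n" using real_arch_simple by blast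
    then have "x n \<le> T0" unfolding x_def by linarith
    then show thesis by (rule that)
  qed
  \<comment> \<open>The boundary of one cell of width 1 between two vertical cuts. All contour
    pieces further left are translates of parts of it, so a bound on this compact set and repeated
    use of \<open>halve\<close> control them all.\<close>
  define A0 where "A0 = path_image (rectpath (Complex (x (Suc n0)) (-1)) (Complex (x n0) 1))"
  have A0: "A0 = {s. Re s \<in> {x (Suc n0), x n0} \<and> Im s \<in> {-1..1}} \<union>
      {s. Im s \<in> {-1, 1} \<and> Re s \<in> {x (Suc n0)..x n0}}"
    unfolding A0_def by (subst path_image_rectpath) (auto simp: x_def)
  have A0P: "s \<notin> P" if "s \<in> A0" for s
    using that P_Im[of s] x_int[of s] by (auto simp: A0)
  have "compact (F ` A0)"
    using A0P unfolding A0_def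
    by (intro compact_continuous_image contF compact_path_image path_rectpath) auto
  then obtain K where K: "K > 0" "\<And>s. s \<in> A0 \<Longrightarrow> norm (F s) \<le> K"
    by (metis bounded_pos compact_imp_bounded imageI)
  have A0n: "norm (F (s - of_nat n)) \<le> K * (1 / 2) ^ n" if "s \<in> A0" for s n
  proof (induction n)
    case 0
    then show ?case using K(2)[OF that] by simp
  next
    case (Suc n)
    have "s - of_nat n \<notin> P"
    proof
      assume *: "s - of_nat n \<in> P"
      from that have "Im s \<noteq> 0 \<or> Re (s - of_nat n) = x (Suc n0 + n) \<or> Re (s - of_nat n) = x (n0 + n)"
        by (auto simp: A0 x_def)
      then show False using P_Im[OF *] x_int[OF _ *] by auto
    qed
    moreover have "Re (s - of_nat n) \<le> T0"
      using that n0 by (auto simp: A0 x_def)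
    ultimately have "norm (F (s - of_nat n - 1)) \<le> norm (F (s - of_nat n)) / 2"
      by (rule halve[rotated])
    then show ?case using Suc by (simp add: algebra_simps)
  qed
  \<comment> \<open>The factor \<open>2 ^ n0\<close> accounts for the halving starting only at the
    cell \<open>n0\<close>.\<close>
  define \<epsilon> where "\<epsilon> n = K * 2 ^ n0 * (1 / 2) ^ n" for n :: nat
  have \<epsilon>: "\<epsilon> n \<ge> 0" "\<epsilon> (n0 + n) = K * (1 / 2) ^ n" for n
    using K(1) by (simp_all add: \<epsilon>_def power_add power_one_over)
  have hor: "norm (F s) \<le> \<epsilon> n" if "n \<ge> n0" "\<bar>Im s\<bar> = 1" "Re s \<in> {x (Suc n)..x n}" for s n
  proof -
    from that(1) obtain j where n: "n = n0 + j" using le_Suc_ex by blast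
    have "s + of_nat j \<in> A0"
      using that by (auto simp: A0 x_def n)
    from A0n[OF this, of j] show ?thesis by (simp add: n \<epsilon>)
  qed
  have ver: "norm (F s) \<le> \<epsilon> n" if "n \<ge> n0" "\<bar>Im s\<bar> \<le> 1" "Re s = x n" for s n
  proof -
    from that(1) obtain j where n: "n = n0 + j" using le_Suc_ex by blast
    have "s + of_nat j \<in> A0"
      using that by (auto simp: A0 x_def n)
    from A0n[OF this, of j] show ?thesis by (simp add: n \<epsilon>)
  qed
  have int_hor: "F contour_integrable_on linepath (Complex a y) (Complex b y)"
    "continuous_on (closed_segment (Complex a y) (Complex b y)) F" if "\<bar>y\<bar> = 1" for a b y
  proof -
    have "closed_segment (Complex a y) (Complex b y) \<inter> P = {}"
      using that P_Im by (fastforce simp: closed_segment_same_Im)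
    then show "continuous_on (closed_segment (Complex a y) (Complex b y)) F" by (rule contF)
    then show "F contour_integrable_on linepath (Complex a y) (Complex b y)"
      by (rule contour_integrable_continuous_linepath)
  qed
  have int_ver: "F contour_integrable_on linepath (Complex r a) (Complex r b)"
    if "r = \<sigma> + 1 \<or> r = x n" for r n a b
  proof -
    have "s \<notin> P" if "s \<in> closed_segment (Complex r a) (Complex r b)" for s
      using that \<open>r = \<sigma> + 1 \<or> r = x n\<close> x_int[of s n] far_P[of s] by (auto simp: closed_segment_same_Re)
    then show ?thesis
      by (intro contour_integrable_continuous_linepath contF) auto
  qed
  define I where "I T = contour_integral (truncated_loop (\<sigma> + 1) 1 T) F" for T
  define H where "H y a b = contour_integral (linepath (Complex a y) (Complex b y)) F" for y a b
  define V where "V r a b = contour_integral (linepath (Complex r a) (Complex r b)) F" for r a b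
  have I_eq: "I T = H (-1) (-T) (\<sigma> + 1) + V (\<sigma> + 1) (-1) 1 + H 1 (\<sigma> + 1) (-T)" for T
    unfolding I_def truncated_loop_def H_def V_def
    by (simp add: int_hor int_ver)
  have H_bound: "norm (H y a b) \<le> \<epsilon> n" if "n \<ge> n0" "\<bar>y\<bar> = 1" "a \<in> {x (Suc n)..x n}" "b \<in> {x (Suc n)..x n}"
    for n a b y
  proof -
    have "norm (H y a b) \<le> \<epsilon> n * norm (Complex b y - Complex a y)"
      unfolding H_def
    proof (rule contour_integral_bound_linepath)
      fix s assume "s \<in> closed_segment (Complex a y) (Complex b y)"
      then have "Im s = y" "Re s \<in> closed_segment a b" by (auto simp: closed_segment_same_Im)
      moreover have "closed_segment a b \<subseteq> {x (Suc n)..x n}"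
        using that by (intro closed_segment_subset) (auto simp: convex_real_interval)
      ultimately show "norm (F s) \<le> \<epsilon> n" using that by (intro hor) auto
    qed (use int_hor that \<epsilon> in auto)
    also have "\<dots> \<le> \<epsilon> n * 1"
    proof (rule mult_left_mono)
      have "\<bar>b - a\<bar> \<le> x n - x (Suc n)" using that by auto
      then show "norm (Complex b y - Complex a y) \<le> 1"
        by (simp add: complex_diff complex_norm x_def)
    qed (use \<epsilon> in auto)
    finally show ?thesis by simp
  qed
  have V_bound: "norm (V (x n) 1 (-1)) \<le> 2 * \<epsilon> n" if "n \<ge> n0" for n
  proof -
    have "norm (V (x n) 1 (-1)) \<le> \<epsilon> n * norm (Complex (x n) (-1) - Complex (x n) 1)"
      unfolding V_def
    proof (rule contour_integral_bound_linepath)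
      fix s assume "s \<in> closed_segment (Complex (x n) 1) (Complex (x n) (-1))"
      then show "norm (F s) \<le> \<epsilon> n"
        using that by (intro ver) (auto simp: closed_segment_same_Re closed_segment_eq_real_ivl)
    qed (use int_ver[of "x n" n] \<epsilon> in auto)
    then show ?thesis by (simp add: complex_diff complex_norm mult.commute)
  qed
  have x_mono: "x (Suc n) \<le> x n" "x n < \<sigma>" for n
    by (auto simp: x_def)
  have I_diff: "norm (I T - I (- x n)) \<le> 2 * \<epsilon> n" if "n \<ge> n0" "- T \<in> {x (Suc n)..x n}" for n T
  proof -
    have seg: "Complex (x n) y \<in> closed_segment (Complex (- T) y) (Complex (\<sigma> + 1) y)" for y
      using that(2) x_mono(2)[of n] by (simp add: closed_segment_same_Im closed_segment_eq_real_ivl)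
    have 1: "H (-1) (-T) (\<sigma> + 1) = H (-1) (-T) (x n) + H (-1) (x n) (\<sigma> + 1)"
      unfolding H_def by (rule contour_integral_split_linepath) (use int_hor seg in auto)
    have 2: "H 1 (\<sigma> + 1) (-T) = H 1 (\<sigma> + 1) (x n) + H 1 (x n) (-T)"
      unfolding H_def by (rule contour_integral_split_linepath)
        (use int_hor seg in \<open>auto simp: closed_segment_commute\<close>)
    have "I T - I (- x n) = H (-1) (-T) (x n) + H 1 (x n) (-T)"
      unfolding I_eq 1 2 by simp
    also have "norm \<dots> \<le> \<epsilon> n + \<epsilon> n"
      using that x_mono(1)[of n] by (intro norm_triangle_le add_mono H_bound) auto
    finally show ?thesis by simp
  qed
  have rect: "I (- x n) + V (x n) 1 (-1) = 2 * of_real pi * \<i> * (\<Sum>k<Suc n. residue F (of_real \<sigma> - of_nat k))" for n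
  proof -
    let ?a = "Complex (x n) (-1)" and ?b = "Complex (\<sigma> + 1) 1"
    define pts where "pts = (\<lambda>k::nat. of_real \<sigma> - of_nat k :: complex) ` {..n}"
    \<comment> \<open>The margin \<open>1 / 4\<close> makes room for the closed rectangle, whose
      left side is at \<open>x n\<close>, but stays to the right of the next pole, which is at
      distance \<open>1 / 2\<close> from that side.\<close>
    define U where "U = {s. Re s > x n - 1 / 4}"
    have UP: "U - pts \<subseteq> - P"
    proof
      fix s assume s: "s \<in> U - pts"
      show "s \<in> - P"
      proof
        assume "s \<in> P"
        then obtain k where k: "s = of_real \<sigma> - of_nat k" by (auto simp: P_def)
        with s have "real k < real n + 3 / 4" by (auto simp: U_def x_def)
        then have "k \<le> n" by linarith
        with s k show False by (auto simp: pts_def)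
      qed
    qed
    have cbox: "cbox ?a ?b \<subseteq> U"
      by (auto simp: U_def in_cbox_complex_iff)
    have img: "path_image (rectpath ?a ?b) = {s. Re s \<in> {x n, \<sigma> + 1} \<and> Im s \<in> {-1..1}} \<union>
           {s. Im s \<in> {-1, 1} \<and> Re s \<in> {x n..\<sigma> + 1}}"
      using x_mono(2)[of n] by (subst path_image_rectpath) auto
    have "contour_integral (rectpath ?a ?b) F = 2 * pi * \<i> *
        (\<Sum>p\<in>pts. winding_number (rectpath ?a ?b) p * residue F p)"
    proof (rule Residue_theorem)
      show "open U" unfolding U_def by (rule open_halfspace_Re_gt)
      show "connected U" unfolding U_def by (intro convex_connected convex_halfspace_Re_gt)
      show "finite pts" by (simp add: pts_def)
      show "F holomorphic_on U - pts" by (rule holomorphic_on_subset[OF holo UP])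
      have "s \<in> U" if "s \<in> path_image (rectpath ?a ?b)" for s
        using that x_mono(2)[of n] by (auto simp: img U_def)
      moreover have "s \<notin> pts" if "s \<in> path_image (rectpath ?a ?b)" for s
      proof
        assume "s \<in> pts"
        then have "s \<in> P" by (auto simp: pts_def P_def)
        then show False using that P_Im[of s] x_int[of s n] far_P[of s] by (auto simp: img)
      qed
      ultimately show "path_image (rectpath ?a ?b) \<subseteq> U - pts" by blast
      show "\<forall>s. s \<notin> U \<longrightarrow> winding_number (rectpath ?a ?b) s = 0"
        using cbox x_mono(2)[of n] by (auto intro!: winding_number_rectpath_outside)
    qed auto
    also have "(\<Sum>p\<in>pts. winding_number (rectpath ?a ?b) p * residue F p) = (\<Sum>p\<in>pts. residue F p)"
      by (intro sum.cong) (auto simp: pts_def winding_number_rectpath in_box_complex_iff x_def)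
    also have "\<dots> = (\<Sum>k<Suc n. residue F (of_real \<sigma> - of_nat k))"
      unfolding pts_def lessThan_Suc_atMost by (subst sum.reindex) (auto simp: inj_on_def)
    also have "contour_integral (rectpath ?a ?b) F =
        H (-1) (x n) (\<sigma> + 1) + V (\<sigma> + 1) (-1) 1 + H 1 (\<sigma> + 1) (x n) + V (x n) 1 (-1)"
      unfolding rectpath_def Let_def H_def V_def
      using int_ver[of "x n" n] by (simp add: int_hor int_ver)
    finally show ?thesis by (simp add: I_eq)
  qed
  have \<epsilon>_lim: "\<epsilon> \<longlonglongrightarrow> 0"
    unfolding \<epsilon>_def[abs_def] using LIMSEQ_power_zero[of "1 / 2 :: real"]
    by (auto intro: tendsto_mult_right_zero)
  \<comment> \<open>Convergence of \<open>I (- x n)\<close> comes from its telescoping differences,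
    which have a geometric majorant; the limit itself is not known in advance.\<close>
  have "summable (\<lambda>n. I (- x (Suc n)) - I (- x n))"
  proof (rule summable_comparison_test[OF exI, OF allI, OF impI])
    show "summable (\<lambda>n. 2 * \<epsilon> n)"
      unfolding \<epsilon>_def by (intro summable_mult summable_geometric) auto
    show "norm (I (- x (Suc n)) - I (- x n)) \<le> 2 * \<epsilon> n" if "n0 \<le> n" for n
      using that x_mono(1)[of n] by (intro I_diff) auto
  qed
  from summable_LIMSEQ[OF this]
  have "(\<lambda>n. I (- x n) - I (- x 0)) \<longlonglongrightarrow> (\<Sum>n. I (- x (Suc n)) - I (- x n))"
    using sum_lessThan_telescope[of "\<lambda>n. I (- x n)"] by simp
  from tendsto_add[OF this tendsto_const, of "I (- x 0)"]
  obtain L where L: "(\<lambda>n. I (- x n)) \<longlonglongrightarrow> L" by auto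
  have "(\<lambda>n. V (x n) 1 (-1)) \<longlonglongrightarrow> 0"
  proof (rule Lim_null_comparison)
    show "\<forall>\<^sub>F n in sequentially. norm (V (x n) 1 (-1)) \<le> 2 * \<epsilon> n"
      using eventually_ge_at_top[of n0] by eventually_elim (rule V_bound)
    show "(\<lambda>n. 2 * \<epsilon> n) \<longlonglongrightarrow> 0" using \<epsilon>_lim by (rule tendsto_mult_right_zero)
  qed
  from tendsto_add[OF L this]
  have "(\<lambda>n. 2 * of_real pi * \<i> * (\<Sum>k<Suc n. residue F (of_real \<sigma> - of_nat k))) \<longlonglongrightarrow> L"
    unfolding rect by simp
  from tendsto_divide[OF this tendsto_const, of "2 * of_real pi * \<i>"]
  have "(\<lambda>n. \<Sum>k<Suc n. residue F (of_real \<sigma> - of_nat k)) \<longlonglongrightarrow> L / (2 * of_real pi * \<i>)"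
    by simp
  then have sums: "(\<lambda>k. residue F (of_real \<sigma> - of_nat k)) sums (L / (2 * of_real pi * \<i>))"
    unfolding sums_def by (rule LIMSEQ_imp_Suc)
  \<comment> \<open>Chosen so that \<open>x (Suc n) \<le> - T \<le> x n\<close> for
    \<open>n = nn T\<close>: the cell in which the loop cut at \<open>- T\<close> ends.\<close>
  define nn where "nn T = nat \<lfloor>T + (\<sigma> - 1 / 2)\<rfloor>" for T :: real
  have nn_top: "filterlim nn at_top at_top"
    unfolding filterlim_at_top
  proof
    fix Z :: nat
    show "\<forall>\<^sub>F T in at_top. Z \<le> nn T"
      using eventually_ge_at_top[of "real Z - (\<sigma> - 1 / 2)"]
      unfolding nn_def by eventually_elim linarith
  qed
  have "((\<lambda>T. I T - I (- x (nn T))) \<longlongrightarrow> 0) at_top"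
  proof (rule Lim_null_comparison)
    show "\<forall>\<^sub>F T in at_top. norm (I T - I (- x (nn T))) \<le> 2 * \<epsilon> (nn T)"
      using filterlim_at_top[THEN iffD1, OF nn_top, THEN spec, of n0]
        eventually_ge_at_top[of "- (\<sigma> - 1 / 2)"]
    proof eventually_elim
      case (elim T)
      have "- T \<in> {x (Suc (nn T))..x (nn T)}"
        using elim(2) unfolding x_def nn_def by (simp, linarith)
      with elim(1) show ?case by (rule I_diff)
    qed
    show "((\<lambda>T. 2 * \<epsilon> (nn T)) \<longlongrightarrow> 0) at_top"
      using filterlim_compose[OF \<epsilon>_lim nn_top] by (rule tendsto_mult_right_zero)
  qed
  from tendsto_add[OF this filterlim_compose[OF L nn_top]]
  have "(I \<longlongrightarrow> L) at_top" by simp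
  then show thesis
    using that[OF sums] by (simp add: I_def[abs_def])
qed

section \<open>Residues of the Meijer integrand\<close>

text \<open>By the functional equation of Gamma, \<open>s \<mapsto> s - 1\<close> multiplies the
  integrand by \<open>z\<close> times two linear factors over four linear factors, a ratio of order
  \<open>1 / norm s ^ 2\<close>. No asymptotics of Gamma enter.\<close>

lemma meijer_G_integrand_halves:
  obtains T0 where "\<And>s. Re s \<le> T0 \<Longrightarrow> b1 + s \<notin> \<int>\<^sub>\<le>\<^sub>0 \<Longrightarrow> b2 + s \<notin> \<int>\<^sub>\<le>\<^sub>0 \<Longrightarrow> b3 + s \<notin> \<int>\<^sub>\<le>\<^sub>0 \<Longrightarrow>
    norm (meijer_G_integrand a1 a2 b1 b2 b3 b4 z (s - 1))
      \<le> norm (meijer_G_integrand a1 a2 b1 b2 b3 b4 z s) / 2"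
proof -
  define A where "A = Max {norm a1, norm a2, norm b1, norm b2, norm b3, norm b4}"
  have A: "norm a1 \<le> A" "norm a2 \<le> A" "norm b1 \<le> A" "norm b2 \<le> A" "norm b3 \<le> A" "norm b4 \<le> A"
    unfolding A_def by (intro Max_ge; simp)+
  have "A \<ge> 0" using A(1) norm_ge_zero order_trans by blast
  \<comment> \<open>With \<open>r = norm s\<close>, numerator factors are at most
    \<open>2 * r\<close> and denominator factors at least \<open>r / 2\<close>, so the ratio is at
    most \<open>64 * norm z / r ^ 2\<close>; \<open>r \<ge> 128 * norm z\<close> and
    \<open>r \<ge> 1\<close> bring it below \<open>1 / 2\<close>.\<close>
  define B where "B = 128 * norm z"
  have "B \<ge> 0" by (simp add: B_def)
  define K where "K = 2 * (1 + A) + B"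
  show thesis
  proof (rule that[of "- K"])
    fix s
    assume s: "Re s \<le> - K" and b: "b1 + s \<notin> \<int>\<^sub>\<le>\<^sub>0" "b2 + s \<notin> \<int>\<^sub>\<le>\<^sub>0" "b3 + s \<notin> \<int>\<^sub>\<le>\<^sub>0"
    define r where "r = norm s"
    have K: "K \<ge> 1" "B \<le> K" "1 + norm a1 \<le> K" "1 + norm a2 \<le> K"
      "2 * (1 + norm b1) \<le> K" "2 * (1 + norm b2) \<le> K" "2 * (1 + norm b3) \<le> K"
      "2 * (1 + norm b4) \<le> K"
      using A \<open>A \<ge> 0\<close> \<open>B \<ge> 0\<close> unfolding K_def by auto
    have "r \<ge> K"
      using s abs_Re_le_cmod[of s] unfolding r_def by linarith
    with K have r: "r \<ge> K" "K \<ge> 1" "r > 0" by auto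
    have up: "norm (a + s - 1) \<le> 2 * r" if "1 + norm a \<le> r" for a
      using norm_triangle_ineq[of "a - 1" s] norm_triangle_ineq4[of a 1] that
      by (simp add: r_def algebra_simps)
    have lo: "norm (b + s - 1) \<ge> r / 2" if "2 * (1 + norm b) \<le> r" for b
      using norm_triangle_ineq2[of s "1 - b"] norm_triangle_ineq4[of 1 b] that
      by (simp add: r_def algebra_simps)
    have small: "1 + norm a1 \<le> r" "1 + norm a2 \<le> r" "2 * (1 + norm b1) \<le> r"
      "2 * (1 + norm b2) \<le> r" "2 * (1 + norm b3) \<le> r" "2 * (1 + norm b4) \<le> r"
      using r K by auto
    define w where "w = 1 - b4 - s"
    have w: "norm w \<ge> r / 2"
      using lo[of b4] small by (simp add: w_def norm_minus_commute algebra_simps)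
    have w0: "w \<noteq> 0" using w r by auto
    have G: "Gamma (b + (s - 1)) = Gamma (b + s) / (b + s - 1)"
      if "b + s \<notin> \<int>\<^sub>\<le>\<^sub>0" "2 * (1 + norm b) \<le> r" for b
    proof -
      have "b + s - 1 \<noteq> 0" using lo[OF that(2)] r by auto
      moreover have "b + s - 1 \<notin> \<int>\<^sub>\<le>\<^sub>0"
      proof
        assume "b + s - 1 \<in> \<int>\<^sub>\<le>\<^sub>0"
        then obtain n where n: "b + s - 1 = - of_nat n" by (elim nonpos_Ints_cases')
        with \<open>b + s - 1 \<noteq> 0\<close> obtain k where "n = Suc k" by (cases n) auto
        with n have "b + s = - of_nat k" by (simp add: eq_neg_iff_add_eq_0 algebra_simps)
        with that(1) show False by simp
      qed
      ultimately show ?thesis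
        using Gamma_plus1[of "b + s - 1"] by (simp add: field_simps)
    qed
    have rG: "rGamma (a + (s - 1)) = (a + s - 1) * rGamma (a + s)" for a
      using rGamma_plus1[of "a + s - 1"] by (simp add: algebra_simps)
    have rGw: "rGamma (1 - b4 - (s - 1)) = rGamma (1 - b4 - s) / w"
      using rGamma_plus1[of w] w0 by (simp add: w_def field_simps)
    have zp: "z powr - (s - 1) = z * z powr (- s)"
      by (cases "z = 0") (simp_all add: powr_def algebra_simps exp_diff exp_minus divide_inverse)
    have "meijer_G_integrand a1 a2 b1 b2 b3 b4 z (s - 1) =
        (z * (a1 + s - 1) * (a2 + s - 1) / ((b1 + s - 1) * (b2 + s - 1) * (b3 + s - 1) * w))
        * meijer_G_integrand a1 a2 b1 b2 b3 b4 z s"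
      unfolding meijer_G_integrand_def G[OF b(1) small(3)] G[OF b(2) small(4)] G[OF b(3) small(5)]
        rG rGw zp by (simp add: mult_ac)
    moreover have "norm (z * (a1 + s - 1) * (a2 + s - 1) /
        ((b1 + s - 1) * (b2 + s - 1) * (b3 + s - 1) * w)) \<le> 1 / 2"
    proof -
      have "norm z * norm (a1 + s - 1) * norm (a2 + s - 1) \<le> norm z * (2 * r) * (2 * r)"
        using up small r by (intro mult_mono) auto
      moreover have "norm (b1 + s - 1) * norm (b2 + s - 1) * norm (b3 + s - 1) * norm w
          \<ge> (r / 2) * (r / 2) * (r / 2) * (r / 2)"
        using lo small r w by (intro mult_mono mult_nonneg_nonneg) auto
      ultimately have "norm (z * (a1 + s - 1) * (a2 + s - 1) /
          ((b1 + s - 1) * (b2 + s - 1) * (b3 + s - 1) * w))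
          \<le> (norm z * (2 * r) * (2 * r)) / ((r / 2) * (r / 2) * (r / 2) * (r / 2))"
        unfolding norm_divide norm_mult using r by (intro frac_le) auto
      also have "\<dots> = 64 * norm z / r ^ 2"
        using r by (simp add: field_simps power2_eq_square)
      also have "\<dots> \<le> 1 / 2"
      proof -
        have "128 * norm z \<le> r"
          using r K B_def by linarith
        also have "r \<le> r ^ 2"
          using r by (intro self_le_power) auto
        finally show ?thesis using r by (simp add: field_simps)
      qed
      finally show ?thesis .
    qed
    ultimately show "norm (meijer_G_integrand a1 a2 b1 b2 b3 b4 z (s - 1))
      \<le> norm (meijer_G_integrand a1 a2 b1 b2 b3 b4 z s) / 2"
      unfolding norm_mult
      by (metis (no_types, lifting) mult_right_mono norm_ge_zero norm_mult times_divide_eq_left mult_1)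
  qed
qed

text \<open>The form of the parameters puts all poles into the one sequence \<open>\<sigma>\<close>,
  \<open>\<sigma> - 1\<close>, ..., and a vanishing \<open>k1\<close>, \<open>k2\<close> or
  \<open>k3\<close> makes \<open>\<sigma>\<close> the rightmost; the loop of the definition then has
  \<open>c = \<sigma> + 1\<close> and \<open>d = 1\<close>. The limit behind \<open>Lim\<close> is
  shown to exist.\<close>

lemma meijer_G_residue_sums:
  fixes \<sigma> :: real
  assumes "z \<noteq> 0"
    and b: "b1 = of_nat k1 - of_real \<sigma>" "b2 = of_nat k2 - of_real \<sigma>" "b3 = of_nat k3 - of_real \<sigma>"
    and "k1 = 0 \<or> k2 = 0 \<or> k3 = 0"
  shows "(\<lambda>k. residue (meijer_G_integrand a1 a2 b1 b2 b3 b4 z) (of_real \<sigma> - of_nat k))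
    sums meijer_G_3_0_2_4 z a1 a2 b1 b2 b3 b4"
proof -
  define P where "P = range (\<lambda>k::nat. of_real \<sigma> - of_nat k :: complex)"
  have pole: "of_nat j - of_real \<sigma> + s \<notin> \<int>\<^sub>\<le>\<^sub>0" if "s \<notin> P" for s and j :: nat
  proof
    assume "of_nat j - of_real \<sigma> + s \<in> \<int>\<^sub>\<le>\<^sub>0"
    then obtain n where "of_nat j - of_real \<sigma> + s = - of_nat n" by (elim nonpos_Ints_cases')
    then have "s = of_real \<sigma> - of_nat (j + n)" by (simp add: algebra_simps)
    with that show False unfolding P_def by blast
  qed
  obtain T0 where T0: "\<And>s. Re s \<le> T0 \<Longrightarrow> b1 + s \<notin> \<int>\<^sub>\<le>\<^sub>0 \<Longrightarrow> b2 + s \<notin> \<int>\<^sub>\<le>\<^sub>0 \<Longrightarrow> b3 + s \<notin> \<int>\<^sub>\<le>\<^sub>0 \<Longrightarrow>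
      norm (meijer_G_integrand a1 a2 b1 b2 b3 b4 z (s - 1))
      \<le> norm (meijer_G_integrand a1 a2 b1 b2 b3 b4 z s) / 2"
    using meijer_G_integrand_halves[of b1 b2 b3 a1 a2 b4 z] by blast
  have holo: "meijer_G_integrand a1 a2 b1 b2 b3 b4 z holomorphic_on - P"
    unfolding meijer_G_integrand_def[abs_def] b using pole
    by (intro holomorphic_intros) auto
  have halve: "norm (meijer_G_integrand a1 a2 b1 b2 b3 b4 z (s - 1))
      \<le> norm (meijer_G_integrand a1 a2 b1 b2 b3 b4 z s) / 2" if "Re s \<le> T0" "s \<notin> P" for s
    using T0[OF that(1)] pole[OF that(2)] b by simp
  obtain S where S: "(\<lambda>k. residue (meijer_G_integrand a1 a2 b1 b2 b3 b4 z) (of_real \<sigma> - of_nat k)) sums S"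
    "((\<lambda>T. contour_integral (truncated_loop (\<sigma> + 1) 1 T) (meijer_G_integrand a1 a2 b1 b2 b3 b4 z))
        \<longlongrightarrow> 2 * of_real pi * \<i> * S) at_top"
    by (rule truncated_loop_residue_sums[OF holo[unfolded P_def] halve[unfolded P_def]])
  have Max: "Max {- Re b1, - Re b2, - Re b3} = \<sigma>" and Im: "Im b1 = 0" "Im b2 = 0" "Im b3 = 0"
    using assms(5) by (auto simp: b)
  have "meijer_G_3_0_2_4 z a1 a2 b1 b2 b3 b4 = S"
    unfolding meijer_G_3_0_2_4_def Max Im Let_def
    using tendsto_Lim[OF _ S(2)] by (simp add: add.commute)
  with S(1) show ?thesis by simp
qed

lemma even_function_deriv_0:
  fixes f :: "complex \<Rightarrow> complex"
  assumes "f field_differentiable at 0" "\<And>x. f (- x) = f x"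
  shows "deriv f 0 = 0"
proof -
  have D: "(f has_field_derivative deriv f 0) (at 0)"
    using assms(1) by (simp add: DERIV_deriv_iff_field_differentiable)
  have "((\<lambda>x. f (- x)) has_field_derivative deriv f 0 * (-1)) (at 0)"
    by (rule DERIV_chain2[of f]) (use D in \<open>auto intro!: derivative_eq_intros\<close>)
  then have "(f has_field_derivative - deriv f 0) (at 0)" by (simp add: assms(2))
  with D have "deriv f 0 = - deriv f 0" by (rule DERIV_unique)
  then show ?thesis by simp
qed

text \<open>
  The double pole of \<open>cos (\<pi>u) / sin\<^sup>2 (\<pi>u)\<close> at an integer has an even local expansion, so only the
  derivative of \<open>q\<close> survives in the residue.
\<close>

lemma residue_cos_over_sin_squared:
  fixes q F :: "complex \<Rightarrow> complex" and c :: complex and j :: int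
  defines "s0 \<equiv> c - of_int j"
  assumes r: "0 < r" "r \<le> 1" and q: "q holomorphic_on ball (of_int j) r"
    and F: "\<forall>\<^sub>F s in at s0. F s
      = - 2 * of_real pi ^ 2 * cos (of_real pi * (c - s)) / sin (of_real pi * (c - s)) ^ 2 * q (c - s)"
  shows "residue F s0 = 2 * (-1) powi j * deriv q (of_int j)"
proof -
  define e :: complex where "e = (-1) powi j"
  have e: "e * e = 1" by (simp add: e_def flip: power_int_mult_distrib)
  have cos_j: "cos (of_real pi * of_int j :: complex) = e" and sin_j: "sin (of_real pi * of_int j :: complex) = 0"
    using cos_sin_int_pi[of j] by (simp_all add: e_def mult.commute)
  define f where "f v = sin (of_real pi * v)" for v :: complex
  have f': "(f has_field_derivative of_real pi) (at 0)"
    unfolding f_def by (auto intro!: derivative_eq_intros)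
  \<comment> \<open>Removes the singularity of \<open>sin (\<pi> v) / v\<close>. As \<open>S\<close>
    is even and has no zero in the unit disc, the integrand is \<open>h s / (s - s0) ^ 2\<close>
    with \<open>h\<close> holomorphic, and \<open>S\<close> and the cosine contribute nothing to
    \<open>deriv h s0\<close>.\<close>
  define S where "S v = (if v = 0 then of_real pi else sin (of_real pi * v) / v)" for v :: complex
  have "(\<lambda>v. if v = 0 then deriv f 0 else (f v - f 0) / (v - 0)) holomorphic_on UNIV"
    by (rule pole_lemma) (auto simp: f_def[abs_def] intro!: holomorphic_intros)
  also have "(\<lambda>v. if v = 0 then deriv f 0 else (f v - f 0) / (v - 0)) = S"
    using DERIV_imp_deriv[OF f'] by (auto simp: S_def f_def)
  finally have S: "S holomorphic_on UNIV" .
  have S_diff: "S field_differentiable at v" for v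
    using S by (auto simp: holomorphic_on_def)
  have "deriv S 0 = 0"
    by (rule even_function_deriv_0[OF S_diff]) (auto simp: S_def)
  then have S': "(S has_field_derivative 0) (at 0)"
    using S_diff[of 0] DERIV_deriv_iff_field_differentiable by metis
  have S_nz: "S v \<noteq> 0" if "norm v < 1" for v
  proof (cases "v = 0")
    case False
    have "sin (of_real pi * v) \<noteq> 0"
    proof
      assume "sin (of_real pi * v) = 0"
      then obtain n :: int where "of_real pi * v = of_real pi * of_int n"
        unfolding sin_eq_0 by (auto simp: mult.commute)
      then have "v = of_int n" by simp
      with that False show False by auto
    qed
    with False show ?thesis by (simp add: S_def)
  qed (simp add: S_def)
  define h where "h s = - 2 * of_real pi ^ 2 * e * (cos (of_real pi * (s - s0)) * q (of_int j - (s - s0)) / S (s - s0) ^ 2)" for s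
  have "h holomorphic_on ball s0 r"
  proof -
    have "(\<lambda>s. q (of_int j - (s - s0))) holomorphic_on ball s0 r"
    proof (rule holomorphic_on_compose_gen[OF _ q, unfolded o_def])
      show "(\<lambda>s. of_int j - (s - s0)) ` ball s0 r \<subseteq> ball (of_int j) r"
        by (auto simp: dist_norm norm_minus_commute)
    qed (intro holomorphic_intros)
    moreover have "(\<lambda>s. S (s - s0)) holomorphic_on ball s0 r"
      by (rule holomorphic_on_compose_gen[OF _ S, unfolded o_def]) (auto intro!: holomorphic_intros)
    ultimately show ?thesis
      unfolding h_def using S_nz r
      by (intro holomorphic_intros) (auto simp: dist_norm norm_minus_commute)
  qed
  then have "residue (\<lambda>s. h s / (s - s0) ^ Suc 1) s0 = (deriv ^^ 1) h s0 / fact 1"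
    using r by (intro residue_holomorphic_over_power[of "ball s0 r"]) auto
  also have "residue (\<lambda>s. h s / (s - s0) ^ Suc 1) s0 = residue F s0"
  proof (rule residue_cong[OF _ refl])
    have "\<forall>\<^sub>F s in at s0. s \<noteq> s0" by (simp add: eventually_at_filter)
    with F show "\<forall>\<^sub>F s in at s0. h s / (s - s0) ^ Suc 1 = F s"
    proof eventually_elim
      case (elim s)
      define v where "v = s - s0"
      have v: "v \<noteq> 0" using elim(2) by (simp add: v_def)
      have cs: "c - s = of_int j - v" by (simp add: v_def s0_def)
      have "cos (of_real pi * (of_int j - v)) = e * cos (of_real pi * v)"
        "sin (of_real pi * (of_int j - v)) ^ 2 = sin (of_real pi * v) ^ 2"
        using e by (simp_all add: right_diff_distrib cos_diff sin_diff cos_j sin_j power_mult_distrib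
            power2_eq_square)
      then show ?case
        unfolding elim(1) cs h_def v_def[symmetric] using v by (simp add: S_def power2_eq_square)
    qed
  qed
  also have "(deriv ^^ 1) h s0 / fact 1 = 2 * e * deriv q (of_int j)"
  proof -
    have q': "(q has_field_derivative deriv q (of_int j)) (at (of_int j))"
      using holomorphic_derivI[OF q] r by auto
    have 1: "((\<lambda>s. q (of_int j - (s - s0))) has_field_derivative deriv q (of_int j) * (-1)) (at s0)"
      by (rule DERIV_chain2[of q]) (use q' in \<open>auto intro!: derivative_eq_intros\<close>)
    have 2: "((\<lambda>s. S (s - s0)) has_field_derivative 0 * 1) (at s0)"
      by (rule DERIV_chain2[of S]) (use S' in \<open>auto intro!: derivative_eq_intros\<close>)
    have 3: "((\<lambda>s. S (s - s0) ^ 2) has_field_derivative 0) (at s0)"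
      using DERIV_power[OF 2, of 2] by simp
    have 4: "((\<lambda>s. cos (of_real pi * (s - s0))) has_field_derivative 0) (at s0)"
      by (auto intro!: derivative_eq_intros)
    have "(h has_field_derivative 2 * e * deriv q (of_int j)) (at s0)"
      unfolding h_def[abs_def]
      using DERIV_cmult[OF DERIV_divide[OF DERIV_mult[OF 4 1] 3], of "- 2 * of_real pi ^ 2 * e"]
      by (simp add: S_def power2_eq_square mult.assoc)
    then show ?thesis by (simp add: DERIV_imp_deriv)
  qed
  finally show ?thesis by (simp add: e_def)
qed

section \<open>The Meijer integrand in reflected form\<close>

text \<open>
  By the duplication formula this is \<open>Gamma (2 * u + 1) / Gamma (u + 1)\<close>, continued analytically
  to the negative integers.
\<close>

definition dup_quot :: "complex \<Rightarrow> complex" where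
  "dup_quot u = exp (2 * u * of_real (ln 2)) * Gamma (u + 1/2) / of_real (sqrt pi)"

text \<open>The single condition \<open>2 * u \<notin> \<int>\<close> keeps every argument of the
  form \<open>n / 2 + u\<close> or \<open>n / 2 - u\<close> off the poles of Gamma.\<close>

lemma not_nonpos_Int_if_double:
  fixes u w :: complex
  assumes "2 * u \<notin> \<int>" "2 * w = of_int n + 2 * u \<or> 2 * w = of_int n - 2 * u"
  shows "w \<notin> \<int>\<^sub>\<le>\<^sub>0"
proof
  assume "w \<in> \<int>\<^sub>\<le>\<^sub>0"
  then have "w \<in> \<int>" by (elim nonpos_Ints_cases') simp
  then have "2 * w - of_int n \<in> \<int>" "of_int n - 2 * w \<in> \<int>" by auto
  moreover from assms(2) have "2 * u = 2 * w - of_int n \<or> 2 * u = of_int n - 2 * w"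
    by (metis add_diff_cancel_left' diff_diff_eq2 add_diff_cancel)
  ultimately show False using assms(1) by metis
qed

lemma dup_quot_eq:
  assumes "2 * u \<notin> \<int>"
  shows "dup_quot u = Gamma (2 * u + 1) * rGamma (u + 1)"
proof -
  have 1: "u + 1/2 \<notin> \<int>\<^sub>\<le>\<^sub>0" and 2: "u + 1 \<notin> \<int>\<^sub>\<le>\<^sub>0"
    using not_nonpos_Int_if_double[OF assms, of "u + 1/2" 1] not_nonpos_Int_if_double[OF assms, of "u + 1" 2]
    by simp_all
  have "Gamma (u + 1/2) * Gamma (u + 1)
      = exp (- (2 * u * of_real (ln 2))) * of_real (sqrt pi) * Gamma (2 * u + 1)"
    using Gamma_legendre_duplication[of "u + 1/2"] 1 2 by (simp add: algebra_simps)
  moreover have "Gamma (u + 1) \<noteq> 0" using 2 by (simp add: Gamma_eq_zero_iff)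
  ultimately show ?thesis
    by (simp add: dup_quot_def rGamma_inverse_Gamma exp_minus field_simps)
qed

text \<open>Half-integers, among which are the poles of \<open>Gamma (u + 1/2)\<close>, lie just
  outside these balls. In the punctured ball the Gamma formulas for
  \<open>2 * u \<notin> \<int>\<close> all apply.\<close>

lemma ball_int_half:
  fixes u :: complex
  assumes "u \<in> ball (of_int j) (1/2)"
  shows "u + 1/2 \<notin> \<int>\<^sub>\<le>\<^sub>0" and "u \<noteq> of_int j \<Longrightarrow> 2 * u \<notin> \<int>"
proof -
  have Re: "\<bar>Re u - of_int j\<bar> < 1/2"
    using assms abs_Re_le_cmod[of "u - of_int j"] by (simp add: dist_norm norm_minus_commute)
  show "u + 1/2 \<notin> \<int>\<^sub>\<le>\<^sub>0"
  proof
    assume "u + 1/2 \<in> \<int>\<^sub>\<le>\<^sub>0"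
    then obtain n where "u + 1/2 = - of_nat n" by (elim nonpos_Ints_cases')
    then have "Re (u + 1/2) = - real n" by simp
    then have "Re u = - real n - 1/2" by simp
    with Re have "- real n - of_int j < 1" "- real n - of_int j > 0" by linarith+
    then have "real_of_int (- int n - j) < real_of_int 1" "real_of_int 0 < real_of_int (- int n - j)"
      by simp_all
    then show False unfolding of_int_less_iff by linarith
  qed
  show "2 * u \<notin> \<int>" if "u \<noteq> of_int j"
  proof
    assume "2 * u \<in> \<int>"
    then obtain n where n: "2 * u = of_int n" by (elim Ints_cases)
    then have "Re (2 * u) = of_int n" by simp
    then have "2 * Re u = of_int n" by simp
    with Re have "\<bar>real_of_int n - 2 * real_of_int j\<bar> < 1" by linarith
    then have "\<bar>real_of_int (n - 2 * j)\<bar> < real_of_int 1" by simp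
    then have "n = 2 * j" unfolding of_int_abs[symmetric] of_int_less_iff by linarith
    with n that show False by simp
  qed
qed

lemma dup_quot_holomorphic [holomorphic_intros]: "dup_quot holomorphic_on ball (of_int j) (1/2)"
  unfolding dup_quot_def[abs_def] using ball_int_half(1)[of _ j] by (intro holomorphic_intros) auto

text \<open>The function \<open>Gamma (2 * u + 1) * rGamma (u + 1) ^ 2 * rGamma (u + 1 + M) ^ 2 * (z
  / 2) powr A\<close>, \<open>A = 2 * u + M\<close>, continued to negative integers. A factor
  \<open>pochhammer (2 * u + 1) n\<close> raises the Gamma argument by \<open>n\<close>: the choices
  \<open>M\<close>, \<open>M - 1\<close>, \<open>M - 2\<close> give \<open>Gamma (A + 1)\<close>,
  \<open>Gamma A\<close>, \<open>Gamma (A - 1)\<close>.\<close>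

definition meijer_kernel :: "complex \<Rightarrow> nat \<Rightarrow> complex \<Rightarrow> complex" where
  "meijer_kernel z M u = dup_quot u * rGamma (u + 1) * rGamma (u + 1 + of_nat M) ^ 2
     * (z / 2) powr (2 * u + of_nat M)"

lemma meijer_kernel_holomorphic [holomorphic_intros]:
  "z \<noteq> 0 \<Longrightarrow> meijer_kernel z M holomorphic_on ball (of_int j) (1/2)"
  unfolding meijer_kernel_def[abs_def] by (intro holomorphic_intros)

lemma pochhammer_Gamma_double:
  assumes "2 * u \<notin> \<int>"
  shows "Gamma (2 * u + 1 + of_nat n :: complex) = pochhammer (2 * u + 1) n * Gamma (2 * u + 1)"
proof -
  have "2 * u + 1 \<notin> \<int>\<^sub>\<le>\<^sub>0"
  proof
    assume "2 * u + 1 \<in> \<int>\<^sub>\<le>\<^sub>0"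
    then have "2 * u + 1 \<in> \<int>" by (elim nonpos_Ints_cases') simp
    then have "2 * u + 1 - 1 \<in> \<int>" by (rule Ints_diff) simp
    with assms show False by simp
  qed
  then show ?thesis
    using pochhammer_Gamma[of "2 * u + 1" n] by (simp add: Gamma_eq_zero_iff)
qed

lemma sin_pi_nonzero:
  fixes u :: complex
  assumes "2 * u \<notin> \<int>"
  shows "sin (of_real pi * u) \<noteq> 0"
proof
  assume "sin (of_real pi * u) = 0"
  then obtain n :: int where "of_real pi * u = of_real pi * of_int n"
    unfolding sin_eq_0 by (auto simp: mult.commute)
  then have "2 * u = of_int (2 * n)" by simp
  with assms show False by (metis Ints_of_int)
qed

lemma sin_pi_nat_shift:
  fixes u :: complex
  shows "sin (of_real pi * (u + of_nat M)) = (-1) ^ M * sin (of_real pi * u)"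
  using cos_sin_int_pi[of "int M"] by (simp add: distrib_left sin_add mult.commute)

lemma Gamma_uminus_eq:
  fixes u :: complex
  assumes "u + 1 \<notin> \<int>\<^sub>\<le>\<^sub>0"
  shows "Gamma (- u) = - of_real pi / sin (of_real pi * u) * rGamma (u + 1)"
proof -
  have nz: "Gamma (u + 1) \<noteq> 0" using assms by (simp add: Gamma_eq_zero_iff)
  have "Gamma (- u) * Gamma (u + 1) = - of_real pi / sin (of_real pi * u)"
    using Gamma_reflection_complex[of "- u"] by (simp add: add.commute)
  then show ?thesis
    using nonzero_eq_divide_eq[OF nz, of "Gamma (- u)" "- of_real pi / sin (of_real pi * u)"]
    by (simp add: rGamma_inverse_Gamma divide_inverse)
qed

text \<open>Reflecting the three Gamma factors gives the inverse cube of the sine. Duplication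
  merges the two upper parameters into \<open>rGamma (1 - A)\<close>, whose reflection contributes
  \<open>sin (2 * \<pi> * u)\<close>, leaving cosine over squared sine. Duplication is also the
  source of \<open>sqrt pi\<close> in the theorem and of the step from powers of
  \<open>z\<^sup>2\<close> to powers of \<open>z / 2\<close>.\<close>

lemma meijer_G_integrand_first:
  fixes x :: real and u :: complex and M :: nat
  assumes "x > 0" "2 * u \<notin> \<int>"
  defines "z \<equiv> complex_of_real x" and "m \<equiv> (of_nat M :: complex)"
  shows "of_real (sqrt pi) * meijer_G_integrand (1/2) 1 (- m/2) (m/2) (m/2) (- m/2) (z\<^sup>2) (- u - m/2)
    = - 2 * of_real pi ^ 2 * cos (of_real pi * u) / sin (of_real pi * u) ^ 2
      * (Gamma (2 * u + m) * rGamma (u + 1) ^ 2 * rGamma (u + 1 + m) ^ 2 * (z / 2) powr (2 * u + m))"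
proof -
  define S C where "S = sin (of_real pi * u)" and "C = cos (of_real pi * u)"
  define e :: complex where "e = (-1) ^ M"
  have e: "e \<noteq> 0" by (simp add: e_def)
  have S: "S \<noteq> 0" unfolding S_def by (rule sin_pi_nonzero) fact
  have nonint: "2 * u + of_int n \<notin> \<int>" for n
    using assms(2) Ints_diff[of "2 * u + of_int n" "of_int n"] by auto
  note half = not_nonpos_Int_if_double[OF assms(2)]
  have G1: "Gamma (- u) = - of_real pi / S * rGamma (u + 1)"
    unfolding S_def using half[of "u + 1" 2] by (intro Gamma_uminus_eq) simp
  have G2: "Gamma (- u - m) = - of_real pi / (e * S) * rGamma (u + 1 + m)"
    using half[of "u + m + 1" "2 * int M + 2"] Gamma_uminus_eq[of "u + m"]
    by (simp add: m_def sin_pi_nat_shift S_def e_def add_ac)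
  have G3: "of_real (sqrt pi) * (rGamma (1/2 + (- u - m/2)) * rGamma (1 + (- u - m/2)))
      = exp (- (2 * u + m) * of_real (ln 2)) * rGamma (1 - (2 * u + m))"
  proof -
    define w where "w = 1/2 - u - m/2"
    have w: "w \<notin> \<int>\<^sub>\<le>\<^sub>0" "w + 1/2 \<notin> \<int>\<^sub>\<le>\<^sub>0"
      using half[of w "1 - int M"] half[of "w + 1/2" "2 - int M"] by (simp_all add: w_def m_def)
    define E where "E = exp ((1 - 2*w) * of_real (ln 2) :: complex)"
    have E: "E \<noteq> 0" "exp (- ((1 - 2*w) * of_real (ln 2))) = inverse E"
      by (simp_all only: E_def exp_minus exp_not_eq_zero not_False_eq_True)
    have "rGamma w * rGamma (w + 1/2) = inverse (E * of_real (sqrt pi) * Gamma (2 * w))"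
      unfolding E_def
      by (simp add: rGamma_inverse_Gamma flip: Gamma_legendre_duplication[OF w] inverse_mult_distrib)
    then have "of_real (sqrt pi) * (rGamma w * rGamma (w + 1/2))
        = exp (- ((1 - 2*w) * of_real (ln 2))) * rGamma (2 * w)"
      unfolding E(2) using E(1) by (simp add: rGamma_inverse_Gamma field_simps)
    moreover have "1 - 2 * w = 2 * u + m" "2 * w = 1 - (2 * u + m)" "w + 1/2 = 1 + (- u - m/2)"
      "w = 1/2 + (- u - m/2)"
      by (simp_all add: w_def)
    ultimately show ?thesis by (metis mult_minus_left)
  qed
  have G4: "rGamma (1 - (2 * u + m)) = Gamma (2 * u + m) * (e * (2 * S * C)) / of_real pi"
  proof -
    have "2 * u + m \<notin> \<int>\<^sub>\<le>\<^sub>0"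
      using nonint[of "int M"] by (auto simp: m_def elim: nonpos_Ints_cases')
    then have nz: "Gamma (2 * u + m) \<noteq> 0" by (simp add: Gamma_eq_zero_iff)
    have "rGamma (1 - (2 * u + m)) = Gamma (2 * u + m) * (rGamma (2 * u + m) * rGamma (1 - (2 * u + m)))"
      using nz by (simp add: rGamma_inverse_Gamma[of "2 * u + m"])
    also have "rGamma (2 * u + m) * rGamma (1 - (2 * u + m)) = sin (of_real pi * (2 * u + m)) / of_real pi"
      by (rule rGamma_reflection_complex)
    also have "sin (of_real pi * (2 * u + m)) = e * sin (2 * (of_real pi * u))"
      unfolding m_def e_def sin_pi_nat_shift by (simp add: mult.left_commute)
    also have "\<dots> = e * (2 * S * C)" by (simp add: sin_double S_def C_def)
    finally show ?thesis by simp
  qed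
  have P: "(z\<^sup>2) powr (- (- u - m/2)) * exp (- (2 * u + m) * of_real (ln 2)) = (z / 2) powr (2 * u + m)"
  proof -
    have L1: "Ln (z\<^sup>2) = 2 * of_real (ln x)"
      using assms(1) Ln_of_real[of "x ^ 2"] by (simp add: z_def ln_realpow)
    have L2: "Ln (z / 2) = of_real (ln x) - of_real (ln 2)"
      using assms(1) Ln_of_real[of "x / 2"] by (simp add: z_def ln_div)
    have nz: "z\<^sup>2 \<noteq> 0" "z / 2 \<noteq> 0" using assms(1) by (simp_all add: z_def)
    have "- (- u - m/2) * (2 * of_real (ln x)) + - (2 * u + m) * of_real (ln 2)
        = (2 * u + m) * (of_real (ln x) - of_real (ln 2))"
      by (simp add: algebra_simps)
    then show ?thesis
      by (simp only: powr_def L1 L2 nz if_False exp_add[symmetric])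
  qed
  have args: "- m/2 + (- u - m/2) = - u - m" "m/2 + (- u - m/2) = - u"
    "1 - (- m/2) - (- u - m/2) = u + 1 + m"
    by (simp_all add: algebra_simps)
  have "of_real (sqrt pi) * meijer_G_integrand (1/2) 1 (- m/2) (m/2) (m/2) (- m/2) (z\<^sup>2) (- u - m/2)
      = Gamma (- u - m) * Gamma (- u) * Gamma (- u)
        * (of_real (sqrt pi) * (rGamma (1/2 + (- u - m/2)) * rGamma (1 + (- u - m/2))))
        * rGamma (u + 1 + m) * (z\<^sup>2) powr (- (- u - m/2))"
    unfolding meijer_G_integrand_def args by (simp only: mult_ac)
  also have "\<dots> = Gamma (- u - m) * Gamma (- u) * Gamma (- u) * rGamma (1 - (2 * u + m)) * rGamma (u + 1 + m)
      * ((z\<^sup>2) powr (- (- u - m/2)) * exp (- (2 * u + m) * of_real (ln 2)))"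
    unfolding G3 by (simp only: mult_ac)
  also have "\<dots> = (- of_real pi / (e * S) * rGamma (u + 1 + m)) * (- of_real pi / S * rGamma (u + 1))
      * (- of_real pi / S * rGamma (u + 1)) * (Gamma (2 * u + m) * (e * (2 * S * C)) / of_real pi)
      * rGamma (u + 1 + m) * (z / 2) powr (2 * u + m)"
    unfolding P G1 G2 G4 ..
  also have "\<dots> = - 2 * of_real pi ^ 2 * C / S ^ 2
      * (Gamma (2 * u + m) * rGamma (u + 1) ^ 2 * rGamma (u + 1 + m) ^ 2 * (z / 2) powr (2 * u + m))"
    using S e by (simp add: field_simps power2_eq_square)
  finally show ?thesis by (simp add: S_def C_def)
qed

text \<open>Shifting by \<open>1/2\<close> matches the factors with the \<open>b\<close> parameters
  exactly. The two upper parameters leave the ratio \<open>s / (s + 1/2)\<close>, which is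
  \<open>A / (A - 1)\<close> at \<open>s = - A / 2\<close>; the assumption on \<open>Ln\<close>
  makes \<open>z\<close> cancel the surplus half power of \<open>z\<^sup>2\<close>.\<close>

lemma meijer_G_integrand_second:
  fixes z m s :: complex
  assumes "s \<noteq> - 1/2" "z \<noteq> 0" and ln: "Ln (z\<^sup>2) = 2 * Ln z"
  shows "z * meijer_G_integrand (- 1/2) 1 (- (m + 1)/2) ((m - 1)/2) ((m - 1)/2) (- (m + 1)/2) (z\<^sup>2) (s + 1/2)
    = s / (s + 1/2) * meijer_G_integrand (1/2) 1 (- m/2) (m/2) (m/2) (- m/2) (z\<^sup>2) s"
proof -
  have args: "- (m + 1)/2 + (s + 1/2) = - m/2 + s" "(m - 1)/2 + (s + 1/2) = m/2 + s"
    "- 1/2 + (s + 1/2) = s" "1 - (- (m + 1)/2) - (s + 1/2) = 1 - (- m/2) - s"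
    by (simp_all add: field_simps)
  have r1: "rGamma s = s * rGamma (1 + s)" using rGamma_plus1[of s] by (simp add: add.commute)
  have nz: "s + 1/2 \<noteq> 0" using assms(1) by (metis add_eq_0_iff2 minus_divide_left)
  have r2: "rGamma (1 + (s + 1/2)) = rGamma (1/2 + s) / (s + 1/2)"
    using rGamma_plus1[of "s + 1/2"] nz by (simp add: field_simps)
  have p: "z * (z\<^sup>2) powr (- (s + 1/2)) = (z\<^sup>2) powr (- s)"
  proof -
    have "(z\<^sup>2) powr (- (s + 1/2)) = exp (- s * Ln (z\<^sup>2)) * exp (- Ln z)"
    proof -
      have "- (s + 1/2) * Ln (z\<^sup>2) = - s * Ln (z\<^sup>2) + - Ln z" by (simp add: ln algebra_simps)
      then show ?thesis using assms(2) by (simp only: powr_def exp_add) simp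
    qed
    then show ?thesis using assms(2) by (simp add: powr_def exp_minus)
  qed
  show ?thesis
    unfolding meijer_G_integrand_def args r1 r2 p[symmetric] by (simp add: mult_ac)
qed

section \<open>Meijer functions as series of derivatives\<close>

lemma meijer_kernel_eq:
  assumes "2 * u \<notin> \<int>"
  shows "pochhammer (2 * u + 1) n * meijer_kernel z M u = Gamma (2 * u + 1 + of_nat n) * rGamma (u + 1) ^ 2
    * rGamma (u + 1 + of_nat M) ^ 2 * (z / 2) powr (2 * u + of_nat M)"
  unfolding meijer_kernel_def pochhammer_Gamma_double[OF assms] dup_quot_eq[OF assms]
  by (simp add: power2_eq_square mult_ac)

text \<open>In the variable \<open>u = \<sigma> - M - s\<close> the \<open>k\<close>-th pole is the
  integer \<open>k - M\<close>. For \<open>k < M\<close> only \<open>Gamma (b1 + s)\<close> can be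
  singular, so the pole is at most simple; in the applications the double-pole formula still fits
  because \<open>q\<close> contains the factor \<open>rGamma (u + 1)\<close>, which vanishes
  there.\<close>

lemma meijer_G_sums_deriv:
  fixes \<sigma> :: real and q :: "complex \<Rightarrow> complex"
  assumes "z \<noteq> 0" "a \<noteq> 0"
    and b: "b1 = - of_real \<sigma>" "b2 = of_nat M - of_real \<sigma>" "b3 = of_nat M - of_real \<sigma>"
    and q: "\<And>j. q holomorphic_on ball (of_int j) (1/2)"
    and F: "\<And>u. 2 * u \<notin> \<int> \<Longrightarrow> a * meijer_G_integrand a1 a2 b1 b2 b3 b4 z (of_real \<sigma> - of_nat M - u)
      = - 2 * of_real pi ^ 2 * cos (of_real pi * u) / sin (of_real pi * u) ^ 2 * q u"
  shows "(\<lambda>k. 2 * (-1) powi (int k - int M) * deriv q (of_int (int k - int M)))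
    sums (a * meijer_G_3_0_2_4 z a1 a2 b1 b2 b3 b4)"
proof -
  define c :: complex where "c = of_real \<sigma> - of_nat M"
  have "residue (meijer_G_integrand a1 a2 b1 b2 b3 b4 z) (of_real \<sigma> - of_nat k)
      = 2 * (-1) powi (int k - int M) * deriv q (of_int (int k - int M)) / a" for k
  proof -
    define j where "j = int k - int M"
    have "residue (meijer_G_integrand a1 a2 b1 b2 b3 b4 z) (c - of_int j)
      = 2 * (-1) powi j * deriv (\<lambda>u. q u / a) (of_int j)"
    proof (rule residue_cos_over_sin_squared[of "1/2"])
      show "(\<lambda>u. q u / a) holomorphic_on ball (of_int j) (1/2)"
        using q assms(2) by (intro holomorphic_intros) auto
      show "\<forall>\<^sub>F s in at (c - of_int j). meijer_G_integrand a1 a2 b1 b2 b3 b4 z s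
          = - 2 * of_real pi ^ 2 * cos (of_real pi * (c - s)) / sin (of_real pi * (c - s)) ^ 2 * (q (c - s) / a)"
        unfolding eventually_at
      proof (intro exI[of _ "1/2"] conjI ballI impI)
        fix s assume s: "s \<noteq> c - of_int j \<and> dist s (c - of_int j) < 1/2"
        have "c - s \<in> ball (of_int j) (1/2)" "c - s \<noteq> of_int j"
          using s by (auto simp: dist_norm algebra_simps norm_minus_commute)
        then have "2 * (c - s) \<notin> \<int>" by (rule ball_int_half(2))
        from F[OF this] have "a * meijer_G_integrand a1 a2 b1 b2 b3 b4 z s
          = - 2 * of_real pi ^ 2 * cos (of_real pi * (c - s)) / sin (of_real pi * (c - s)) ^ 2 * q (c - s)"
          by (simp add: c_def)
        then show "meijer_G_integrand a1 a2 b1 b2 b3 b4 z s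
          = - 2 * of_real pi ^ 2 * cos (of_real pi * (c - s)) / sin (of_real pi * (c - s)) ^ 2 * (q (c - s) / a)"
          using assms(2) by (metis nonzero_mult_div_cancel_left times_divide_eq_right)
      qed simp
    qed auto
    also have "deriv (\<lambda>u. q u / a) (of_int j) = deriv q (of_int j) / a"
      using holomorphic_on_imp_differentiable_at[OF q[of j]] by (intro deriv_cdivide_right) auto
    finally show ?thesis by (simp add: c_def j_def)
  qed
  moreover have "(\<lambda>k. residue (meijer_G_integrand a1 a2 b1 b2 b3 b4 z) (of_real \<sigma> - of_nat k))
    sums meijer_G_3_0_2_4 z a1 a2 b1 b2 b3 b4"
    by (rule meijer_G_residue_sums[of z b1 0 \<sigma> b2 M b3 M]) (use assms(1) b in auto)
  ultimately have "(\<lambda>k. 2 * (-1) powi (int k - int M) * deriv q (of_int (int k - int M)) / a)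
    sums meijer_G_3_0_2_4 z a1 a2 b1 b2 b3 b4" by simp
  from sums_mult[OF this, of a] show ?thesis using assms(2) by simp
qed

lemma meijer_G_first_sums:
  fixes x :: real and M :: nat
  assumes "x > 0" "M \<ge> 1"
  defines "z \<equiv> complex_of_real x" and "m \<equiv> (of_nat M :: complex)"
  shows "(\<lambda>k. 2 * (-1) powi (int k - int M)
      * deriv (\<lambda>u. pochhammer (2 * u + 1) (M - 1) * meijer_kernel z M u) (of_int (int k - int M)))
    sums (of_real (sqrt pi) * meijer_G_3_0_2_4 (z\<^sup>2) (1/2) 1 (- m/2) (m/2) (m/2) (- m/2))"
proof (rule meijer_G_sums_deriv[where \<sigma> = "M / 2"])
  have z: "z \<noteq> 0" using assms(1) by (simp add: z_def)
  then show "z\<^sup>2 \<noteq> 0" by simp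
  show "(\<lambda>u. pochhammer (2 * u + 1) (M - 1) * meijer_kernel z M u) holomorphic_on ball (of_int j) (1/2)" for j
    unfolding pochhammer_prod using z by (intro holomorphic_intros)
  fix u :: complex assume u: "2 * u \<notin> \<int>"
  have eq: "2 * u + 1 + of_nat (M - 1) = 2 * u + m" "of_real (M / 2) - of_nat M - u = - u - m / 2"
    using assms(2) by (simp_all add: m_def of_nat_diff)
  show "of_real (sqrt pi) * meijer_G_integrand (1/2) 1 (- m/2) (m/2) (m/2) (- m/2) (z\<^sup>2)
       (of_real (M / 2) - of_nat M - u)
      = - 2 * of_real pi ^ 2 * cos (of_real pi * u) / sin (of_real pi * u) ^ 2
        * (pochhammer (2 * u + 1) (M - 1) * meijer_kernel z M u)"
    unfolding meijer_kernel_eq[OF u] eq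
    using meijer_G_integrand_first[OF assms(1) u, of M] by (simp add: z_def m_def)
qed (auto simp: m_def)

text \<open>\<open>A / (A - 1) * Gamma A = A * Gamma (A - 1)\<close>; \<open>M \<ge> 2\<close> lets
  \<open>pochhammer (2 * u + 1) (M - 2)\<close> express the last Gamma factor.\<close>

lemma meijer_G_second_sums:
  fixes x :: real and M :: nat
  assumes "x > 0" "M \<ge> 2"
  defines "z \<equiv> complex_of_real x" and "m \<equiv> (of_nat M :: complex)"
  shows "(\<lambda>k. 2 * (-1) powi (int k - int M)
      * deriv (\<lambda>u. pochhammer (2 * u + 1) (M - 2) * (2 * u + m) * meijer_kernel z M u) (of_int (int k - int M)))
    sums (of_real (sqrt pi) * z * meijer_G_3_0_2_4 (z\<^sup>2) (- 1/2) 1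
             (- (m + 1)/2) ((m - 1)/2) ((m - 1)/2) (- (m + 1)/2))"
proof (rule meijer_G_sums_deriv[where \<sigma> = "(M + 1) / 2"])
  have z: "z \<noteq> 0" using assms(1) by (simp add: z_def)
  then show "z\<^sup>2 \<noteq> 0" "of_real (sqrt pi) * z \<noteq> 0" by simp_all
  show "(\<lambda>u. pochhammer (2 * u + 1) (M - 2) * (2 * u + m) * meijer_kernel z M u)
      holomorphic_on ball (of_int j) (1/2)" for j
    unfolding pochhammer_prod using z by (intro holomorphic_intros)
  fix u :: complex assume u: "2 * u \<notin> \<int>"
  define s where "s = - u - m / 2"
  have M: "Suc (M - 2) = M - 1" using assms(2) by simp
  have s: "s \<noteq> - 1/2"
  proof
    assume "s = - 1/2"
    then have "2 * u = of_int (1 - int M)" by (simp add: s_def m_def field_simps)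
    with u show False by (metis Ints_of_int)
  qed
  have nz: "2 * u + m - 1 \<noteq> 0"
    using s by (auto simp: s_def field_simps)
  have ratio: "s / (s + 1/2) = (2 * u + m) / (2 * u + m - 1)"
  proof -
    have "s = - (2 * u + m) / 2" "s + 1/2 = - (2 * u + m - 1) / 2"
      by (simp_all add: s_def field_simps)
    moreover have "(- t / 2) / (- w / 2) = t / w" for t w :: complex
      by (cases "w = 0") (simp_all add: field_simps)
    ultimately show ?thesis by metis
  qed
  have ln: "Ln (z\<^sup>2) = 2 * Ln z"
    using assms(1) Ln_of_real[of "x ^ 2"] Ln_of_real[of x] by (simp add: z_def ln_realpow)
  have eq: "2 * u + 1 + of_nat (M - 1) = 2 * u + m" "of_real ((M + 1) / 2) - of_nat M - u = s + 1/2"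
    using assms(2) by (simp_all add: m_def s_def of_nat_diff field_simps)
  have poch: "pochhammer (2 * u + 1) (M - 1) = pochhammer (2 * u + 1) (M - 2) * (2 * u + m - 1)"
    unfolding M[symmetric] using assms(2) by (simp add: pochhammer_Suc m_def of_nat_diff algebra_simps)
  have "of_real (sqrt pi) * z * meijer_G_integrand (- 1/2) 1 (- (m + 1)/2) ((m - 1)/2) ((m - 1)/2)
       (- (m + 1)/2) (z\<^sup>2) (s + 1/2)
    = (2 * u + m) / (2 * u + m - 1) * (of_real (sqrt pi)
       * meijer_G_integrand (1/2) 1 (- m/2) (m/2) (m/2) (- m/2) (z\<^sup>2) s)"
    using arg_cong[OF meijer_G_integrand_second[OF s z ln, of m], of "\<lambda>y. of_real (sqrt pi) * y"]
    unfolding ratio by (simp only: mult_ac)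
  also have "of_real (sqrt pi) * meijer_G_integrand (1/2) 1 (- m/2) (m/2) (m/2) (- m/2) (z\<^sup>2) s
      = - 2 * of_real pi ^ 2 * cos (of_real pi * u) / sin (of_real pi * u) ^ 2
        * (pochhammer (2 * u + 1) (M - 1) * meijer_kernel z M u)"
    unfolding meijer_kernel_eq[OF u] eq s_def
    using meijer_G_integrand_first[OF assms(1) u, of M] by (simp add: z_def m_def)
  also have "(2 * u + m) / (2 * u + m - 1) * (- 2 * of_real pi ^ 2 * cos (of_real pi * u) / sin (of_real pi * u) ^ 2
        * (pochhammer (2 * u + 1) (M - 1) * meijer_kernel z M u))
      = - 2 * of_real pi ^ 2 * cos (of_real pi * u) / sin (of_real pi * u) ^ 2
        * (pochhammer (2 * u + 1) (M - 2) * (2 * u + m) * meijer_kernel z M u)"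
  proof -
    have "t / w * (R * (P * w * K)) = R * (P * t * K)" if "w \<noteq> 0" for t w R P K :: complex
      using that by simp
    from this[OF nz] show ?thesis unfolding poch .
  qed
  finally show "of_real (sqrt pi) * z * meijer_G_integrand (- 1/2) 1 (- (m + 1)/2) ((m - 1)/2) ((m - 1)/2)
       (- (m + 1)/2) (z\<^sup>2) (of_real ((M + 1) / 2) - of_nat M - u)
      = - 2 * of_real pi ^ 2 * cos (of_real pi * u) / sin (of_real pi * u) ^ 2
        * (pochhammer (2 * u + 1) (M - 2) * (2 * u + m) * meijer_kernel z M u)"
    unfolding eq .
qed (auto simp: m_def field_simps)

section \<open>Derivatives where the Gamma factors degenerate\<close>

lemma deriv_eq_punctured:
  fixes f g :: "complex \<Rightarrow> complex"
  assumes "f field_differentiable at a" "g field_differentiable at a" "\<forall>\<^sub>F x in at a. f x = g x"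
  shows "deriv f a = deriv g a"
proof -
  have "isCont f a" "isCont g a"
    using assms field_differentiable_imp_continuous_at by blast+
  then have "f \<midarrow>a\<rightarrow> f a" "g \<midarrow>a\<rightarrow> g a" by (auto simp: isCont_def)
  then have "f a = g a"
    using tendsto_cong[OF assms(3), of "f a"] tendsto_unique[of "at a" g "f a" "g a"] by simp
  with assms(3) have "\<forall>\<^sub>F x in nhds a. f x = g x"
    by (auto simp: eventually_at_filter elim: eventually_mono)
  then show ?thesis by (intro deriv_cong_ev) auto
qed

lemma int_gbinomial_Gamma:
  assumes "a + 1 \<notin> \<int>\<^sub>\<le>\<^sub>0"
  shows "int_gbinomial a j = Gamma (a + 1) * rGamma (of_int j + 1) * rGamma (a - of_int j + 1)"
proof (cases "j < 0")
  case True
  then have "of_int j + 1 = (- of_nat (nat (- j - 1)) :: complex)" by simp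
  then have "rGamma (of_int j + 1 :: complex) = 0" by (simp add: rGamma_eq_zero_iff)
  then show ?thesis using True by (simp add: int_gbinomial_def)
next
  case False
  then obtain n where j: "j = int n" by (metis not_less zero_le_imp_eq_int)
  have "rGamma (of_nat n + 1 :: complex) = inverse (fact n)"
    using Gamma_fact[of n, where 'a = complex] by (simp add: rGamma_inverse_Gamma add_ac)
  then show ?thesis
    using gbinomial_Gamma[OF assms, of n]
    by (simp add: j int_gbinomial_def rGamma_inverse_Gamma[of "a - of_nat n + 1"] divide_inverse)
qed

text \<open>Numerator and denominator have simple zeros at \<open>p = 0\<close>, with slopes in the
  ratio 1 to 2.\<close>

lemma rGamma_ratio_at_zero:
  assumes "l < 0"
  shows "(\<lambda>p. rGamma (of_int l + 1 + p) / rGamma (of_int l + 1 + 2 * p :: complex)) \<midarrow>0\<rightarrow> 1 / 2"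
proof -
  define n where "n = nat (- l - 1)"
  have l: "of_int l + 1 = (- of_nat n :: complex)" using assms by (simp add: n_def)
  define d :: complex where "d = (-1) ^ n * fact n"
  have d: "d \<noteq> 0" by (simp add: d_def)
  have z: "rGamma (- of_nat n :: complex) = 0" by (simp add: rGamma_eq_zero_iff)
  have 1: "((\<lambda>p. rGamma (- of_nat n + p)) has_field_derivative d) (at 0)"
    using has_field_derivative_rGamma_nonpos_int[of n "UNIV :: complex set"]
      DERIV_chain2[where f = rGamma and g = "\<lambda>p. - of_nat n + p" and x = "0 :: complex" and Db = 1 and Da = d and s = UNIV]
      DERIV_add[OF DERIV_const DERIV_ident, of "- of_nat n" "0 :: complex" UNIV]
    by (simp add: d_def)
  have 2: "((\<lambda>p. rGamma (- of_nat n + 2 * p)) has_field_derivative 2 * d) (at 0)"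
    using has_field_derivative_rGamma_nonpos_int[of n "UNIV :: complex set"]
      DERIV_chain2[where f = rGamma and g = "\<lambda>p. - of_nat n + 2 * p" and x = "0 :: complex" and Db = 2 and Da = d and s = UNIV]
      DERIV_add[OF DERIV_const DERIV_cmult[OF DERIV_ident, of 2], of "- of_nat n" "0 :: complex" UNIV]
    by (simp add: d_def mult.commute)
  have "(\<lambda>p. rGamma (- of_nat n + p) / rGamma (- of_nat n + 2 * p :: complex)) \<midarrow>0\<rightarrow> d / (2 * d)"
    by (rule lhopital_complex_simple[OF 1 2]) (use z d in auto)
  then show ?thesis using d by (simp add: l)
qed

lemma nonpos_Ints_avoid_punctured:
  "\<forall>\<^sub>F p in at (0 :: complex). 2 * (of_int j + p) \<notin> \<int>"
  unfolding eventually_at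
  using ball_int_half(2)[of "of_int j + _" j]
  by (intro exI[of _ "1/2"]) (auto simp: dist_norm)

text \<open>
  Derivatives of the two symmetric binomial coefficients add up to twice that of the "central" one:
  the derivatives with respect to the two lower Gamma arguments cancel.
\<close>

lemma deriv_gbinomial_pair:
  fixes w H :: "complex \<Rightarrow> complex" and j l :: int
  assumes w: "w holomorphic_on UNIV" and H: "H field_differentiable at 0" and "j \<ge> 0"
    and ev: "\<forall>\<^sub>F p in at 0. H p = 2 * w p * (Gamma (of_int (j + l) + 1 + 2 * p)
      * rGamma (of_int j + 1 + p) * rGamma (of_int l + 1 + p))"
    and regular: "j + l \<ge> 0 \<or> w 0 = 0 \<and> l < 0"
  shows "deriv (\<lambda>p. w p * (int_gbinomial (of_int (j + l) + 2 * p) j + int_gbinomial (of_int (j + l) + 2 * p) l)) 0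
    = deriv H 0"
proof -
  define X where "X = j + l"
  have w': "(w has_field_derivative deriv w 0) (at 0)"
    using holomorphic_derivI[OF w] by simp
  define f where "f p = w p * (int_gbinomial (of_int X + 2 * p) j + int_gbinomial (of_int X + 2 * p) l)" for p
  have f_holo: "f holomorphic_on UNIV"
    unfolding f_def[abs_def] using w by (intro holomorphic_intros)
  then have f_diff: "f field_differentiable at 0" by (simp add: holomorphic_on_def)
  have avoid: "\<forall>\<^sub>F p in at (0 :: complex). of_int X + 2 * p + 1 \<notin> \<int>\<^sub>\<le>\<^sub>0"
    using nonpos_Ints_avoid_punctured[of 0]
  proof eventually_elim
    case (elim p)
    show ?case
    proof
      assume "of_int X + 2 * p + 1 \<in> \<int>\<^sub>\<le>\<^sub>0"
      then have "of_int X + 2 * p + 1 \<in> \<int>" by (elim nonpos_Ints_cases') simp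
      then have "of_int X + 2 * p + 1 - of_int (X + 1) \<in> \<int>" by (rule Ints_diff) simp
      with elim show False by simp
    qed
  qed
  have ig: "int_gbinomial (of_int X + 2 * p) j = Gamma (of_int X + 1 + 2 * p) * rGamma (of_int j + 1) * rGamma (of_int l + 1 + 2 * p)"
    "int_gbinomial (of_int X + 2 * p) l = Gamma (of_int X + 1 + 2 * p) * rGamma (of_int l + 1) * rGamma (of_int j + 1 + 2 * p)"
    if "of_int X + 2 * p + 1 \<notin> \<int>\<^sub>\<le>\<^sub>0" for p
    using int_gbinomial_Gamma[OF that, of j] int_gbinomial_Gamma[OF that, of l]
    by (simp_all add: X_def add_ac)
  show ?thesis
  proof (cases "X \<ge> 0")
    case True
    define k where "k = nat X"
    have k: "(of_int X :: complex) = of_nat k" using True by (simp add: k_def)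
    have pos: "of_nat k + 1 \<notin> (\<int>\<^sub>\<le>\<^sub>0 :: complex set)"
      using of_nat_in_nonpos_Ints_iff[of "Suc k", where 'a = complex] by (simp add: add.commute)
    define g where "g = Gamma (of_nat k + 1 :: complex)"
    define a b where "a = rGamma (of_int j + 1 :: complex)" and "b = rGamma (of_int l + 1 :: complex)"
    have chain: "((\<lambda>p. F (c + e * p)) has_field_derivative deriv F c * e) (at 0)"
      if "F field_differentiable at c" for F :: "complex \<Rightarrow> complex" and c e
    proof (rule DERIV_chain2[of F])
      show "(F has_field_derivative deriv F c) (at (c + e * 0))"
        using that by (simp add: DERIV_deriv_iff_field_differentiable)
      show "((\<lambda>p. c + e * p) has_field_derivative e) (at 0)"
        by (auto intro!: derivative_eq_intros)
    qed
    have Gd: "((\<lambda>p. Gamma (of_nat k + 1 + 2 * p)) has_field_derivative deriv Gamma (of_nat k + 1) * 2) (at (0 :: complex))"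
      by (rule chain) (rule field_differentiable_Gamma[OF pos])
    have Rd: "((\<lambda>p. rGamma (c + e * p)) has_field_derivative deriv rGamma c * e) (at 0)" for c e :: complex
      by (rule chain) (rule field_differentiable_rGamma)
    define g' a' b' w1 where "g' = deriv Gamma (of_nat k + 1 :: complex)" and "a' = deriv rGamma (of_int j + 1 :: complex)"
      and "b' = deriv rGamma (of_int l + 1 :: complex)" and "w1 = deriv w 0"
    note D = Gd[folded g'_def] Rd[of "of_int j + 1", folded a'_def] Rd[of "of_int l + 1", folded b'_def] w'[folded w1_def]
    \<comment> \<open>In \<open>\<phi>\<close> each lower Gamma factor moves with
      \<open>2 * p\<close> in one of two summands; in \<open>\<psi>\<close> both move with
      \<open>p\<close> under a prefactor 2. The product rule gives the same total
      \<open>D1\<close>.\<close>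
    define D1 where "D1 = w1 * (2 * (g * a * b)) + w 0 * (4 * g' * a * b + 2 * g * a * b' + 2 * g * a' * b)"
    define \<phi> where "\<phi> p = w p * (Gamma (of_nat k + 1 + 2 * p) * a * rGamma (of_int l + 1 + 2 * p)
        + Gamma (of_nat k + 1 + 2 * p) * b * rGamma (of_int j + 1 + 2 * p))" for p
    have \<phi>: "(\<phi> has_field_derivative D1) (at 0)"
      unfolding \<phi>_def[abs_def]
      by (rule derivative_eq_intros D(1) D(4) D(2)[of 2] D(3)[of 2] refl)+
         (simp add: D1_def a_def b_def g_def algebra_simps)
    have "deriv f 0 = deriv \<phi> 0"
    proof (rule deriv_eq_punctured[OF f_diff])
      show "\<phi> field_differentiable at 0" using \<phi> by (auto simp: field_differentiable_def)
      show "\<forall>\<^sub>F p in at 0. f p = \<phi> p"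
        using avoid
      proof eventually_elim
        case (elim p)
        show ?case unfolding f_def \<phi>_def a_def b_def k[symmetric] ig[OF elim] ..
      qed
    qed
    define \<psi> where "\<psi> p = 2 * w p * (Gamma (of_nat k + 1 + 2 * p)
        * rGamma (of_int j + 1 + 1 * p) * rGamma (of_int l + 1 + 1 * p))" for p
    have \<psi>: "(\<psi> has_field_derivative D1) (at 0)"
      unfolding \<psi>_def[abs_def]
      by (rule derivative_eq_intros D(1) D(4) D(2)[of 1] D(3)[of 1] refl)+
         (simp add: D1_def a_def b_def g_def algebra_simps)
    have "deriv H 0 = deriv \<psi> 0"
    proof (rule deriv_eq_punctured[OF H])
      show "\<psi> field_differentiable at 0" using \<psi> by (auto simp: field_differentiable_def)
      show "\<forall>\<^sub>F p in at 0. H p = \<psi> p"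
        using ev by eventually_elim (simp add: \<psi>_def k flip: X_def)
    qed
    with \<open>deriv f 0 = deriv \<phi> 0\<close> show ?thesis
      using DERIV_imp_deriv[OF \<phi>] DERIV_imp_deriv[OF \<psi>] by (simp add: f_def[abs_def] X_def)
  next
    case False
    \<comment> \<open>Gamma has a pole at \<open>p = 0\<close> here, but the second binomial is
      identically zero and \<open>w\<close> vanishes. Both derivatives therefore equal
      \<open>deriv w 0\<close> times the limit of the cofactor; the \<open>1/2\<close> of
      \<open>rGamma_ratio_at_zero\<close> cancels the 2 in \<open>H\<close>.\<close>
    with regular have w0: "w 0 = 0" and l: "l < 0" by (auto simp: X_def)
    define a where "a = rGamma (of_int j + 1 :: complex)"
    have a: "a \<noteq> 0"
      using of_nat_in_nonpos_Ints_iff[of "Suc (nat j)", where 'a = complex] \<open>j \<ge> 0\<close>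
      by (simp add: a_def rGamma_eq_zero_iff add.commute)
    define C where "C = int_gbinomial (of_int X) j"
    have il: "int_gbinomial x l = 0" for x using l by (simp add: int_gbinomial_def)
    have "(\<lambda>p. int_gbinomial (of_int X + 2 * p) j) holomorphic_on UNIV"
      by (intro holomorphic_intros)
    then have ig_diff: "(\<lambda>p. int_gbinomial (of_int X + 2 * p) j) field_differentiable at 0"
      by (simp add: holomorphic_on_def)
    from field_differentiable_imp_continuous_at[OF this]
    have "(\<lambda>p. int_gbinomial (of_int X + 2 * p) j) \<midarrow>0\<rightarrow> C"
      by (simp add: isCont_def C_def)
    from tendsto_divide[OF this tendsto_const a]
    have "(\<lambda>p. int_gbinomial (of_int X + 2 * p) j / a) \<midarrow>0\<rightarrow> C / a" .
    moreover have "\<forall>\<^sub>F p in at 0. int_gbinomial (of_int X + 2 * p) j / a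
        = Gamma (of_int X + 1 + 2 * p) * rGamma (of_int l + 1 + 2 * p)"
      using avoid
    proof eventually_elim
      case (elim p)
      show ?case using a unfolding ig(1)[OF elim] a_def by simp
    qed
    ultimately have 1: "(\<lambda>p. Gamma (of_int X + 1 + 2 * p) * rGamma (of_int l + 1 + 2 * p)) \<midarrow>0\<rightarrow> C / a"
      by (rule Lim_transform_eventually)
    have "(\<lambda>p. rGamma (of_int j + 1 + p)) field_differentiable at (0 :: complex)"
      by (rule holomorphic_on_imp_differentiable_at[of _ UNIV]) (intro holomorphic_intros open_UNIV UNIV_I)+
    from field_differentiable_imp_continuous_at[OF this]
    have 2: "(\<lambda>p. rGamma (of_int j + 1 + p)) \<midarrow>0\<rightarrow> a"
      by (simp add: isCont_def a_def)
    define \<beta> where "\<beta> p = 2 * (Gamma (of_int X + 1 + 2 * p) * rGamma (of_int j + 1 + p) * rGamma (of_int l + 1 + p))" for p :: complex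
    have "(\<lambda>p. 2 * ((Gamma (of_int X + 1 + 2 * p) * rGamma (of_int l + 1 + 2 * p)) * rGamma (of_int j + 1 + p)
        * (rGamma (of_int l + 1 + p) / rGamma (of_int l + 1 + 2 * p)))) \<midarrow>0\<rightarrow> 2 * (C / a * a * (1 / 2))"
      by (intro tendsto_mult tendsto_const 1 2 rGamma_ratio_at_zero[OF l])
    moreover have "\<forall>\<^sub>F p in at 0. 2 * ((Gamma (of_int X + 1 + 2 * p) * rGamma (of_int l + 1 + 2 * p)) * rGamma (of_int j + 1 + p)
        * (rGamma (of_int l + 1 + p) / rGamma (of_int l + 1 + 2 * p))) = \<beta> p"
      using nonpos_Ints_avoid_punctured[of 0]
    proof eventually_elim
      case (elim p)
      have "rGamma (of_int l + 1 + 2 * p) \<noteq> 0"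
      proof
        assume "rGamma (of_int l + 1 + 2 * p) = 0"
        then have "of_int l + 1 + 2 * p \<in> \<int>\<^sub>\<le>\<^sub>0" by (simp add: rGamma_eq_zero_iff)
        then have "of_int l + 1 + 2 * p \<in> \<int>" by (elim nonpos_Ints_cases') simp
        then have "of_int l + 1 + 2 * p - of_int (l + 1) \<in> \<int>" by (rule Ints_diff) simp
        with elim show False by simp
      qed
      then show ?case by (simp add: \<beta>_def)
    qed
    ultimately have "\<beta> \<midarrow>0\<rightarrow> 2 * (C / a * a * (1 / 2))"
      by (rule Lim_transform_eventually)
    then have \<beta>: "\<beta> \<midarrow>0\<rightarrow> C" using a by simp
    have H_eq: "\<forall>\<^sub>F p in at 0. H p = w p * \<beta> p"
      using ev by eventually_elim (simp add: \<beta>_def mult_ac flip: X_def)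
    have wp: "(\<lambda>p. w p / p) \<midarrow>0\<rightarrow> deriv w 0"
      using w' by (simp add: has_field_derivative_iff w0)
    have "w \<midarrow>0\<rightarrow> 0"
      using DERIV_isCont[OF w'] w0 by (simp add: isCont_def)
    from tendsto_mult[OF this \<beta>] have "(\<lambda>p. w p * \<beta> p) \<midarrow>0\<rightarrow> 0" by simp
    then have "H \<midarrow>0\<rightarrow> 0" using tendsto_cong[OF H_eq] by simp
    moreover have "H \<midarrow>0\<rightarrow> H 0"
      using field_differentiable_imp_continuous_at[OF H] by (simp add: isCont_def)
    ultimately have H0: "H 0 = 0" using LIM_unique by blast
    have "(\<lambda>p. H p / p) \<midarrow>0\<rightarrow> deriv H 0"
      using H by (simp add: has_field_derivative_iff H0 flip: DERIV_deriv_iff_field_differentiable)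
    moreover have "\<forall>\<^sub>F p in at 0. w p / p * \<beta> p = H p / p"
      using H_eq by eventually_elim simp
    then have "(\<lambda>p. H p / p) \<midarrow>0\<rightarrow> deriv w 0 * C"
      using tendsto_mult[OF wp \<beta>] by (rule Lim_transform_eventually[rotated])
    ultimately have "deriv H 0 = deriv w 0 * C" by (rule LIM_unique)
    moreover have "deriv f 0 = deriv w 0 * C"
    proof (rule DERIV_imp_deriv)
      from ig_diff have "((\<lambda>p. int_gbinomial (of_int X + 2 * p) j) has_field_derivative
          deriv (\<lambda>p. int_gbinomial (of_int X + 2 * p) j) 0) (at 0)"
        by (simp add: DERIV_deriv_iff_field_differentiable)
      from DERIV_mult[OF w' this] show "(f has_field_derivative deriv w 0 * C) (at 0)"
        by (simp add: f_def[abs_def] il C_def w0)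
    qed
    ultimately show ?thesis by (simp add: f_def[abs_def] X_def)
  qed
qed

section \<open>Comparison of coefficients\<close>

lemma deriv_translate:
  fixes f :: "complex \<Rightarrow> complex"
  assumes "f field_differentiable at c"
  shows "(\<lambda>p. f (c + p)) field_differentiable at 0" and "deriv (\<lambda>p. f (c + p)) 0 = deriv f c"
proof -
  have "((\<lambda>p. f (c + p)) has_field_derivative deriv f c * 1) (at 0)"
  proof (rule DERIV_chain2[of f])
    show "(f has_field_derivative deriv f c) (at (c + 0))"
      using assms by (simp add: DERIV_deriv_iff_field_differentiable)
    show "((\<lambda>p. c + p) has_field_derivative 1) (at 0)"
      by (auto intro!: derivative_eq_intros)
  qed
  then show "(\<lambda>p. f (c + p)) field_differentiable at 0" and "deriv (\<lambda>p. f (c + p)) 0 = deriv f c"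
    by (auto simp: field_differentiable_def dest: DERIV_imp_deriv)
qed

lemma field_differentiable_at_int:
  assumes "\<And>j. f holomorphic_on ball (of_int j) (1/2)"
  shows "f field_differentiable at (of_int j :: complex)"
  using holomorphic_on_imp_differentiable_at[OF assms[of j]] by auto

lemma kernel_poly_holomorphic:
  assumes "z \<noteq> 0" "g holomorphic_on UNIV"
  shows "(\<lambda>u. g u * meijer_kernel z M u) holomorphic_on ball (of_int j) (1/2)"
  using assms by (intro holomorphic_on_mult meijer_kernel_holomorphic) (auto intro: holomorphic_on_subset)

text \<open>The pair identity with lower indices \<open>N\<close> and \<open>N - M\<close>. If their
  sum is negative then \<open>N < M\<close>, and the factor \<open>rGamma (N + 1 - M)\<close>
  supplies the required zero of the diagonal coefficient.\<close>

lemma deriv_YJ_coeff: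
  assumes z: "z \<noteq> 0"
  shows "deriv (\<lambda>p. bessel_diag_coeff z (of_nat M) N p *
           (int_gbinomial (2 * of_nat N - of_nat M + 2 * p) (int N)
            + int_gbinomial (2 * of_nat N - of_nat M + 2 * p) (int N - int M))) 0
    = 2 * deriv (\<lambda>u. pochhammer (2 * u + 1) M * meijer_kernel z M u) (of_int (int N - int M))"
proof -
  define q where "q = (\<lambda>u. pochhammer (2 * u + 1) M * meijer_kernel z M u)"
  define c where "c = (of_int (int N - int M) :: complex)"
  define j l where "j = int N" and "l = int N - int M"
  have q: "q field_differentiable at c"
    unfolding c_def q_def using z
    by (intro field_differentiable_at_int kernel_poly_holomorphic) (auto simp: pochhammer_prod intro!: holomorphic_intros)
  have "deriv (\<lambda>p. bessel_diag_coeff z (of_nat M) N p *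
      (int_gbinomial (of_int (j + l) + 2 * p) j + int_gbinomial (of_int (j + l) + 2 * p) l)) 0
    = deriv (\<lambda>p. 2 * q (c + p)) 0"
  proof (rule deriv_gbinomial_pair)
    show "bessel_diag_coeff z (of_nat M) N holomorphic_on UNIV"
      by (rule bessel_diag_coeff_holomorphic[OF z])
    show "(\<lambda>p. 2 * q (c + p)) field_differentiable at 0"
      using deriv_translate(1)[OF q] by (intro field_differentiable_mult) auto
    show "\<forall>\<^sub>F p in at 0. 2 * q (c + p) = 2 * bessel_diag_coeff z (of_nat M) N p *
        (Gamma (of_int (j + l) + 1 + 2 * p) * rGamma (of_int j + 1 + p) * rGamma (of_int l + 1 + p))"
      using nonpos_Ints_avoid_punctured[of "int N - int M"]
    proof eventually_elim
      case (elim p)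
      define u where "u = c + p"
      have u: "2 * u \<notin> \<int>" using elim by (simp add: u_def c_def)
      have e: "of_int (j + l) + 1 + 2 * p = 2 * u + 1 + of_nat M" "of_int j + 1 + p = u + 1 + of_nat M"
        "of_int l + 1 + p = u + 1" "of_nat N + (1 - of_nat M) + p = u + 1"
        "of_nat N + 1 + p = u + 1 + of_nat M" "2 * of_nat N - of_nat M + 2 * p = 2 * u + of_nat M"
        by (simp_all add: u_def c_def j_def l_def algebra_simps)
      show ?case
        unfolding q_def u_def[symmetric] meijer_kernel_eq[OF u] bessel_diag_coeff_def e
        by (simp add: power2_eq_square mult_ac)
    qed
    have "rGamma (of_int (int N - int M) + 1 :: complex) = 0" if "N < M"
    proof -
      have "of_int (int N - int M) + 1 = (- of_nat (M - N - 1) :: complex)"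
        using that by (simp add: of_nat_diff)
      then show ?thesis by (simp add: rGamma_eq_zero_iff)
    qed
    then show "0 \<le> j + l \<or> bessel_diag_coeff z (of_nat M) N 0 = 0 \<and> l < 0"
      by (auto simp: j_def l_def bessel_diag_coeff_def algebra_simps)
  qed (simp add: j_def)
  also have "deriv (\<lambda>p. 2 * q (c + p)) 0 = 2 * deriv q c"
    using deriv_translate[OF q] by simp
  finally show ?thesis
    by (simp add: j_def l_def c_def q_def)
qed

text \<open>
  The three summands belong to the Bessel term and to the two Meijer functions; with \<open>A = 2 * u + M\<close>
  they are proportional to \<open>1\<close>, \<open>1 / A\<close> and \<open>1 / (A - 1)\<close>.
\<close>

definition meijer_sum_kernel :: "complex \<Rightarrow> nat \<Rightarrow> complex \<Rightarrow> complex" where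
  "meijer_sum_kernel z M u = pochhammer (2 * u + 1) M * meijer_kernel z M u
     + of_nat M ^ 2 * (pochhammer (2 * u + 1) (M - 1) * meijer_kernel z M u)
     + (1 - of_nat M ^ 2) * (pochhammer (2 * u + 1) (M - 2) * (2 * u + of_nat M) * meijer_kernel z M u)"

text \<open>For \<open>M = 1\<close> the truncated \<open>M - 2\<close> is masked by the coefficient
  \<open>1 - M ^ 2 = 0\<close>.\<close>

lemma meijer_sum_kernel_one: "meijer_sum_kernel z 1 u = (u + 1) * (2 * meijer_kernel z 1 u)"
  by (simp add: meijer_sum_kernel_def algebra_simps)

text \<open>The factors \<open>u\<close> and \<open>u + M\<close> are exactly what lowers
  \<open>rGamma (u + 1)\<close> to \<open>rGamma u\<close> and \<open>rGamma (u + 1 + M)\<close> to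
  \<open>rGamma (u + M)\<close>, the lower Gamma factors of the binomials in the series of
  \<open>P\<close>.\<close>

lemma meijer_sum_kernel_ge_2:
  assumes "M \<ge> 2"
  shows "meijer_sum_kernel z M u
    = (u + of_nat M) * (4 * u * pochhammer (2 * u + 1) (M - 2) * meijer_kernel z M u)"
proof -
  obtain k where M: "M = Suc (Suc k)" using assms by (metis add_2_eq_Suc le_Suc_ex)
  define m where "m = (of_nat M :: complex)"
  have e: "pochhammer (2 * u + 1) (M - 1) = pochhammer (2 * u + 1) k * (2 * u + m - 1)"
    "pochhammer (2 * u + 1) M = pochhammer (2 * u + 1) k * (2 * u + m - 1) * (2 * u + m)" "M - 2 = k"
    by (simp_all add: M m_def pochhammer_Suc algebra_simps)
  have "meijer_sum_kernel z M u = pochhammer (2 * u + 1) k * meijer_kernel z M u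
      * ((2 * u + m - 1) * (2 * u + m) + m ^ 2 * (2 * u + m - 1) + (1 - m ^ 2) * (2 * u + m))"
    unfolding meijer_sum_kernel_def m_def[symmetric] e by (simp add: algebra_simps)
  also have "(2 * u + m - 1) * (2 * u + m) + m ^ 2 * (2 * u + m - 1) + (1 - m ^ 2) * (2 * u + m)
      = 4 * u * (u + m)"
    by (simp add: algebra_simps power2_eq_square)
  finally show ?thesis by (simp add: M m_def mult_ac)
qed

lemma meijer_sum_kernel_differentiable:
  assumes "z \<noteq> 0"
  shows "meijer_sum_kernel z M field_differentiable at (of_int j)"
  unfolding meijer_sum_kernel_def[abs_def] pochhammer_prod
  by (intro field_differentiable_at_int holomorphic_intros assms)

text \<open>
  For \<open>M = N = 1\<close> the factor \<open>Gamma (2 * u + M - 1)\<close> has a pole at \<open>u = 0\<close> where the diagonal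
  coefficient does not vanish, so this case escapes \<open>deriv_gbinomial_pair\<close>.
\<close>

lemma deriv_P_coeff_one_one:
  assumes z: "z \<noteq> 0"
  shows "deriv (bessel_diag_coeff z 1 1) 0 = deriv (\<lambda>p. meijer_sum_kernel z 1 (0 + p) / 2) 0"
proof -
  define w where "w = bessel_diag_coeff z 1 1"
  have w': "(w has_field_derivative deriv w 0) (at 0)"
    using holomorphic_derivI[OF bessel_diag_coeff_holomorphic[OF z, of 1 1 UNIV]] by (simp add: w_def)
  \<comment> \<open>The logarithmic derivative at 0 is twice the digamma value at 1 minus the same
    amount, so multiplying by this factor, which is 1 at 0, preserves the derivative.\<close>
  have "((\<lambda>p. Gamma (2 * p + 1) * rGamma (p + 1) ^ 2) has_field_derivative 0) (at (0 :: complex))"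
    by (rule derivative_eq_intros refl | simp)+
  from DERIV_mult[OF w' this]
  have E: "((\<lambda>p. w p * (Gamma (2 * p + 1) * rGamma (p + 1) ^ 2)) has_field_derivative deriv w 0) (at 0)"
    by simp
  have "deriv (\<lambda>p. meijer_sum_kernel z 1 (0 + p) / 2) 0
      = deriv (\<lambda>p. w p * (Gamma (2 * p + 1) * rGamma (p + 1) ^ 2)) 0"
  proof (rule deriv_eq_punctured)
    show "(\<lambda>p. meijer_sum_kernel z 1 (0 + p) / 2) field_differentiable at 0"
      using meijer_sum_kernel_differentiable[OF z, of 1 0]
      by (intro field_differentiable_divide) auto
    show "(\<lambda>p. w p * (Gamma (2 * p + 1) * rGamma (p + 1) ^ 2)) field_differentiable at 0"
      using E by (auto simp: field_differentiable_def)
    show "\<forall>\<^sub>F p in at 0. meijer_sum_kernel z 1 (0 + p) / 2 = w p * (Gamma (2 * p + 1) * rGamma (p + 1) ^ 2)"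
      using nonpos_Ints_avoid_punctured[of 0]
    proof eventually_elim
      case (elim p)
      then have p: "2 * p \<notin> \<int>" by simp
      have r: "rGamma (p + 1) = (p + 1) * rGamma (p + 2)"
        using rGamma_plus1[of "p + 1"] by (simp add: add.assoc)
      have "meijer_sum_kernel z 1 (0 + p) / 2
          = (p + 1) * (Gamma (2 * p + 1) * rGamma (p + 1) ^ 2 * rGamma (p + 2) ^ 2 * (z / 2) powr (2 * p + 1))"
        unfolding meijer_sum_kernel_one using meijer_kernel_eq[OF p, of 0 z 1] by (simp add: add.assoc)
      also have "\<dots> = Gamma (2 * p + 1) * rGamma (p + 1) ^ 2 * ((p + 1) * rGamma (p + 2)) * rGamma (p + 2)
          * (z / 2) powr (2 * p + 1)"
        by (simp add: power2_eq_square mult_ac)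
      also have "\<dots> = w p * (Gamma (2 * p + 1) * rGamma (p + 1) ^ 2)"
        unfolding r[symmetric] w_def bessel_diag_coeff_def by (simp add: mult_ac add_ac)
      finally show ?case .
    qed
  qed
  then show ?thesis using DERIV_imp_deriv[OF E] by (simp add: w_def)
qed

lemma deriv_P_coeff:
  assumes z: "z \<noteq> 0" and "M \<ge> 1"
  shows "deriv (\<lambda>p. bessel_diag_coeff z (of_nat M) N p *
           (int_gbinomial (2 * of_nat N - of_nat M - 2 + 2 * p) (int N - 1)
            + int_gbinomial (2 * of_nat N - of_nat M - 2 + 2 * p) (int N - int M - 1))) 0
    = deriv (meijer_sum_kernel z M) (of_int (int N - int M)) / 2"
proof -
  define c where "c = (of_int (int N - int M) :: complex)"
  have q: "meijer_sum_kernel z M field_differentiable at c"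
    unfolding c_def by (rule meijer_sum_kernel_differentiable[OF z])
  note qt = deriv_translate[OF q]
  have H: "(\<lambda>p. meijer_sum_kernel z M (c + p) / 2) field_differentiable at 0"
    using qt(1) by (intro field_differentiable_divide) auto
  have H': "deriv (\<lambda>p. meijer_sum_kernel z M (c + p) / 2) 0 = deriv (meijer_sum_kernel z M) c / 2"
    using qt by (subst deriv_cdivide_right) auto
  \<comment> \<open>The pair identity needs \<open>j = N - 1 \<ge> 0\<close> and, if
    \<open>j + l < 0\<close>, a zero of the diagonal coefficient, that is \<open>N < M\<close>. The
    first fails for \<open>N = 0\<close>, the second only for \<open>N = M = 1\<close>.\<close>
  consider "N = 0" | "N = 1" "M = 1" | "N \<ge> 1" "M \<ge> 2 \<or> N \<ge> 2"
    using \<open>M \<ge> 1\<close> by linarith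
  then show ?thesis
  proof cases
    case 1
    \<comment> \<open>Both binomials vanish for \<open>N = 0\<close>, so a zero derivative is
      wanted: \<open>u + M\<close> and \<open>T\<close> both vanish at \<open>u = - M\<close>, a
      zero of order at least two.\<close>
    define T where "T = (if M = 1 then (\<lambda>u. 2 * meijer_kernel z M u)
      else (\<lambda>u. 4 * u * pochhammer (2 * u + 1) (M - 2) * meijer_kernel z M u))"
    have "T field_differentiable at c"
      unfolding c_def
    proof (rule field_differentiable_at_int)
      show "T holomorphic_on ball (of_int j) (1/2)" for j
        unfolding T_def pochhammer_prod using z by (cases "M = 1") (auto intro!: holomorphic_intros)
    qed
    then have T': "(T has_field_derivative deriv T c) (at c)"
      by (simp add: DERIV_deriv_iff_field_differentiable)
    have c: "c = - of_nat M" by (simp add: c_def 1)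
    have "rGamma (c + 1) = 0"
    proof -
      have "c + 1 = - of_nat (M - 1)" using \<open>M \<ge> 1\<close> by (simp add: c of_nat_diff)
      then show ?thesis by (simp add: rGamma_eq_zero_iff)
    qed
    then have T0: "T c = 0" by (simp add: T_def meijer_kernel_def)
    have "meijer_sum_kernel z M = (\<lambda>u. (u + of_nat M) * T u)"
      using meijer_sum_kernel_one[of z] meijer_sum_kernel_ge_2[of M z] \<open>M \<ge> 1\<close>
      by (cases "M = 1") (auto simp: T_def fun_eq_iff)
    moreover have "((\<lambda>u. (u + of_nat M) * T u) has_field_derivative 0) (at c)"
      by (rule derivative_eq_intros T' refl | simp add: T0)+ (simp add: c)
    ultimately have "deriv (meijer_sum_kernel z M) c = 0" by (simp add: DERIV_imp_deriv)
    then show ?thesis by (simp add: 1 int_gbinomial_def c_def)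
  next
    case 2
    then show ?thesis
      using deriv_P_coeff_one_one[OF z] H' by (simp add: int_gbinomial_def c_def)
  next
    case 3
    define j l where "j = int N - 1" and "l = int N - int M - 1"
    have "deriv (\<lambda>p. bessel_diag_coeff z (of_nat M) N p *
        (int_gbinomial (of_int (j + l) + 2 * p) j + int_gbinomial (of_int (j + l) + 2 * p) l)) 0
      = deriv (\<lambda>p. meijer_sum_kernel z M (c + p) / 2) 0"
    proof (rule deriv_gbinomial_pair[OF bessel_diag_coeff_holomorphic[OF z] H])
      show "\<forall>\<^sub>F p in at 0. meijer_sum_kernel z M (c + p) / 2 = 2 * bessel_diag_coeff z (of_nat M) N p *
          (Gamma (of_int (j + l) + 1 + 2 * p) * rGamma (of_int j + 1 + p) * rGamma (of_int l + 1 + p))"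
        using nonpos_Ints_avoid_punctured[of "int N - int M"]
      proof eventually_elim
        case (elim p)
        define u where "u = c + p"
        have u: "2 * u \<notin> \<int>" using elim by (simp add: u_def c_def)
        have e: "of_int (j + l) + 1 + 2 * p = 2 * u + of_nat M - 1" "of_int j + 1 + p = u + of_nat M"
          "of_int l + 1 + p = u" "of_nat N + (1 - of_nat M) + p = u + 1"
          "of_nat N + 1 + p = u + 1 + of_nat M" "2 * of_nat N - of_nat M + 2 * p = 2 * u + of_nat M"
          by (simp_all add: u_def c_def j_def l_def algebra_simps)
        have r1: "rGamma u = u * rGamma (u + 1)" by (rule rGamma_plus1[symmetric])
        have r2: "rGamma (u + of_nat M) = (u + of_nat M) * rGamma (u + 1 + of_nat M)"
          using rGamma_plus1[of "u + of_nat M"] by (simp add: add_ac)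
        have "meijer_sum_kernel z M u / 2 = 2 * (rGamma (u + 1) * rGamma (u + 1 + of_nat M)
          * (z / 2) powr (2 * u + of_nat M)) * (Gamma (2 * u + of_nat M - 1) * rGamma (u + of_nat M) * rGamma u)"
        proof (cases "M = 1")
          case False
          with \<open>M \<ge> 1\<close> have M: "M \<ge> 2" by simp
          have "2 * u + 1 + of_nat (M - 2) = 2 * u + of_nat M - 1" using M by (simp add: of_nat_diff)
          then show ?thesis
            using meijer_kernel_eq[OF u, of "M - 2" z M] unfolding meijer_sum_kernel_ge_2[OF M] r1 r2
            by (simp only:) (simp add: power2_eq_square mult_ac)
        next
          case True
          have "2 * u \<notin> \<int>\<^sub>\<le>\<^sub>0" using u by (auto elim: nonpos_Ints_cases')
          then have g: "Gamma (2 * u + 1) = 2 * u * Gamma (2 * u)" by (rule Gamma_plus1)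
          have "rGamma (u + 1) = (u + 1) * rGamma (u + 1 + 1)" by (rule rGamma_plus1[symmetric])
          moreover have "meijer_kernel z 1 u = 2 * u * Gamma (2 * u) * rGamma (u + 1) ^ 2
              * rGamma (u + 1 + 1) ^ 2 * (z / 2) powr (2 * u + 1)"
            using meijer_kernel_eq[OF u, of 0 z 1]
            unfolding pochhammer_0 mult_1 of_nat_0 of_nat_1 add_0_right g .
          ultimately show ?thesis
            unfolding True meijer_sum_kernel_one r1 by (simp add: power2_eq_square mult_ac)
        qed
        then show ?case
          unfolding u_def[symmetric] bessel_diag_coeff_def e .
      qed
      have "rGamma (of_int (int N - int M) + 1 :: complex) = 0" if "N < M"
      proof -
        have "of_int (int N - int M) + 1 = (- of_nat (M - N - 1) :: complex)"
          using that by (simp add: of_nat_diff)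
        then show ?thesis by (simp add: rGamma_eq_zero_iff)
      qed
      moreover have "N < M" if "j + l < 0" using 3 that unfolding j_def l_def by linarith
      ultimately show "0 \<le> j + l \<or> bessel_diag_coeff z (of_nat M) N 0 = 0 \<and> l < 0"
        by (auto simp: l_def bessel_diag_coeff_def algebra_simps not_le)
    qed (use 3 in \<open>simp add: j_def\<close>)
    moreover have "of_int (j + l) + 2 * p = 2 * of_nat N - of_nat M - 2 + 2 * p" for p :: complex
      by (simp add: j_def l_def)
    ultimately show ?thesis
      unfolding H' by (simp only: j_def l_def c_def)
  qed
qed

section \<open>The identity\<close>

lemma bessel_P_of_nat:
  fixes M :: nat and x :: real
  assumes "M \<ge> 1" and "x > 0"
  defines "z \<equiv> complex_of_real x" and "m \<equiv> (of_nat M :: complex)"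
  shows "bessel_P (int M) z = (-1) ^ (M + 1) / 4 *
      (of_real pi * (bessel_Y 0 z * bessel_J m z + bessel_J 0 z * bessel_Y m z)
       + of_real (sqrt pi) * m\<^sup>2
         * meijer_G_3_0_2_4 (z\<^sup>2) (1/2) 1 (- m/2) (m/2) (m/2) (- m/2)
       + of_real (sqrt pi) * (1 - m\<^sup>2) * z
         * meijer_G_3_0_2_4 (z\<^sup>2) (- 1/2) 1
             (- (m + 1)/2) ((m - 1)/2) ((m - 1)/2) (- (m + 1)/2))"
    (is "_ = _ * (?YJ + ?G1 + ?G2)")
proof -
  have z: "z \<noteq> 0" using assms(2) by (simp add: z_def)
  define c where "c N = (of_int (int N - int M) :: complex)" for N
  define q0 where "q0 = (\<lambda>u. pochhammer (2 * u + 1) M * meijer_kernel z M u)"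
  define q1 where "q1 = (\<lambda>u. pochhammer (2 * u + 1) (M - 1) * meijer_kernel z M u)"
  define q2 where "q2 = (\<lambda>u. pochhammer (2 * u + 1) (M - 2) * (2 * u + m) * meijer_kernel z M u)"
  define e :: "nat \<Rightarrow> complex" where "e N = (-1) ^ (M + N)" for N
  have powi: "(-1) powi (int N - int M) = e N" for N
    by (simp add: e_def power_int_minus_left minus_one_power_iff)
  have "q0 field_differentiable at (c N)" "q1 field_differentiable at (c N)"
    "q2 field_differentiable at (c N)" for N
    unfolding c_def q0_def q1_def q2_def pochhammer_prod
    by (intro field_differentiable_at_int holomorphic_intros z)+
  then have D: "(q0 has_field_derivative deriv q0 (c N)) (at (c N))"
    "(q1 has_field_derivative deriv q1 (c N)) (at (c N))"
    "(q2 has_field_derivative deriv q2 (c N)) (at (c N))" for N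
    by (simp_all add: DERIV_deriv_iff_field_differentiable)
  have "(meijer_sum_kernel z M has_field_derivative
      (deriv q0 (c N) + m ^ 2 * deriv q1 (c N) + (1 - m ^ 2) * deriv q2 (c N))) (at (c N))" for N
    using DERIV_add[OF DERIV_add[OF D(1) DERIV_cmult[OF D(2), of "m ^ 2"]] DERIV_cmult[OF D(3), of "1 - m ^ 2"]]
    by (simp add: meijer_sum_kernel_def[abs_def] q0_def q1_def q2_def m_def)
  then have sum': "deriv (meijer_sum_kernel z M) (c N)
      = deriv q0 (c N) + m ^ 2 * deriv q1 (c N) + (1 - m ^ 2) * deriv q2 (c N)" for N
    by (rule DERIV_imp_deriv)
  have YJ: "(\<lambda>N. e N * (2 * deriv q0 (c N))) sums ?YJ"
    using bessel_YJ_sums[OF z, of M] unfolding deriv_YJ_coeff[OF z] by (simp add: e_def q0_def c_def m_def)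
  have "(\<lambda>N. 2 * e N * deriv q1 (c N))
      sums (of_real (sqrt pi) * meijer_G_3_0_2_4 (z\<^sup>2) (1/2) 1 (- m/2) (m/2) (m/2) (- m/2))"
    using meijer_G_first_sums[OF assms(2,1)] by (simp only: powi q1_def c_def z_def m_def)
  from sums_mult[OF this, of "m\<^sup>2"] have G1: "(\<lambda>N. m\<^sup>2 * (2 * e N * deriv q1 (c N))) sums ?G1"
    by (simp only: mult_ac)
  have G2: "(\<lambda>N. (1 - m\<^sup>2) * (2 * e N * deriv q2 (c N))) sums ?G2"
  \<comment> \<open>\<open>M = 1\<close> lies outside \<open>meijer_G_second_sums\<close>; there
    \<open>1 - m\<^sup>2 = 0\<close> makes the summand zero.\<close>
  proof (cases "M = 1")
    case True
    then show ?thesis by (simp add: m_def)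
  next
    case False
    then have "(\<lambda>N. 2 * e N * deriv q2 (c N)) sums (of_real (sqrt pi) * z * meijer_G_3_0_2_4 (z\<^sup>2) (- 1/2) 1
             (- (m + 1)/2) ((m - 1)/2) ((m - 1)/2) (- (m + 1)/2))"
      using meijer_G_second_sums[OF assms(2), of M] assms(1) by (simp only: powi q2_def c_def z_def m_def)
    from sums_mult[OF this, of "1 - m\<^sup>2"] show ?thesis by (simp only: mult_ac)
  qed
  from sums_mult[OF sums_add[OF sums_add[OF YJ G1] G2], of "(-1) ^ (M + 1) / 4"]
  have "(\<lambda>N. (-1) ^ (M + 1) / 4 * (2 * e N * deriv (meijer_sum_kernel z M) (c N)))
      sums ((-1) ^ (M + 1) / 4 * (?YJ + ?G1 + ?G2))"
    by (simp add: sum' algebra_simps)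
  \<comment> \<open>Origin of the \<open>1/4\<close> in the theorem: the factor 2 of the residues
    against the \<open>1/2\<close> of \<open>deriv_P_coeff\<close>.\<close>
  moreover have sign: "(-1) ^ (M + 1) / 4 * (2 * e N * d) = (-1) ^ Suc N * (d / 2)" for N d
    by (simp add: e_def power_add flip: power_mult_distrib mult.assoc)
  ultimately have "(\<lambda>N. (-1) ^ Suc N * (deriv (meijer_sum_kernel z M) (c N) / 2))
      sums ((-1) ^ (M + 1) / 4 * (?YJ + ?G1 + ?G2))" by (simp only: sign)
  moreover have "(\<lambda>N. (-1) ^ Suc N * (deriv (meijer_sum_kernel z M) (c N) / 2)) sums bessel_P (int M) z"
    using bessel_P_sums(2)[OF z, of M] unfolding deriv_P_coeff[OF z assms(1)] c_def .
  ultimately show ?thesis by (rule sums_unique2[rotated])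
qed

section \<open>Reflection to negative \<open>\<mu>\<close>\<close>

lemma meijer_G_integrand_swap:
  fixes b b' s :: complex
  assumes b': "b' = b + of_nat M" and "b + s \<notin> \<int>\<^sub>\<le>\<^sub>0" "b' + s \<notin> \<int>\<^sub>\<le>\<^sub>0"
  shows "meijer_G_integrand a1 a2 b' b b b' z s = (-1) ^ M * meijer_G_integrand a1 a2 b b' b' b z s"
proof -
  \<comment> \<open>This turns the last factor into one more Gamma times a sine. Both integrands
    then contain the squares of the same two Gamma factors and differ only in the sines, whose
    arguments are \<open>M * \<pi>\<close> apart.\<close>
  have reflect: "rGamma (1 - d - s) = Gamma (d + s) * (sin (of_real pi * (d + s)) / of_real pi)"
    if "d + s \<notin> \<int>\<^sub>\<le>\<^sub>0" for d
  proof -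
    have "rGamma (1 - d - s) = Gamma (d + s) * (rGamma (d + s) * rGamma (1 - (d + s)))"
      using that by (simp add: rGamma_inverse_Gamma[of "d + s"] Gamma_eq_zero_iff diff_diff_eq)
    then show ?thesis by (simp only: rGamma_reflection_complex)
  qed
  have "sin (of_real pi * (b' + s)) = (-1) ^ M * sin (of_real pi * (b + s))"
    using sin_pi_nat_shift[of "b + s" M] by (simp add: b' add_ac)
  then show ?thesis
    unfolding meijer_G_integrand_def reflect[OF assms(2)] reflect[OF assms(3)] by (simp add: mult_ac)
qed

text \<open>Both loops enclose the same sequence \<open>\<sigma> - k\<close>, so it suffices to
  compare residues, for which the integrands are compared in punctured discs.\<close>

lemma meijer_G_swap:
  fixes \<sigma> :: real and z :: complex
  assumes "z \<noteq> 0" and b: "b = - of_real \<sigma>" "b' = of_nat M - of_real \<sigma>"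
  shows "meijer_G_3_0_2_4 z a1 a2 b' b b b' = (-1) ^ M * meijer_G_3_0_2_4 z a1 a2 b b' b' b"
proof -
  have "residue (meijer_G_integrand a1 a2 b' b b b' z) (of_real \<sigma> - of_nat k)
      = (-1) ^ M * residue (meijer_G_integrand a1 a2 b b' b' b z) (of_real \<sigma> - of_nat k)" for k
  proof -
    define s0 where "s0 = of_real \<sigma> - (of_nat k :: complex)"
    have regular: "b + s \<notin> \<int>\<^sub>\<le>\<^sub>0 \<and> b' + s \<notin> \<int>\<^sub>\<le>\<^sub>0" if "s \<in> ball s0 1 - {s0}" for s
    proof -
      have False if n: "s = of_real \<sigma> - of_nat n" for n
      proof -
        have "s0 - s = of_int (int n - int k)" by (simp add: s0_def n)
        moreover have "norm (s0 - s) < 1" "s0 - s \<noteq> 0"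
          using \<open>s \<in> ball s0 1 - {s0}\<close> by (auto simp: dist_norm)
        ultimately show False by (simp only: norm_of_int of_int_eq_0_iff)
      qed
      moreover have "\<exists>n. s = of_real \<sigma> - of_nat n" if "of_nat j - of_real \<sigma> + s \<in> \<int>\<^sub>\<le>\<^sub>0" for j :: nat
      proof -
        from that obtain n where "of_nat j - of_real \<sigma> + s = - of_nat n" by (elim nonpos_Ints_cases')
        then have "s = of_real \<sigma> - of_nat (j + n)" by (simp add: algebra_simps)
        then show ?thesis by blast
      qed
      from this[of 0] this[of M] have "\<exists>n. s = of_real \<sigma> - of_nat n"
        if "b + s \<in> \<int>\<^sub>\<le>\<^sub>0 \<or> b' + s \<in> \<int>\<^sub>\<le>\<^sub>0"
        using that by (auto simp: b)
      ultimately show ?thesis by blast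
    qed
    have "residue (meijer_G_integrand a1 a2 b' b b b' z) s0
        = residue (\<lambda>s. (-1) ^ M * meijer_G_integrand a1 a2 b b' b' b z s) s0"
    proof (rule residue_cong[OF _ refl])
      have "\<forall>\<^sub>F s in at s0. s \<in> ball s0 1 - {s0}"
        by (intro eventually_at_in_open) auto
      then show "\<forall>\<^sub>F s in at s0. meijer_G_integrand a1 a2 b' b b b' z s
          = (-1) ^ M * meijer_G_integrand a1 a2 b b' b' b z s"
        by eventually_elim (use regular b in \<open>auto intro!: meijer_G_integrand_swap\<close>)
    qed
    also have "\<dots> = (-1) ^ M * residue (meijer_G_integrand a1 a2 b b' b' b z) s0"
    proof (rule residue_lmul[of "ball s0 1"])
      show "meijer_G_integrand a1 a2 b b' b' b z holomorphic_on ball s0 1 - {s0}"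
        unfolding meijer_G_integrand_def[abs_def] using regular assms(1) by (intro holomorphic_intros) auto
    qed auto
    finally show ?thesis by (simp add: s0_def)
  qed
  then have res: "residue (meijer_G_integrand a1 a2 b' b b b' z) (of_real \<sigma> - of_nat k)
      = (-1) ^ M * residue (meijer_G_integrand a1 a2 b b' b' b z) (of_real \<sigma> - of_nat k)" for k .
  have "(\<lambda>k. residue (meijer_G_integrand a1 a2 b' b b b' z) (of_real \<sigma> - of_nat k))
      sums meijer_G_3_0_2_4 z a1 a2 b' b b b'"
    by (rule meijer_G_residue_sums[of z b' M \<sigma> b 0 b 0]) (use assms in auto)
  moreover have "(\<lambda>k. residue (meijer_G_integrand a1 a2 b b' b' b z) (of_real \<sigma> - of_nat k))
      sums meijer_G_3_0_2_4 z a1 a2 b b' b' b"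
    by (rule meijer_G_residue_sums[of z b 0 \<sigma> b' M b' M]) (use assms in auto)
  ultimately show ?thesis
    unfolding res by (intro sums_unique2[OF _ sums_mult])
qed

lemma bessel_P_term_uminus:
  "bessel_P_term (- \<mu>) z n = (-1) powi \<mu> * bessel_P_term \<mu> z n"
  by (simp add: bessel_P_term_def power_int_minus_left algebra_simps)

text \<open>Summability is asserted beside the identity because \<open>suminf\<close> takes some
  value on divergent series as well.\<close>

theorem mainTheorem3:
  fixes \<mu> :: int and x :: real
  assumes "\<mu> \<noteq> 0" and "x > 0"
  defines "z \<equiv> complex_of_real x" and "m \<equiv> (of_int \<mu> :: complex)"
  shows "summable (\<lambda>n. bessel_P_term \<mu> z (Suc n)) \<and>
    bessel_P \<mu> z = (-1) powi (\<mu> + 1) / 4 *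
      (of_real pi * (bessel_Y 0 z * bessel_J m z + bessel_J 0 z * bessel_Y m z)
       + of_real (sqrt pi) * m\<^sup>2
         * meijer_G_3_0_2_4 (z\<^sup>2) (1/2) 1 (- m/2) (m/2) (m/2) (- m/2)
       + of_real (sqrt pi) * (1 - m\<^sup>2) * z
         * meijer_G_3_0_2_4 (z\<^sup>2) (- 1/2) 1
             (- (m + 1)/2) ((m - 1)/2) ((m - 1)/2) (- (m + 1)/2))"
proof -
  have z: "z \<noteq> 0" using assms(2) by (simp add: z_def)
  define M where "M = nat \<bar>\<mu>\<bar>"
  define p where "p = (of_nat M :: complex)"
  define e :: complex where "e = (-1) ^ M"
  have M: "M \<ge> 1" using assms(1) by (simp add: M_def)
  have pos: "bessel_P (int M) z = - e / 4 *
      (of_real pi * (bessel_Y 0 z * bessel_J p z + bessel_J 0 z * bessel_Y p z)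
       + of_real (sqrt pi) * p\<^sup>2
         * meijer_G_3_0_2_4 (z\<^sup>2) (1/2) 1 (- p/2) (p/2) (p/2) (- p/2)
       + of_real (sqrt pi) * (1 - p\<^sup>2) * z
         * meijer_G_3_0_2_4 (z\<^sup>2) (- 1/2) 1
             (- (p + 1)/2) ((p - 1)/2) ((p - 1)/2) (- (p + 1)/2))"
    using bessel_P_of_nat[OF M assms(2)] unfolding z_def p_def e_def by simp
  show ?thesis
  proof (cases "\<mu> > 0")
    case True
    then have "\<mu> = int M" by (simp add: M_def)
    then show ?thesis
      using pos bessel_P_sums(1)[OF z, of M]
      by (simp add: m_def p_def e_def power_int_add)
  next
    case False
    then have \<mu>: "\<mu> = - int M" using assms(1) by (simp add: M_def)
    then have m: "m = - p" by (simp add: m_def p_def)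
    \<comment> \<open>Under the change of sign \<open>P\<close>, \<open>J\<close>, \<open>Y\<close>
      and both Meijer functions each acquire the factor \<open>e\<close>, while
      \<open>(-1) powi (\<mu> + 1)\<close> remains \<open>- e\<close>; so the identity for
      \<open>int M\<close> is multiplied by \<open>e\<close> on both sides.\<close>
    have ee: "e * e = 1" by (simp add: e_def flip: power_mult_distrib)
    have e_powi: "(-1) powi \<mu> = e" by (simp add: \<mu> e_def power_int_minus_one_minus)
    have "bessel_P_term \<mu> z n = e * bessel_P_term (int M) z n" for n
      using bessel_P_term_uminus[of "int M"] by (simp add: \<mu> e_def)
    then have term_eq: "(\<lambda>n. bessel_P_term \<mu> z (Suc n)) = (\<lambda>n. e * bessel_P_term (int M) z (Suc n))"
      by simp
    note sm = bessel_P_sums(1)[OF z, of M]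
    have P: "bessel_P \<mu> z = e * bessel_P (int M) z"
      unfolding bessel_P_def term_eq by (rule suminf_mult[OF sm])
    have J: "bessel_J m z = e * bessel_J p z"
      unfolding m p_def e_def by (rule bessel_J_minus_of_nat[OF z])
    have Y: "bessel_Y m z = e * bessel_Y p z"
    proof -
      have "of_real pi * bessel_Y m z = e * (of_real pi * bessel_Y p z)"
        using bessel_Y_of_int[OF z, of \<mu>] bessel_Y_of_int[OF z, of "int M"] ee e_powi
        by (simp add: \<mu> m_def p_def e_def algebra_simps)
      then show ?thesis by simp
    qed
    have G1: "meijer_G_3_0_2_4 (z\<^sup>2) (1/2) 1 (- m/2) (m/2) (m/2) (- m/2)
        = e * meijer_G_3_0_2_4 (z\<^sup>2) (1/2) 1 (- p/2) (p/2) (p/2) (- p/2)"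
      using meijer_G_swap[of "z\<^sup>2" "- p/2" "M / 2" "p / 2" M "1/2" 1] z
      by (simp add: m p_def e_def)
    have G2: "meijer_G_3_0_2_4 (z\<^sup>2) (- 1/2) 1 (- (m + 1)/2) ((m - 1)/2) ((m - 1)/2) (- (m + 1)/2)
        = e * meijer_G_3_0_2_4 (z\<^sup>2) (- 1/2) 1 (- (p + 1)/2) ((p - 1)/2) ((p - 1)/2) (- (p + 1)/2)"
    proof -
      have "- (m + 1)/2 = (p - 1)/2" "(m - 1)/2 = - (p + 1)/2" by (simp_all add: m)
      moreover have "meijer_G_3_0_2_4 (z\<^sup>2) (- 1/2) 1 ((p - 1)/2) (- (p + 1)/2) (- (p + 1)/2) ((p - 1)/2)
        = e * meijer_G_3_0_2_4 (z\<^sup>2) (- 1/2) 1 (- (p + 1)/2) ((p - 1)/2) ((p - 1)/2) (- (p + 1)/2)"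
        unfolding e_def
        by (rule meijer_G_swap[where \<sigma> = "(M + 1) / 2"]) (use z in \<open>auto simp: p_def field_simps\<close>)
      ultimately show ?thesis by simp
    qed
    have "(-1) powi (\<mu> + 1) = - e" using e_powi by (simp add: power_int_add)
    moreover have "summable (\<lambda>n. bessel_P_term \<mu> z (Suc n))"
      unfolding term_eq by (rule summable_mult[OF sm])
    ultimately show ?thesis
      unfolding P J Y G1 G2 pos by (simp add: m algebra_simps)
  qed
qed

end
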